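(* Let $T>0$ and let $\Omega$ be a $\mathcal C^2$ bounded domain of $\mathbb R^d$, $d\le 2$, with outward normal $n$. Let $0<a<b<+\infty$ be two constants and let $\mu=\mu(t,x):[0,T]\times\overline\Omega\to[a,b]$ be a smooth coefficient. Let $p>2$, let $f:[0,T]\times\overline\Omega\to\mathbb R$ be a smooth function and let $u_{\mathrm{in}}:\overline\Omega\to\mathbb R_+$ be a smooth function. Let $u\ge 0$ be a $\mathcal C^2$ function on $[0,T]\times\overline\Omega$ such that $$\begin{cases}\partial_t u-\Delta(\mu u)\le u f & \text{in }[0,T]\times\Omega,\\ \nabla(\mu u)\cdot n=0 & \text{on }[0,T]\times\partial\Omega,\\ u(0)=u_{\mathrm{in}} & \text{in }\Omega.\end{cases}$$ Then there exists a constant $C_p$, depending only on $\|f\|_{L^p([0,T]\times\Omega)}$, $T$, $\Omega$, $d$, $p$, $a$ and $b$ (in particular, depending on $\mu$ only through the bounds $a$ and $b$), such that $$\|u\|_{L^2([0,T]\times\Omega)}\le C_p\,\|u_{\mathrm{in}}\|_{L^2(\Omega)}.$$ *)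

theory Defs
  imports "HOL-Analysis.Analysis"
begin

text \<open>
  Functions of class $C^k$ on an arbitrary set \<open>S\<close>, with derivatives taken within \<open>S\<close>. On an open
  set this is the usual notion. On the closure of a $C^2$ domain, and on a compact time interval
  times such a closure, derivatives within the set are unique, and the definition says that all
  derivatives up to order \<open>k\<close> exist in the interior and extend continuously up to the boundary.
\<close>

primrec Ck_on :: "nat \<Rightarrow> 'a::real_normed_vector set \<Rightarrow> ('a \<Rightarrow> real) \<Rightarrow> bool" where
  "Ck_on 0 S g \<longleftrightarrow> continuous_on S g"
| "Ck_on (Suc k) S g \<longleftrightarrow>
     (\<exists>g'. (\<forall>x\<in>S. (g has_derivative g' x) (at x within S)) \<and> (\<forall>v. Ck_on k S (\<lambda>x. g' x v)))"

definition smooth_on :: "'a::real_normed_vector set \<Rightarrow> ('a \<Rightarrow> real) \<Rightarrow> bool" where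
  "smooth_on S g \<longleftrightarrow> (\<forall>k. Ck_on k S g)"

definition grad_within :: "'a::euclidean_space set \<Rightarrow> ('a \<Rightarrow> real) \<Rightarrow> 'a \<Rightarrow> 'a" where
  "grad_within S g x = (\<Sum>i\<in>Basis. frechet_derivative g (at x within S) i *\<^sub>R i)"

definition laplacian :: "('a::euclidean_space \<Rightarrow> real) \<Rightarrow> 'a \<Rightarrow> real" where
  "laplacian g x = (\<Sum>i\<in>Basis. frechet_derivative (\<lambda>y. frechet_derivative g (at y) i) (at x) i)"

text \<open>
  Near \<open>x0\<close>, the set \<open>\<Omega>\<close> is the part of the ball lying above the graph of a $C^2$ function, where
  the unit vector \<open>e\<close> gives the vertical direction. A function of the $d-1$ horizontal coordinates
  is represented by a function \<open>\<gamma>\<close> on the whole space that is invariant along \<open>e\<close>.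
\<close>

definition C2_graph_at ::
  "'a::euclidean_space set \<Rightarrow> 'a \<Rightarrow> real \<Rightarrow> 'a \<Rightarrow> ('a \<Rightarrow> real) \<Rightarrow> bool" where
  "C2_graph_at \<Omega> x0 r e \<gamma> \<longleftrightarrow>
     r > 0 \<and> norm e = 1 \<and> Ck_on 2 UNIV \<gamma> \<and> (\<forall>x. \<gamma> x = \<gamma> (x - (x \<bullet> e) *\<^sub>R e)) \<and>
     \<Omega> \<inter> ball x0 r = {x \<in> ball x0 r. x \<bullet> e > \<gamma> x}"

definition C2_bounded_domain :: "'a::euclidean_space set \<Rightarrow> bool" where
  "C2_bounded_domain \<Omega> \<longleftrightarrow>
     \<Omega> \<noteq> {} \<and> open \<Omega> \<and> connected \<Omega> \<and> bounded \<Omega> \<and>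
     (\<forall>x0\<in>frontier \<Omega>. \<exists>r e \<gamma>. C2_graph_at \<Omega> x0 r e \<gamma>)"

text \<open>
  Locally \<open>\<Omega>\<close> is the sublevel set where \<open>\<gamma> x - x \<bullet> e < 0\<close>. The gradient \<open>\<nabla>\<gamma> - e\<close> of this
  function is nonzero, since \<open>\<nabla>\<gamma>\<close> is orthogonal to \<open>e\<close>, and normalising it gives the outward
  unit normal (independently of the chosen graph representation).
\<close>

definition outward_unit_normal_at :: "'a::euclidean_space set \<Rightarrow> 'a \<Rightarrow> 'a \<Rightarrow> bool" where
  "outward_unit_normal_at \<Omega> x \<nu> \<longleftrightarrow>
     (\<exists>r e \<gamma>. C2_graph_at \<Omega> x r e \<gamma> \<and> \<nu> = sgn (grad_within UNIV \<gamma> x - e))"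

definition Lp_norm_on :: "real \<Rightarrow> 'a::euclidean_space set \<Rightarrow> ('a \<Rightarrow> real) \<Rightarrow> real" where
  "Lp_norm_on p S g = (LINT x:S|lborel. \<bar>g x\<bar> powr p) powr (1 / p)"

end

theory Submission
  imports Defs
begin

text \<open>
  Put \<open>w = \<mu> u\<close>, \<open>m = \<integral>\<^sub>0\<^sup>t w\<close> and \<open>F = \<integral>\<^sub>0\<^sup>t u \<bar>f\<bar>\<close>. Integrating the inequality in time gives
  \<open>u \<le> u\<^sub>i\<^sub>n + \<Delta>m + F\<close>. Testing with \<open>w = \<partial>\<^sub>t m \<ge> 0\<close>, and using that \<open>F\<close> is nondecreasing in time, yields
  \<open>\<integral>\<integral> u w + 1/2 \<integral> \<bar>\<nabla>m(t)\<bar>\<^sup>2 \<le> \<integral>\<integral> u\<^sub>i\<^sub>n w + \<integral> m(t) F(t)\<close>,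
  in which \<open>\<mu>\<close> enters only through \<open>a u \<le> w \<le> b u\<close>. In dimension at most two,
  $H^1 \subset L^q$ for all finite $q$, so with \<open>f \<in> L\<^sup>p\<close>, \<open>p > 2\<close>, the last term is at most
  $\|m(t)\|_{H^1} \int_0^t \|u\|_{L^2} P^{1/2}$ with a weight $P$ whose time integral is controlled by
  $\|f\|_{L^p}$. Absorbing the norm of $m(t)$ leaves a quadratic Gronwall inequality for
  $\int_0^t \|u\|_{L^2}^2$.
\<close>

section \<open>Integration of derivatives\<close>

text \<open>The constant may see \<open>\<mu>\<close> only through \<open>a\<close> and
  \<open>b\<close>, so no derivative of \<open>\<mu>\<close> may enter. Working with the time
  integral \<open>m\<close> achieves this: its gradient appears as an exact square and is never
  expanded in terms of \<open>\<mu>\<close>. Passing from \<open>f\<close> to its absolute value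
  makes \<open>F\<close> monotone in time, so its value at the final time can be taken out of the
  integral against \<open>w\<close>. Boundary terms vanish throughout, so the divergence theorem is
  needed only in the form that tangential fields have divergence of integral zero; a cutoff near the
  boundary proves this with volume integrals alone. The Sobolev bound is derived inside the domain
  from line integrals in two inward directions, so no extension operator enters. The condition p > 2
  makes the exponent 2p/(p-2) finite, hence dominated by an even integer. The norm of
  \<open>f\<close> enters the constant through the exponential of its p-th power, which is what
  Gronwall produces, while the norm of the initial datum factors out because the final inequality is
  homogeneous in the solution and its datum.\<close>

lemma set_integrable_bounded_continuous:
  fixes f :: "'a::euclidean_space \<Rightarrow> real"
  assumes "S \<in> sets borel" "bounded S" "continuous_on S f" "bounded (f ` S)"
  shows "set_integrable lborel S f"
proof -
  obtain B where B: "\<And>x. x \<in> S \<Longrightarrow> norm (f x) \<le> B"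
    using assms(4) by (auto simp: bounded_iff)
  have 1: "set_integrable lborel S (\<lambda>x. B)"
    using assms emeasure_bounded_finite[of S] by (simp add: set_integrable_def)
  show ?thesis
    unfolding set_integrable_def
  proof (rule Bochner_Integration.integrable_bound)
    show "integrable lborel (\<lambda>x. indicator S x *\<^sub>R B)"
      using 1 by (simp add: set_integrable_def)
    show "(\<lambda>x. indicator S x *\<^sub>R f x) \<in> borel_measurable lborel"
      using borel_measurable_continuous_on_indicator[OF assms(1,3)] by simp
    show "AE x in lborel. norm (indicat_real S x *\<^sub>R f x) \<le> norm (indicat_real S x *\<^sub>R B)"
      using B by (auto simp: indicator_def intro: order_trans[OF _ abs_ge_self])
  qed
qed

lemma lborel_integral_translate:
  fixes g :: "'a::euclidean_space \<Rightarrow> real"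
  assumes "g \<in> borel_measurable borel"
  shows "(\<integral>x. g (x + v) \<partial>lborel) = (\<integral>x. g x \<partial>lborel)"
proof -
  have "(\<integral>x. g x \<partial>lborel) = (\<integral>x. g x \<partial>(distr lborel borel ((+) v)))"
    by (simp add: lborel_distr_plus)
  also have "\<dots> = (\<integral>x. g (v + x) \<partial>lborel)"
    using assms by (subst integral_distr) auto
  finally show ?thesis by (simp add: add.commute)
qed

lemma lborel_nn_integral_translate:
  fixes g :: "'a::euclidean_space \<Rightarrow> ennreal"
  assumes "g \<in> borel_measurable borel"
  shows "(\<integral>\<^sup>+x. g (x + v) \<partial>lborel) = (\<integral>\<^sup>+x. g x \<partial>lborel)"
proof -
  have "(\<integral>\<^sup>+x. g x \<partial>lborel) = (\<integral>\<^sup>+x. g x \<partial>(distr lborel borel ((+) v)))"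
    by (simp add: lborel_distr_plus)
  also have "\<dots> = (\<integral>\<^sup>+x. g (v + x) \<partial>lborel)"
    using assms by (subst nn_integral_distr) auto
  finally show ?thesis by (simp add: add.commute)
qed

lemma has_derivative_along_line:
  assumes "(g has_derivative D) (at (x + t *\<^sub>R v))"
  shows "((\<lambda>t. g (x + t *\<^sub>R v)) has_vector_derivative D v) (at t within S)"
proof -
  have "((\<lambda>t. x + t *\<^sub>R v) has_vector_derivative v) (at t within S)"
    by (auto intro!: derivative_eq_intros)
  from vector_derivative_diff_chain_within[OF this, of g D] assms
  show ?thesis by (simp add: o_def has_derivative_at_withinI)
qed

lemma has_derivative_zero_off_support:
  assumes "(g has_derivative D) (at x)" "closed K" "x \<notin> K" "\<And>x. x \<notin> K \<Longrightarrow> g x = 0"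
  shows "D = (\<lambda>_. 0)"
proof -
  have "((\<lambda>_. 0) has_derivative D) (at x)"
    by (rule has_derivative_transform_within_open[OF assms(1), of "-K"])
      (use assms in auto)
  then show ?thesis
    by (rule has_derivative_unique) simp
qed

text \<open>The translates \<open>x \<mapsto> g (x + t v)\<close> all have the same integral; differentiate at \<open>t = 0\<close>.\<close>

lemma integral_derivative_compact_support:
  fixes g :: "'a::euclidean_space \<Rightarrow> real"
  assumes D: "\<And>x. (g has_derivative D x) (at x)"
    and cont: "continuous_on UNIV (\<lambda>x. D x v)"
    and K: "compact K" "\<And>x. x \<notin> K \<Longrightarrow> g x = 0"
  shows "(\<integral>x. D x v \<partial>lborel) = 0"
proof -
  have D0: "D x v = 0" if "x \<notin> K" for x
    using has_derivative_zero_off_support[OF D compact_imp_closed[OF K(1)] that K(2)] by simp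
  have gcont: "continuous_on UNIV g"
    using D by (meson continuous_at_imp_continuous_on has_derivative_continuous)
  then have gmeas[measurable]: "g \<in> borel_measurable borel"
    by (rule borel_measurable_continuous_onI)
  have "compact ((\<lambda>x. D x v) ` K)"
    using K(1) cont by (meson compact_continuous_image continuous_on_subset subset_UNIV)
  then obtain M where M: "\<And>x. x \<in> K \<Longrightarrow> \<bar>D x v\<bar> \<le> M"
    by (metis compact_imp_bounded bounded_iff imageI real_norm_def)
  define M' where "M' = max M 0"
  have M': "\<bar>D x v\<bar> \<le> M'" for x
    using M[of x] D0[of x] by (cases "x \<in> K") (auto simp: M'_def)
  \<comment> \<open>\<open>K'\<close> is swept out by \<open>K\<close> under backward shifts along
    \<open>v\<close> by times in [0,1]. Every quotient \<open>q k\<close> has step at most 1, so all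
    of them are supported in this one compact set.\<close>
  define K' where "K' = (\<lambda>(x, t). x - t *\<^sub>R v) ` (K \<times> {0..1::real})"
  have K': "compact K'"
    unfolding K'_def
    by (intro compact_continuous_image compact_Times K) (auto intro!: continuous_intros simp: split_beta)
  define q where "q k x = (g (x + (1 / Suc k) *\<^sub>R v) - g x) / (1 / Suc k)" for k :: nat and x
  have gint: "integrable lborel g"
  proof -
    have "integrable lborel (\<lambda>x. indicator K x *\<^sub>R g x)"
      using K(1) gcont by (intro borel_integrable_compact) (auto intro: continuous_on_subset)
    moreover have "(\<lambda>x. indicator K x *\<^sub>R g x) = g"
      using K(2) by (intro ext) (auto simp: indicator_def)
    ultimately show ?thesis by simp
  qed
  have gint': "integrable lborel (\<lambda>x. g (x + w))" for w
  proof -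
    have "integrable (distr lborel borel ((+) w)) g"
      using gint by (simp add: lborel_distr_plus)
    then show ?thesis
      by (subst (asm) integrable_distr_eq) (auto simp: add.commute)
  qed
  have q0: "(\<integral>x. q k x \<partial>lborel) = 0" for k
    unfolding q_def
    using gint gint' lborel_integral_translate[OF gmeas]
    by (simp add: Bochner_Integration.integral_diff)
  \<comment> \<open>Uniform domination by the mean value theorem: the quotient is the derivative at
    an intermediate point of the segment, hence bounded by \<open>M'\<close>, and such a point can
    lie in \<open>K\<close> only if \<open>x\<close> lies in \<open>K'\<close>.\<close>
  have bd: "\<bar>q k x\<bar> \<le> indicator K' x * M'" for k x
  proof -
    define h where "h = 1 / real (Suc k)"
    have h: "h > 0" "h \<le> 1" by (auto simp: h_def)
    obtain z where z: "z \<in> {0<..<h}" "g (x + h *\<^sub>R v) - g x = D (x + z *\<^sub>R v) v * h"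
    proof -
      have "\<exists>z>0. z < h \<and> g (x + h *\<^sub>R v) - g (x + 0 *\<^sub>R v) = (h - 0) * D (x + z *\<^sub>R v) v"
        using h has_derivative_along_line[OF D, where x = x and v = v and S = UNIV]
        by (intro MVT2) (auto simp: has_real_derivative_iff_has_vector_derivative)
      then show ?thesis using that by (auto simp: mult.commute)
    qed
    then have eq: "q k x = D (x + z *\<^sub>R v) v"
      using h by (simp add: q_def h_def)
    show ?thesis
    proof (cases "x \<in> K'")
      case True
      then show ?thesis using M' eq by simp
    next
      case False
      have "x + z *\<^sub>R v \<notin> K"
      proof
        assume "x + z *\<^sub>R v \<in> K"
        moreover have "x = (x + z *\<^sub>R v) - z *\<^sub>R v" by simp
        moreover have "z \<in> {0..1}" using z h by auto
        ultimately have "x \<in> K'"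
          unfolding K'_def by (intro image_eqI[where x = "(x + z *\<^sub>R v, z)"]) auto
        with False show False by simp
      qed
      then show ?thesis using D0 eq False by simp
    qed
  qed
  have lim: "(\<lambda>k. q k x) \<longlonglongrightarrow> D x v" for x
  proof -
    have "((\<lambda>t. g (x + t *\<^sub>R v)) has_real_derivative D x v) (at 0)"
      using has_derivative_along_line[of g "D x" x 0 v UNIV] D
      by (simp add: has_real_derivative_iff_has_vector_derivative)
    then have "((\<lambda>h. (g (x + h *\<^sub>R v) - g x) / h) \<longlongrightarrow> D x v) (at 0)"
      by (simp add: DERIV_def)
    moreover have "filterlim (\<lambda>k. 1 / real (Suc k)) (at 0) sequentially"
      unfolding filterlim_at using LIMSEQ_inverse_real_of_nat by (auto simp: inverse_eq_divide)
    ultimately show ?thesis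
      unfolding q_def using filterlim_compose by blast
  qed
  have "(\<lambda>k. \<integral>x. q k x \<partial>lborel) \<longlonglongrightarrow> (\<integral>x. D x v \<partial>lborel)"
  proof (rule integral_dominated_convergence)
    show "integrable lborel (\<lambda>x. indicator K' x * M')"
      using borel_integrable_compact[OF K', of "\<lambda>_. M'"] by simp
    show "(\<lambda>x. D x v) \<in> borel_measurable lborel"
      using borel_measurable_continuous_onI[OF cont] by simp
    show "q k \<in> borel_measurable lborel" for k
      unfolding q_def by measurable
  qed (use lim bd in auto)
  then show ?thesis
    unfolding q0 using LIMSEQ_unique tendsto_const by blast
qed

text \<open>The derivative is extended by zero outside \<open>U\<close>. Since the function vanishes
  off \<open>K\<close>, the open sets \<open>U\<close> and \<open>- K\<close> cover the space and
  the extension is continuous on each, so the whole-space result applies.\<close>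

lemma set_integral_derivative_compact_support:
  fixes g :: "'a::euclidean_space \<Rightarrow> real"
  assumes U: "open U"
    and D: "\<And>x. x \<in> U \<Longrightarrow> (g has_derivative D x) (at x)"
    and cont: "continuous_on U (\<lambda>x. D x v)"
    and K: "compact K" "K \<subseteq> U" "\<And>x. x \<notin> K \<Longrightarrow> g x = 0"
  shows "(LINT x:U|lborel. D x v) = 0"
proof -
  have cl: "closed K" using K(1) compact_imp_closed by blast
  define E where "E x = (if x \<in> U then D x else (\<lambda>_. 0))" for x
  have E0: "E x v = 0" if "x \<notin> K" for x v
    using has_derivative_zero_off_support[OF D cl that K(3)] by (auto simp: E_def)
  have 1: "(g has_derivative E x) (at x)" for x
  proof (cases "x \<in> U")
    case False
    have "((\<lambda>_. 0) has_derivative (\<lambda>_. 0)) (at x)" by simp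
    then have "(g has_derivative (\<lambda>_. 0)) (at x)"
      by (rule has_derivative_transform_within_open[of _ _ _ _ "-K"])
        (use K False cl in auto)
    with False show ?thesis by (simp add: E_def)
  qed (use D E_def in simp)
  have "continuous_on (U \<union> - K) (\<lambda>x. E x v)"
  proof (rule continuous_on_open_Un)
    show "continuous_on U (\<lambda>x. E x v)"
      using cont by (rule continuous_on_eq) (auto simp: E_def)
    show "continuous_on (- K) (\<lambda>x. E x v)"
      by (rule continuous_on_eq[of _ "\<lambda>_. 0"]) (auto simp: E0)
  qed (use U cl in auto)
  then have 2: "continuous_on UNIV (\<lambda>x. E x v)"
    using K(2) by (metis Compl_partition2 Un_commute Un_mono boolean_algebra.disj_cancel_right order_refl top.extremum_uniqueI)
  have "(LINT x:U|lborel. D x v) = (\<integral>x. E x v \<partial>lborel)"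
    unfolding set_lebesgue_integral_def
    by (rule Bochner_Integration.integral_cong) (auto simp: E_def indicator_def)
  also have "\<dots> = 0"
    by (rule integral_derivative_compact_support[OF 1 2 K(1,3)])
  finally show ?thesis .
qed

section \<open>Local geometry of the boundary\<close>

text \<open>Invariance of \<open>\<gamma>\<close> along \<open>e\<close> makes the height above the
  graph an exact affine coordinate in the direction \<open>e\<close>. Both the normalisation of its
  gradient and the disjointness of translated boundary layers rest on this.\<close>

lemma C2_graph_at_shift:
  assumes "C2_graph_at \<Omega> x0 r e \<gamma>"
  shows "(x + t *\<^sub>R e) \<bullet> e - \<gamma> (x + t *\<^sub>R e) = x \<bullet> e - \<gamma> x + t"
proof -
  from assms have e: "norm e = 1" and inv: "\<And>x. \<gamma> x = \<gamma> (x - (x \<bullet> e) *\<^sub>R e)"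
    unfolding C2_graph_at_def by auto
  have ee: "e \<bullet> e = 1" using e by (simp add: dot_square_norm)
  have eq: "\<gamma> (x + t *\<^sub>R e) = \<gamma> x" for t
    using inv[of "x + t *\<^sub>R e"] inv[of x] by (simp add: inner_add_left ee algebra_simps)
  then show ?thesis by (simp add: inner_add_left ee)
qed

text \<open>\<open>N\<close> is the gradient of the height above the graph, that is, an inward
  normal that is not normalised. The identity \<open>N x \<bullet> e = 1\<close>, found by
  differentiating the height along \<open>e\<close>, is what keeps it away from zero.\<close>

lemma C2_graph_at_normal:
  assumes "C2_graph_at \<Omega> x0 r e \<gamma>"
  obtains N where "\<And>x. ((\<lambda>x. x \<bullet> e - \<gamma> x) has_derivative (\<lambda>h. N x \<bullet> h)) (at x)"
    and "continuous_on UNIV N" and "\<And>x. N x \<bullet> e = 1"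
    and "\<And>x. grad_within UNIV \<gamma> x - e = - N x"
proof -
  from assms have C2: "Ck_on (Suc (Suc 0)) UNIV \<gamma>"
    unfolding C2_graph_at_def by (auto simp: numeral_2_eq_2)
  from C2 obtain g where g: "\<And>x. (\<gamma> has_derivative g x) (at x)"
    and g1: "\<And>v. Ck_on (Suc 0) UNIV (\<lambda>x. g x v)"
    by auto
  have gc: "continuous_on UNIV (\<lambda>x. g x v)" for v
  proof -
    obtain g' where "\<And>x. ((\<lambda>x. g x v) has_derivative g' x) (at x)" using g1[of v] by auto
    then show ?thesis by (meson continuous_at_imp_continuous_on has_derivative_continuous)
  qed
  define N where "N x = e - (\<Sum>i\<in>Basis. g x i *\<^sub>R i)" for x
  have gsum: "g x h = (\<Sum>i\<in>Basis. g x i *\<^sub>R i) \<bullet> h" for x h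
  proof -
    interpret linear "g x" using g has_derivative_linear by blast
    have "g x h = g x (\<Sum>i\<in>Basis. (h \<bullet> i) *\<^sub>R i)" by (simp add: euclidean_representation)
    also have "\<dots> = (\<Sum>i\<in>Basis. (h \<bullet> i) * g x i)" by (simp add: sum scale)
    also have "\<dots> = (\<Sum>i\<in>Basis. (g x i *\<^sub>R i) \<bullet> h)"
      by (rule sum.cong) (simp_all add: inner_commute)
    finally show ?thesis by (simp only: inner_sum_left)
  qed
  have N_inner: "N x \<bullet> h = h \<bullet> e - g x h" for x h
    unfolding N_def inner_diff_left gsum[symmetric] by (simp add: inner_commute)
  have N: "((\<lambda>x. x \<bullet> e - \<gamma> x) has_derivative (\<lambda>h. N x \<bullet> h)) (at x)" for x
    unfolding N_inner by (rule derivative_eq_intros g refl)+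
  have "continuous_on UNIV N"
    unfolding N_def by (intro continuous_intros gc)
  moreover have "N x \<bullet> e = 1" for x
  proof -
    have "((\<lambda>t. (x + t *\<^sub>R e) \<bullet> e - \<gamma> (x + t *\<^sub>R e)) has_vector_derivative N x \<bullet> e) (at 0)"
      using has_derivative_along_line[of "\<lambda>x. x \<bullet> e - \<gamma> x" "(\<bullet>) (N x)" x 0 e UNIV] N by simp
    moreover have "((\<lambda>t. (x + t *\<^sub>R e) \<bullet> e - \<gamma> (x + t *\<^sub>R e)) has_vector_derivative 1) (at 0)"
      unfolding C2_graph_at_shift[OF assms] by (auto intro!: derivative_eq_intros
          simp flip: has_real_derivative_iff_has_vector_derivative)
    ultimately show ?thesis
      using vector_derivative_unique_at by blast
  qed
  moreover have "grad_within UNIV \<gamma> x - e = - N x" for x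
  proof -
    have "frechet_derivative \<gamma> (at x) = g x"
      using frechet_derivative_at[OF g[of x]] by simp
    then show ?thesis by (simp add: grad_within_def N_def)
  qed
  ultimately show ?thesis using that N by blast
qed

lemma C2_graph_at_mem:
  assumes "C2_graph_at \<Omega> x0 r e \<gamma>" "x \<in> ball x0 r"
  shows "x \<in> \<Omega> \<longleftrightarrow> x \<bullet> e - \<gamma> x > 0"
  using assms unfolding C2_graph_at_def by auto

text \<open>Positive height would put the point into the open set \<open>\<Omega>\<close>, which is
  disjoint from its frontier; negative height would persist on a neighbourhood missing
  \<open>\<Omega>\<close>, which excludes the closure.\<close>

lemma C2_graph_at_frontier:
  assumes G: "C2_graph_at \<Omega> x0 r e \<gamma>" and "open \<Omega>" and y: "y \<in> ball x0 r" "y \<in> frontier \<Omega>"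
  shows "y \<bullet> e - \<gamma> y = 0"
proof -
  obtain N where "\<And>x. ((\<lambda>x. x \<bullet> e - \<gamma> x) has_derivative (\<lambda>h. N x \<bullet> h)) (at x)"
    using C2_graph_at_normal[OF G] by metis
  then have cont: "continuous_on UNIV (\<lambda>x. x \<bullet> e - \<gamma> x)"
    by (meson continuous_at_imp_continuous_on has_derivative_continuous)
  have "y \<notin> \<Omega>" using assms(2) y by (simp add: frontier_def interior_open)
  then have le: "y \<bullet> e - \<gamma> y \<le> 0" using C2_graph_at_mem[OF G y(1)] by simp
  have "\<not> y \<bullet> e - \<gamma> y < 0"
  proof
    assume "y \<bullet> e - \<gamma> y < 0"
    define W where "W = {x. x \<bullet> e - \<gamma> x < 0} \<inter> ball x0 r"
    have "open W" unfolding W_def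
      by (intro open_Int open_Collect_less cont continuous_intros) auto
    moreover have "y \<in> W" using y \<open>y \<bullet> e - \<gamma> y < 0\<close> by (simp add: W_def)
    moreover have "W \<inter> \<Omega> = {}" using C2_graph_at_mem[OF G] by (force simp: W_def)
    ultimately have "y \<notin> closure \<Omega>"
      by (metis disjoint_iff open_Int_closure_eq_empty)
    then show False using y by (simp add: frontier_def)
  qed
  with le show ?thesis by simp
qed

lemma positive_along_ascent_direction:
  fixes \<rho> :: "'a::euclidean_space \<Rightarrow> real"
  assumes "(\<rho> has_derivative (\<lambda>h. N \<bullet> h)) (at y)" "\<rho> y = 0" "N \<bullet> v > 0"
  shows "\<exists>\<delta>>0. \<forall>t. 0 < t \<and> t < \<delta> \<longrightarrow> \<rho> (y + t *\<^sub>R v) > 0"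
proof -
  have "((\<lambda>t. \<rho> (y + t *\<^sub>R v)) has_real_derivative N \<bullet> v) (at 0)"
    using has_derivative_along_line[of \<rho> "(\<bullet>) N" y 0 v UNIV] assms
    by (simp add: has_real_derivative_iff_has_vector_derivative)
  from DERIV_pos_inc_right[OF this assms(3)] obtain \<delta>
    where "\<delta> > 0" "\<And>h. 0 < h \<Longrightarrow> h < \<delta> \<Longrightarrow> \<rho> y < \<rho> (y + h *\<^sub>R v)" by auto
  then show ?thesis using assms(2) by auto
qed

text \<open>Every direction with \<open>N1 \<bullet> v > 0\<close> leads into the common positivity
  set, so \<open>N2\<close> is nonnegative on an open half-space and therefore vanishes on the
  bounding hyperplane. This compares the normals that two graph representations give at the same
  boundary point.\<close>

lemma same_positivity_imp_parallel_normals: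
  fixes N1 N2 :: "'a::euclidean_space"
  assumes d1: "(\<rho>1 has_derivative (\<lambda>h. N1 \<bullet> h)) (at y)" "\<rho>1 y = 0"
    and d2: "(\<rho>2 has_derivative (\<lambda>h. N2 \<bullet> h)) (at y)" "\<rho>2 y = 0"
    and U: "open U" "y \<in> U" "\<And>x. x \<in> U \<Longrightarrow> \<rho>1 x > 0 \<longleftrightarrow> \<rho>2 x > 0"
    and N1: "N1 \<noteq> 0" and V: "N1 \<bullet> V = 0"
  shows "N2 \<bullet> V = 0"
proof -
  have pos: "N2 \<bullet> v \<ge> 0" if v: "N1 \<bullet> v > 0" for v
  proof (rule ccontr)
    assume "\<not> ?thesis"
    then have neg: "((\<lambda>x. - \<rho>2 x) has_derivative (\<lambda>h. (-N2) \<bullet> h)) (at y)" "(- N2) \<bullet> v > 0"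
      using has_derivative_minus[OF d2(1)] by auto
    obtain \<delta>2 where 2: "\<delta>2 > 0" "\<And>t. 0 < t \<Longrightarrow> t < \<delta>2 \<Longrightarrow> - \<rho>2 (y + t *\<^sub>R v) > 0"
      using positive_along_ascent_direction[OF neg(1) _ neg(2)] d2(2) by auto
    obtain \<delta>1 where 1: "\<delta>1 > 0" "\<And>t. 0 < t \<Longrightarrow> t < \<delta>1 \<Longrightarrow> \<rho>1 (y + t *\<^sub>R v) > 0"
      using positive_along_ascent_direction[OF d1 v] by auto
    obtain \<epsilon> where \<epsilon>: "\<epsilon> > 0" "ball y \<epsilon> \<subseteq> U"
      using U openE by blast
    define q where "q = \<epsilon> / (norm v + 1)"
    have q: "q > 0" using \<epsilon>(1) by (simp add: q_def add_nonneg_pos)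
    \<comment> \<open>A time at which both sign statements hold and the point has not left
      \<open>U\<close>: there \<open>\<rho>1\<close> is positive and \<open>\<rho>2\<close>
      negative.\<close>
    define t where "t = min (min \<delta>1 \<delta>2) q / 2"
    have t: "0 < t" "t < \<delta>1" "t < \<delta>2" "t < q"
      using 1(1) 2(1) q by (auto simp: t_def min_def)
    have "t * norm v < \<epsilon>"
    proof -
      have "t * (norm v + 1) < \<epsilon>" using t(4) by (simp add: q_def pos_less_divide_eq add_nonneg_pos)
      then show ?thesis using t(1) by (simp add: algebra_simps)
    qed
    then have "y + t *\<^sub>R v \<in> U" using \<epsilon>(2) t(1) by (auto simp: dist_norm subset_iff)
    with U(3)[of "y + t *\<^sub>R v"] 1(2)[OF t(1,2)] 2(2)[OF t(1,3)] show False by simp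
  qed
  have le: "N2 \<bullet> W \<ge> 0" if W: "N1 \<bullet> W = 0" for W
  proof (rule ccontr)
    assume n: "\<not> ?thesis"
    \<comment> \<open>\<open>s\<close> makes the contribution of \<open>W\<close> outweigh that of
      \<open>N1\<close>: \<open>s *\<^sub>R W + N1\<close> is still in the half-space, but its
      product with \<open>N2\<close> is at most -1.\<close>
    define s where "s = (\<bar>N2 \<bullet> N1\<bar> + 1) / (- (N2 \<bullet> W))"
    have "s * (N2 \<bullet> W) = - (\<bar>N2 \<bullet> N1\<bar> + 1)" using n by (simp add: s_def)
    moreover have "N2 \<bullet> (s *\<^sub>R W + N1) \<ge> 0"
      by (rule pos) (use W N1 in \<open>auto simp: inner_add_right\<close>)
    ultimately show False by (auto simp: inner_add_right)
  qed
  from le[of V] le[of "-V"] V show ?thesis by auto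
qed

text \<open>The given normal comes from some graph representation centred at \<open>y\<close>, while
  integration takes place in a chart centred at \<open>x0\<close>. Both heights are positive exactly
  on \<open>\<Omega>\<close> near \<open>y\<close>, so tangency passes from one chart to the
  other.\<close>

lemma outward_unit_normal_orthogonal:
  assumes "open \<Omega>" and G: "C2_graph_at \<Omega> x0 r e \<gamma>"
    and N: "\<And>x. ((\<lambda>x. x \<bullet> e - \<gamma> x) has_derivative (\<lambda>h. N x \<bullet> h)) (at x)"
    and y: "y \<in> frontier \<Omega>" "y \<in> ball x0 r"
    and \<nu>: "outward_unit_normal_at \<Omega> y \<nu>" and V: "V \<bullet> \<nu> = 0"
  shows "N y \<bullet> V = 0"
proof -
  from \<nu> obtain r' e' \<gamma>' where G': "C2_graph_at \<Omega> y r' e' \<gamma>'" and \<nu>: "\<nu> = sgn (grad_within UNIV \<gamma>' y - e')"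
    unfolding outward_unit_normal_at_def by auto
  obtain N' where N': "\<And>x. ((\<lambda>x. x \<bullet> e' - \<gamma>' x) has_derivative (\<lambda>h. N' x \<bullet> h)) (at x)"
    "\<And>x. N' x \<bullet> e' = 1" "\<And>x. grad_within UNIV \<gamma>' x - e' = - N' x"
    using C2_graph_at_normal[OF G'] by metis
  have N0: "N' y \<noteq> 0" using N'(2)[of y] by auto
  have "N' y \<bullet> V = 0"
    using V N0 unfolding \<nu> N'(3) by (auto simp: sgn_div_norm inner_commute)
  have r': "y \<in> ball y r'" using G' by (simp add: C2_graph_at_def)
  show ?thesis
  proof (rule same_positivity_imp_parallel_normals[OF N'(1) _ N _ _ _ _ N0 \<open>N' y \<bullet> V = 0\<close>])
    show "open (ball y r' \<inter> ball x0 r)" "y \<in> ball y r' \<inter> ball x0 r" using r' y by auto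
  qed (use C2_graph_at_mem[OF G] C2_graph_at_mem[OF G'] C2_graph_at_frontier[OF G assms(1) y(2,1)]
        C2_graph_at_frontier[OF G' assms(1) r' y(1)] in auto)
qed

text \<open>\<open>grad_within\<close> refers to a chosen derivative, so on the closure it is
  determined only once uniqueness is known. At a boundary point, short segments in every direction
  with \<open>N y \<bullet> v > 0\<close> stay in the closure; the two derivatives agree on this
  open half-space, which spans.\<close>

lemma has_derivative_unique_closure_domain:
  fixes g :: "'a::euclidean_space \<Rightarrow> real"
  assumes dom: "C2_bounded_domain \<Omega>" and y: "y \<in> closure \<Omega>"
    and D1: "(g has_derivative D1) (at y within closure \<Omega>)"
    and D2: "(g has_derivative D2) (at y within closure \<Omega>)"
  shows "D1 = D2"
proof -
  have op: "open \<Omega>" using dom by (simp add: C2_bounded_domain_def)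
  interpret D1: linear D1 using D1 has_derivative_linear by blast
  interpret D2: linear D2 using D2 has_derivative_linear by blast
  show ?thesis
  proof (cases "y \<in> \<Omega>")
    case True
    then have "at y within closure \<Omega> = at y"
      using op at_within_interior by (metis closure_subset interior_maximal subsetD)
    then show ?thesis using D1 D2 has_derivative_unique by metis
  next
    case False
    then have yf: "y \<in> frontier \<Omega>" using y op by (simp add: frontier_def interior_open)
    then obtain r e \<gamma> where G: "C2_graph_at \<Omega> y r e \<gamma>"
      using dom unfolding C2_bounded_domain_def by blast
    then have r: "r > 0" "y \<in> ball y r" by (auto simp: C2_graph_at_def)
    obtain N where N: "\<And>x. ((\<lambda>x. x \<bullet> e - \<gamma> x) has_derivative (\<lambda>h. N x \<bullet> h)) (at x)"
      "\<And>x. N x \<bullet> e = 1" using C2_graph_at_normal[OF G] by metis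
    have eq: "D1 v = D2 v" if v: "N y \<bullet> v > 0" for v
    proof -
      obtain \<delta>1 where \<delta>1: "\<delta>1 > 0" "\<And>t. 0 < t \<Longrightarrow> t < \<delta>1 \<Longrightarrow> (y + t *\<^sub>R v) \<bullet> e - \<gamma> (y + t *\<^sub>R v) > 0"
        using positive_along_ascent_direction[OF N(1) C2_graph_at_frontier[OF G op r(2) yf] v] by blast
      define q where "q = r / (norm v + 1)"
      have q: "q > 0" using r(1) by (simp add: q_def add_nonneg_pos)
      define \<delta> where "\<delta> = min \<delta>1 q / 2"
      have \<delta>: "0 < \<delta>" "\<delta> < \<delta>1" "\<delta> < q"
        using \<delta>1(1) q by (auto simp: \<delta>_def min_def)
      have sub: "(\<lambda>t. y + t *\<^sub>R v) ` {0..\<delta>} \<subseteq> closure \<Omega>"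
      proof safe
        fix t assume t: "t \<in> {0..\<delta>}"
        show "y + t *\<^sub>R v \<in> closure \<Omega>"
        proof (cases "t = 0")
          case False
          have "t * (norm v + 1) < r"
            using le_less_trans[OF _ \<delta>(3), of t] t by (simp add: q_def pos_less_divide_eq add_nonneg_pos)
          then have "t * norm v < r" using t by (simp add: algebra_simps)
          then have "y + t *\<^sub>R v \<in> ball y r" using t by (simp add: dist_norm)
          then have "y + t *\<^sub>R v \<in> \<Omega>"
            using C2_graph_at_mem[OF G] \<delta>1(2)[of t] t False \<delta> by auto
          then show ?thesis using closure_subset by blast
        qed (use y in auto)
      qed
      have line: "((\<lambda>t. y + t *\<^sub>R v) has_vector_derivative v) (at 0 within {0..\<delta>})"
        by (auto intro!: derivative_eq_intros)
      have *: "((\<lambda>t. g (y + t *\<^sub>R v)) has_vector_derivative D v) (at 0 within {0..\<delta>})"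
        if "(g has_derivative D) (at y within closure \<Omega>)" for D
        using vector_derivative_diff_chain_within[OF line, of g D]
          has_derivative_subset[OF that sub] by (simp add: o_def)
      show ?thesis
        by (rule vector_derivative_unique_within[OF _ *[OF D1] *[OF D2]])
          (use \<delta> in \<open>auto simp: trivial_limit_within islimpt_Icc\<close>)
    qed
    show ?thesis
    proof
      fix v
      \<comment> \<open>Adding \<open>c *\<^sub>R e\<close> pushes an arbitrary \<open>v\<close>
        into the inward half-space, because \<open>N y \<bullet> e = 1\<close>; linearity then
        removes the correction.\<close>
      define c where "c = \<bar>N y \<bullet> v\<bar> + 1"
      have "D1 (v + c *\<^sub>R e) = D2 (v + c *\<^sub>R e)"
        by (rule eq) (auto simp: inner_add_right N(2) c_def)
      moreover have "D1 e = D2 e" by (rule eq) (simp add: N(2))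
      ultimately show "D1 v = D2 v" by (simp add: D1.add D2.add D1.scale D2.scale)
    qed
  qed
qed

text \<open>A local cone property: \<open>N x \<bullet> v\<close> stays positive near
  \<open>x0\<close>, so the height increases along \<open>v\<close> within a small ball and points
  of \<open>\<Omega>\<close> cannot be carried out of \<open>\<Omega>\<close> there. The radius may
  depend on \<open>v\<close>; only two directions are used later.\<close>

lemma inward_directions:
  fixes \<Omega> :: "'a::euclidean_space set"
  assumes dom: "C2_bounded_domain \<Omega>" and x0: "x0 \<in> closure \<Omega>"
  shows "\<exists>N. N \<noteq> 0 \<and> (\<forall>v. N \<bullet> v > 0 \<longrightarrow> (\<exists>r>0. \<forall>x\<in>\<Omega> \<inter> ball x0 r. \<forall>t\<ge>0.
           x + t *\<^sub>R v \<in> ball x0 r \<longrightarrow> x + t *\<^sub>R v \<in> \<Omega>))"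
proof -
  have op: "open \<Omega>" using dom by (simp add: C2_bounded_domain_def)
  show ?thesis
  proof (cases "x0 \<in> \<Omega>")
    case True
    then obtain r where r: "r > 0" "ball x0 r \<subseteq> \<Omega>" using op openE by blast
    \<comment> \<open>A ball inside \<open>\<Omega>\<close> imposes no constraint on directions, so
      any nonzero vector serves as \<open>N\<close>.\<close>
    then show ?thesis
      by (intro exI[of _ "SOME i. i \<in> Basis"] conjI)
        (auto simp: some_in_eq nonzero_Basis intro!: exI[of _ r])
  next
    case False
    then have "x0 \<in> frontier \<Omega>" using x0 op by (simp add: frontier_def interior_open)
    then obtain r e \<gamma> where G: "C2_graph_at \<Omega> x0 r e \<gamma>"
      using dom unfolding C2_bounded_domain_def by blast
    then have r: "r > 0" by (auto simp: C2_graph_at_def)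
    obtain N where N: "\<And>x. ((\<lambda>x. x \<bullet> e - \<gamma> x) has_derivative (\<lambda>h. N x \<bullet> h)) (at x)"
      "continuous_on UNIV N" "\<And>x. N x \<bullet> e = 1" using C2_graph_at_normal[OF G] by metis
    show ?thesis
    proof (intro exI[of _ "N x0"] conjI allI impI)
      show "N x0 \<noteq> 0" using N(3)[of x0] by auto
      fix v assume v: "N x0 \<bullet> v > 0"
      have "open {x. N x \<bullet> v > 0}"
        by (intro open_Collect_less continuous_intros N(2))
      then obtain r1 where r1: "r1 > 0" "ball x0 r1 \<subseteq> {x. N x \<bullet> v > 0}"
        using v openE by blast
      define r2 where "r2 = min r r1"
      have "x + t *\<^sub>R v \<in> \<Omega>" if x: "x \<in> \<Omega> \<inter> ball x0 r2" and t: "t \<ge> 0" and xt: "x + t *\<^sub>R v \<in> ball x0 r2" for x t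
      proof -
        have "(0 *\<^sub>R v + x) \<bullet> e - \<gamma> (x + 0 *\<^sub>R v) \<le> (x + t *\<^sub>R v) \<bullet> e - \<gamma> (x + t *\<^sub>R v)"
        proof (simp only: add.commute[of "0 *\<^sub>R v"], rule DERIV_nonneg_imp_nondecreasing[OF t])
          fix s assume s: "0 \<le> s" "s \<le> t"
          have "x + s *\<^sub>R v \<in> ball x0 r2"
          proof -
            have "x + s *\<^sub>R v = (1 - s / t) *\<^sub>R x + (s / t) *\<^sub>R (x + t *\<^sub>R v)" if "t \<noteq> 0"
              using that by (simp add: algebra_simps)
            moreover have "(1 - s / t) *\<^sub>R x + (s / t) *\<^sub>R (x + t *\<^sub>R v) \<in> ball x0 r2" if "t \<noteq> 0"
              using x xt s t that by (intro convexD[OF convex_ball]) auto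
            ultimately show ?thesis using x s by (cases "t = 0") auto
          qed
          then have "N (x + s *\<^sub>R v) \<bullet> v > 0" using r1 by (auto simp: r2_def subset_iff)
          moreover have "((\<lambda>t. (x + t *\<^sub>R v) \<bullet> e - \<gamma> (x + t *\<^sub>R v)) has_real_derivative N (x + s *\<^sub>R v) \<bullet> v) (at s)"
            using has_derivative_along_line[OF N(1), where x = x and t = s and v = v and S = UNIV]
            by (simp add: has_real_derivative_iff_has_vector_derivative)
          ultimately show "\<exists>y. ((\<lambda>t. (x + t *\<^sub>R v) \<bullet> e - \<gamma> (x + t *\<^sub>R v)) has_real_derivative y) (at s) \<and> 0 \<le> y"
            by (intro exI conjI) auto
        qed
        moreover have "x \<bullet> e - \<gamma> x > 0" using C2_graph_at_mem[OF G, of x] x by (simp add: r2_def)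
        ultimately have "(x + t *\<^sub>R v) \<bullet> e - \<gamma> (x + t *\<^sub>R v) > 0" by simp
        then show ?thesis using C2_graph_at_mem[OF G, of "x + t *\<^sub>R v"] xt by (simp add: r2_def)
      qed
      moreover have "r2 > 0" using r r1 by (simp add: r2_def)
      ultimately show "\<exists>r>0. \<forall>x\<in>\<Omega> \<inter> ball x0 r. \<forall>t\<ge>0. x + t *\<^sub>R v \<in> ball x0 r \<longrightarrow> x + t *\<^sub>R v \<in> \<Omega>"
        by blast
    qed
  qed
qed

text \<open>About \<open>1 / \<epsilon>\<close> disjoint translates of the layer along \<open>e\<close> fit into a fixed ball.\<close>

lemma measure_boundary_layer:
  fixes \<rho> :: "'a::euclidean_space \<Rightarrow> real"
  assumes shift: "\<And>x t. \<rho> (x + t *\<^sub>R e) = \<rho> x + t" and e: "norm e = 1"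
    and cont: "continuous_on UNIV \<rho>" and \<epsilon>: "0 < \<epsilon>" "\<epsilon> \<le> 1"
  shows "measure lborel {x \<in> ball x0 R. 0 < \<rho> x \<and> \<rho> x \<le> \<epsilon>} \<le> 2 * measure lborel (ball x0 (R + 1)) * \<epsilon>"
proof -
  define L where "L = {x \<in> ball x0 R. 0 < \<rho> x \<and> \<rho> x \<le> \<epsilon>}"
  define B where "B = ball x0 (R + 1)"
  define K where "K = nat \<lfloor>1 / \<epsilon>\<rfloor>"
  have meas[measurable]: "\<rho> \<in> borel_measurable borel"
    using cont by (rule borel_measurable_continuous_onI)
  have Ls[measurable]: "L \<in> sets borel" unfolding L_def ball_def by measurable
  have fin: "emeasure lborel L < \<infinity>"
    by (rule emeasure_bounded_finite) (auto simp: L_def intro: bounded_subset[OF bounded_ball[of x0 R]])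
  \<comment> \<open>At most one translate contains \<open>x\<close>, because the heights allowed in
    \<open>L\<close> form a half-open interval of length \<open>\<epsilon>\<close>. All shifts have
    length at most 1, whence the ball of radius \<open>R + 1\<close>.\<close>
  have one: "(\<Sum>k<K. indicat_real L (x + (- (real k * \<epsilon>)) *\<^sub>R e)) \<le> indicat_real B x" for x
  proof (cases "\<exists>k<K. x + (- (real k * \<epsilon>)) *\<^sub>R e \<in> L")
    case True
    then obtain k where k: "k < K" "x + (- (real k * \<epsilon>)) *\<^sub>R e \<in> L" by blast
    have uniq: "x + (- (real j * \<epsilon>)) *\<^sub>R e \<notin> L" if "j \<noteq> k" for j
    proof
      assume "x + (- (real j * \<epsilon>)) *\<^sub>R e \<in> L"
      with k have *: "0 < \<rho> x - real j * \<epsilon>" "\<rho> x - real j * \<epsilon> \<le> \<epsilon>"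
        "0 < \<rho> x - real k * \<epsilon>" "\<rho> x - real k * \<epsilon> \<le> \<epsilon>"
        using shift[of x "- (real j * \<epsilon>)"] shift[of x "- (real k * \<epsilon>)"] by (auto simp: L_def)
      then have "(real j - real k) * \<epsilon> < 1 * \<epsilon>" "(real k - real j) * \<epsilon> < 1 * \<epsilon>"
        by (simp_all add: algebra_simps)
      then have "real j - real k < 1" "real k - real j < 1"
        using \<epsilon>(1) by (simp_all only: mult_less_cancel_right_pos)
      with that show False by linarith
    qed
    have "(\<Sum>j<K. indicat_real L (x + (- (real j * \<epsilon>)) *\<^sub>R e)) = (\<Sum>j<K. if j = k then 1 else 0)"
      by (rule sum.cong) (use uniq k in \<open>auto simp: indicator_def\<close>)
    also have "\<dots> = 1" using k by simp
    also have "1 = indicat_real B x"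
    proof -
      have "real k * \<epsilon> \<le> 1"
      proof -
        have "real k \<le> 1 / \<epsilon>" using k(1) \<epsilon>(1) unfolding K_def by linarith
        then show ?thesis using \<epsilon>(1) by (simp add: field_simps)
      qed
      moreover have "dist x0 x \<le> dist x0 (x + (- (real k * \<epsilon>)) *\<^sub>R e) + dist (x + (- (real k * \<epsilon>)) *\<^sub>R e) x"
        by (rule dist_triangle)
      moreover have "dist (x + (- (real k * \<epsilon>)) *\<^sub>R e) x = real k * \<epsilon>"
        using \<epsilon> e by (simp add: dist_norm)
      moreover have "dist x0 (x + (- (real k * \<epsilon>)) *\<^sub>R e) < R" using k(2) by (simp add: L_def)
      ultimately show ?thesis by (simp add: B_def indicator_def)
    qed
    finally show ?thesis by simp
  next
    case False
    then have "(\<Sum>k<K. indicat_real L (x + (- (real k * \<epsilon>)) *\<^sub>R e)) = 0"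
      by (intro sum.neutral) (auto simp: indicator_def)
    then show ?thesis by simp
  qed
  have int: "integrable lborel (\<lambda>x. indicat_real L (x + w))" for w
  proof -
    have "integrable (distr lborel borel ((+) w)) (indicat_real L)"
      using fin by (simp add: lborel_distr_plus)
    then show ?thesis by (subst (asm) integrable_distr_eq) (auto simp: add.commute)
  qed
  have "real K * measure lborel L = (\<Sum>k<K. \<integral>x. indicat_real L (x + (- (real k * \<epsilon>)) *\<^sub>R e) \<partial>lborel)"
    by (subst lborel_integral_translate) auto
  also have "\<dots> = (\<integral>x. (\<Sum>k<K. indicat_real L (x + (- (real k * \<epsilon>)) *\<^sub>R e)) \<partial>lborel)"
    by (rule Bochner_Integration.integral_sum[symmetric]) (rule int)
  also have "\<dots> \<le> (\<integral>x. indicat_real B x \<partial>lborel)"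
  proof (rule integral_mono)
    show "integrable lborel (\<lambda>x. \<Sum>k<K. indicat_real L (x + (- (real k * \<epsilon>)) *\<^sub>R e))"
      by (rule Bochner_Integration.integrable_sum) (rule int)
    show "integrable lborel (indicat_real B)"
      unfolding B_def by (intro integrable_real_indicator emeasure_bounded_finite) auto
  qed (rule one)
  also have "\<dots> = measure lborel B" by (simp add: B_def)
  finally have le: "real K * measure lborel L \<le> measure lborel B" .
  \<comment> \<open>Rounding down costs at most one half, since \<open>y \<ge> 1\<close>. This is
    the factor 2 in the bound.\<close>
  define y where "y = 1 / \<epsilon>"
  have "y \<ge> 1" using \<epsilon> by (simp add: y_def)
  then have fl: "\<lfloor>y\<rfloor> \<ge> 1" by simp
  then have "real K = real_of_int \<lfloor>y\<rfloor>" unfolding K_def y_def[symmetric] by (intro of_nat_nat) simp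
  moreover have "real_of_int \<lfloor>y\<rfloor> \<ge> 1" using fl by simp
  moreover have "y < real_of_int \<lfloor>y\<rfloor> + 1" by (rule real_of_int_floor_add_one_gt)
  ultimately have "real K \<ge> 1" "y < real K + 1" by simp_all
  then have "real K \<ge> y / 2" by linarith
  then have "y / 2 * measure lborel L \<le> measure lborel B"
    using le mult_right_mono[OF _ measure_nonneg] order_trans by blast
  then show ?thesis using \<epsilon>(1) unfolding y_def L_def[symmetric] B_def[symmetric]
    by (simp add: divide_simps mult_ac)
qed

section \<open>Divergence theorem with vanishing flux\<close>

text \<open>Squaring removes the corner of the positive part at 0, so the derivative exists
  everywhere and is continuous. All cutoff functions below are assembled from this one.\<close>

lemma has_derivative_square_pos_part:
  "((\<lambda>s. (max 0 s)\<^sup>2) has_real_derivative 2 * max 0 s) (at s)"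
proof -
  consider "s > 0" | "s < 0" | "s = 0" by linarith
  then show ?thesis
  proof cases
    case 1
    have "((\<lambda>s. s\<^sup>2) has_real_derivative 2 * max 0 s) (at s)"
      using 1 by (auto intro!: derivative_eq_intros)
    then show ?thesis
      by (rule has_field_derivative_transform_within_open[of _ _ _ "{0<..}"]) (use 1 in auto)
  next
    case 2
    have "((\<lambda>s. 0) has_real_derivative 2 * max 0 s) (at s)"
      using 2 by (auto intro!: derivative_eq_intros)
    then show ?thesis
      by (rule has_field_derivative_transform_within_open[of _ _ _ "{..<0}"]) (use 2 in auto)
  next
    case 3
    have "((\<lambda>h. (max 0 h)\<^sup>2 / h) \<longlongrightarrow> 0) (at (0::real))"
    proof (rule Lim_null_comparison)
      show "\<forall>\<^sub>F h in at (0::real). norm ((max 0 h)\<^sup>2 / h) \<le> \<bar>h\<bar>"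
        by (intro always_eventually) (auto simp: max_def power2_eq_square)
      show "((\<lambda>h. \<bar>h\<bar>) \<longlongrightarrow> 0) (at (0::real))"
        by (auto intro!: tendsto_eq_intros)
    qed
    then show ?thesis using 3 by (simp add: DERIV_def)
  qed
qed

section \<open>Continuously differentiable cutoff functions\<close>

definition bump :: "'a::euclidean_space \<Rightarrow> real \<Rightarrow> 'a \<Rightarrow> real" where
  "bump c r x = (max 0 (r\<^sup>2 - (x - c) \<bullet> (x - c)))\<^sup>2"

definition bump' :: "'a::euclidean_space \<Rightarrow> real \<Rightarrow> 'a \<Rightarrow> 'a \<Rightarrow> real" where
  "bump' c r x h = - 4 * max 0 (r\<^sup>2 - (x - c) \<bullet> (x - c)) * ((x - c) \<bullet> h)"

lemma bump_derivative: "(bump c r has_derivative bump' c r x) (at x)"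
proof -
  have 1: "((\<lambda>x. r\<^sup>2 - (x - c) \<bullet> (x - c)) has_derivative (\<lambda>h. - 2 * ((x - c) \<bullet> h))) (at x)"
    by (auto intro!: derivative_eq_intros simp: inner_commute)
  have 2: "((\<lambda>s. (max 0 s)\<^sup>2) has_derivative (*) (2 * max 0 (r\<^sup>2 - (x - c) \<bullet> (x - c))))
      (at (r\<^sup>2 - (x - c) \<bullet> (x - c)))"
    using has_derivative_square_pos_part unfolding has_field_derivative_def .
  have "bump' c r x = (\<lambda>h. 2 * max 0 (r\<^sup>2 - (x - c) \<bullet> (x - c)) * (- 2 * ((x - c) \<bullet> h)))"
    by (auto simp: bump'_def)
  moreover have "bump c r = (\<lambda>x. (max 0 (r\<^sup>2 - (x - c) \<bullet> (x - c)))\<^sup>2)"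
    by (auto simp: bump_def)
  ultimately show ?thesis
    using has_derivative_compose[OF 1 2] by simp
qed

lemma continuous_on_bump [continuous_intros]:
  "continuous_on S (bump c r)" "continuous_on S (\<lambda>x. bump' c r x h)"
  unfolding bump_def bump'_def by (intro continuous_intros)+

lemma bump_nonneg: "bump c r x \<ge> 0"
  by (simp add: bump_def)

lemma bump_zero: "x \<notin> ball c r \<Longrightarrow> r \<ge> 0 \<Longrightarrow> bump c r x = 0"
proof -
  assume "x \<notin> ball c r" "r \<ge> 0"
  then have "r \<le> norm (x - c)" by (simp add: dist_norm norm_minus_commute)
  then have "r\<^sup>2 \<le> (norm (x - c))\<^sup>2" using \<open>r \<ge> 0\<close> by (rule power_mono)
  then show ?thesis by (simp add: bump_def power2_norm_eq_inner)
qed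

lemma bump_pos: "x \<in> ball c r \<Longrightarrow> bump c r x > 0"
proof -
  assume "x \<in> ball c r"
  then have "norm (x - c) < r" by (simp add: dist_norm norm_minus_commute)
  then have "(norm (x - c))\<^sup>2 < r\<^sup>2" by (intro power_strict_mono) auto
  then show ?thesis by (simp add: bump_def power2_norm_eq_inner)
qed

text \<open>The primitive of the hat function \<open>ramp'\<close>, which is supported in [1,3] with
  peak value 1 at 2. As it vanishes up to 1 and not merely up to 0, the cutoff
  \<open>ramp (\<rho> / \<epsilon>)\<close> is supported at heights at least
  \<open>\<epsilon>\<close>.\<close>

definition ramp :: "real \<Rightarrow> real" where
  "ramp s = ((max 0 (s - 1))\<^sup>2 - 2 * (max 0 (s - 2))\<^sup>2 + (max 0 (s - 3))\<^sup>2) / 2"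

definition ramp' :: "real \<Rightarrow> real" where
  "ramp' s = max 0 (s - 1) - 2 * max 0 (s - 2) + max 0 (s - 3)"

lemma ramp_derivative: "(ramp has_real_derivative ramp' s) (at s)"
proof -
  have *: "((\<lambda>s. (max 0 (s - a))\<^sup>2) has_real_derivative 2 * max 0 (s - a)) (at s)" for a
    by (rule DERIV_chain'[of "\<lambda>s. s - a" 1, OF _ has_derivative_square_pos_part, simplified])
      (auto intro!: derivative_eq_intros)
  show ?thesis
    unfolding ramp_def[abs_def] by (rule derivative_eq_intros * refl)+ (auto simp: ramp'_def)
qed

lemma ramp_values: "s \<le> 1 \<Longrightarrow> ramp s = 0" "s \<ge> 3 \<Longrightarrow> ramp s = 1" "\<bar>ramp s\<bar> \<le> 1"
  and ramp'_values: "s \<le> 1 \<Longrightarrow> ramp' s = 0" "s \<ge> 3 \<Longrightarrow> ramp' s = 0" "\<bar>ramp' s\<bar> \<le> 1"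
proof -
  show "s \<le> 1 \<Longrightarrow> ramp s = 0" by (simp add: ramp_def)
  show 3: "s \<ge> 3 \<Longrightarrow> ramp s = 1" by (simp add: ramp_def power2_eq_square field_simps)
  show "s \<le> 1 \<Longrightarrow> ramp' s = 0" "s \<ge> 3 \<Longrightarrow> ramp' s = 0" "\<bar>ramp' s\<bar> \<le> 1"
    by (auto simp: ramp'_def max_def)
  have mono: "ramp x \<le> ramp y" if "x \<le> y" for x y
    by (rule DERIV_nonneg_imp_nondecreasing[OF that])
      (use ramp_derivative in \<open>auto intro!: exI simp: ramp'_def max_def\<close>)
  have "ramp (min s 1) = 0" "ramp (max s 3) = 1"
    by (simp add: ramp_def, simp add: ramp_def power2_eq_square field_simps max_def)
  then show "\<bar>ramp s\<bar> \<le> 1" using mono[of "min s 1" s] mono[of s "max s 3"] by auto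
qed

lemma continuous_on_ramp: "continuous_on S ramp" "continuous_on S ramp'"
  unfolding ramp_def[abs_def] ramp'_def[abs_def] by (intro continuous_intros; simp)+

text \<open>\<open>DX\<close> is the derivative at points of the open set only; at boundary points
  it stands for a continuous extension. Continuity is asked direction by direction, which in finite
  dimension amounts to continuity of the derivative as a linear map.\<close>

definition C1_field :: "'a::euclidean_space set \<Rightarrow> ('a \<Rightarrow> 'a) \<Rightarrow> ('a \<Rightarrow> 'a \<Rightarrow> 'a) \<Rightarrow> bool" where
  "C1_field \<Omega> X DX \<longleftrightarrow> (\<forall>x\<in>\<Omega>. (X has_derivative DX x) (at x)) \<and>
     (\<forall>v. continuous_on (closure \<Omega>) (\<lambda>x. DX x v)) \<and> continuous_on (closure \<Omega>) X"

lemma C1_field_scaleR: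
  assumes X: "C1_field \<Omega> X DX"
    and D: "\<And>x. x \<in> \<Omega> \<Longrightarrow> (\<zeta> has_derivative D x) (at x)"
    and c: "continuous_on (closure \<Omega>) \<zeta>" "\<And>v. continuous_on (closure \<Omega>) (\<lambda>x. D x v)"
  shows "C1_field \<Omega> (\<lambda>x. \<zeta> x *\<^sub>R X x) (\<lambda>x v. \<zeta> x *\<^sub>R DX x v + D x v *\<^sub>R X x)"
  using X unfolding C1_field_def
  by (auto intro!: continuous_intros c has_derivative_scaleR D)

lemma integral_divergence_compact_support:
  fixes X :: "'a::euclidean_space \<Rightarrow> 'a"
  assumes U: "open U" "bounded U"
    and D: "\<And>x. x \<in> U \<Longrightarrow> (X has_derivative D x) (at x)"
    and cont: "\<And>v. continuous_on U (\<lambda>x. D x v)" and bd: "\<And>v. bounded ((\<lambda>x. D x v) ` U)"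
    and K: "compact K" "K \<subseteq> U" "\<And>x. x \<notin> K \<Longrightarrow> X x = 0"
  shows "(LINT x:U|lborel. \<Sum>i\<in>Basis. D x i \<bullet> i) = 0"
proof -
  have int: "set_integrable lborel U (\<lambda>x. D x i \<bullet> i)" for i
  proof (rule set_integrable_bounded_continuous)
    show "continuous_on U (\<lambda>x. D x i \<bullet> i)" by (intro continuous_intros cont)
    show "bounded ((\<lambda>x. D x i \<bullet> i) ` U)"
      using bounded_linear_image[OF bd[of i] bounded_linear_inner_left[of i]] by (simp add: image_image)
  qed (use U in auto)
  have "(LINT x:U|lborel. \<Sum>i\<in>Basis. D x i \<bullet> i) = (\<Sum>i\<in>Basis. LINT x:U|lborel. D x i \<bullet> i)"
    using int unfolding set_integrable_def set_lebesgue_integral_def scaleR_sum_right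
    by (intro Bochner_Integration.integral_sum)
  also have "\<dots> = 0"
  proof (rule sum.neutral, rule ballI)
    fix i :: 'a
    have "((\<lambda>x. X x \<bullet> i) has_derivative (\<lambda>v. D x v \<bullet> i)) (at x)" if "x \<in> U" for x
      using D[OF that] by (auto intro!: derivative_eq_intros)
    then show "(LINT x:U|lborel. D x i \<bullet> i) = 0"
      by (rule set_integral_derivative_compact_support[OF U(1), where D = "\<lambda>x v. D x v \<bullet> i"])
        (use K cont in \<open>auto intro!: continuous_intros\<close>)
  qed
  finally show ?thesis .
qed

lemma C1_field_bounded:
  assumes "C1_field \<Omega> X DX" "bounded \<Omega>"
  shows "bounded ((\<lambda>x. DX x v) ` closure \<Omega>)"
  using assms unfolding C1_field_def
  by (auto intro!: compact_imp_bounded compact_continuous_image simp: compact_closure)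

lemma divergence_integrable:
  fixes X :: "'a::euclidean_space \<Rightarrow> 'a"
  assumes X: "C1_field \<Omega> X DX" and "open \<Omega>" "bounded \<Omega>"
  shows "set_integrable lborel \<Omega> (\<lambda>x. \<Sum>i\<in>Basis. DX x i \<bullet> i)"
proof -
  have c: "continuous_on (closure \<Omega>) (\<lambda>x. \<Sum>i\<in>Basis. DX x i \<bullet> i)"
    using X unfolding C1_field_def by (auto intro!: continuous_intros)
  then have "compact ((\<lambda>x. \<Sum>i\<in>Basis. DX x i \<bullet> i) ` closure \<Omega>)"
    using assms by (intro compact_continuous_image) (auto simp: compact_closure)
  then have "bounded ((\<lambda>x. \<Sum>i\<in>Basis. DX x i \<bullet> i) ` \<Omega>)"
    by (meson bounded_subset closure_subset compact_imp_bounded image_mono)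
  then show ?thesis
    using assms c by (intro set_integrable_bounded_continuous) (auto intro: continuous_on_subset[OF _ closure_subset])
qed

text \<open>
  Cut off with \<open>ramp (\<rho> / \<epsilon>)\<close>, where \<open>\<rho>\<close> is the height above the graph. The error term is
  \<open>(1 / \<epsilon>) ramp' (\<rho> / \<epsilon>) \<nabla>\<rho> \<bullet> X\<close>; it lives on a layer of measure \<open>O(\<epsilon>)\<close>, on which \<open>\<nabla>\<rho> \<bullet> X\<close> is
  small because the flux vanishes at the boundary.
\<close>

lemma integral_divergence_in_chart:
  fixes X :: "'a::euclidean_space \<Rightarrow> 'a"
  assumes \<Omega>: "open \<Omega>" "bounded \<Omega>" and G: "C2_graph_at \<Omega> x0 r e \<gamma>"
    and N: "\<And>x. ((\<lambda>x. x \<bullet> e - \<gamma> x) has_derivative (\<lambda>h. N x \<bullet> h)) (at x)" "continuous_on UNIV N"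
    and X: "C1_field \<Omega> X DX"
    and flux: "\<And>y. y \<in> frontier \<Omega> \<inter> ball x0 r \<Longrightarrow> N y \<bullet> X y = 0"
    and supp: "\<And>x. x \<notin> cball x0 r' \<Longrightarrow> X x = 0" and r': "r' < r"
  shows "(LINT x:\<Omega>|lborel. \<Sum>i\<in>Basis. DX x i \<bullet> i) = 0"
proof -
  define \<rho> where "\<rho> x = x \<bullet> e - \<gamma> x" for x
  define U where "U = \<Omega> \<inter> ball x0 r"
  define dv where "dv x = (\<Sum>i\<in>Basis. DX x i \<bullet> i)" for x
  note N = N[folded \<rho>_def]
  have e: "norm e = 1" using G by (simp add: C2_graph_at_def)
  have \<rho>c: "continuous_on S \<rho>" for S
    using N(1) by (meson continuous_at_imp_continuous_on has_derivative_continuous)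
  have U: "open U" "bounded U" "U \<subseteq> closure \<Omega>" "U \<subseteq> \<Omega>"
    using \<Omega> closure_subset by (auto simp: U_def)
  have \<rho>U: "x \<in> U \<longleftrightarrow> \<rho> x > 0" if "x \<in> ball x0 r" for x
    using C2_graph_at_mem[OF G that] that by (auto simp: U_def \<rho>_def)
  have DXc: "continuous_on U (\<lambda>x. DX x v)" for v
    using X U(3) by (auto simp: C1_field_def intro: continuous_on_subset)
  have Xc: "continuous_on U X" "continuous_on (closure \<Omega>) X"
    using X U(3) by (auto simp: C1_field_def intro: continuous_on_subset)
  have dvc: "continuous_on U dv" unfolding dv_def by (intro continuous_intros DXc)
  have dvi: "set_integrable lborel U dv"
    using set_integrable_subset[OF divergence_integrable[OF X \<Omega>], of U] U by (simp add: dv_def[abs_def])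
  have dv0: "dv x = 0" if "x \<in> \<Omega>" "x \<notin> U" for x
  proof -
    have "x \<notin> cball x0 r'" using that r' by (auto simp: U_def)
    then have "DX x = (\<lambda>_. 0)"
      using X that supp by (intro has_derivative_zero_off_support[of X _ _ "cball x0 r'"]) (auto simp: C1_field_def)
    then show ?thesis by (simp add: dv_def)
  qed
  have eqU: "(LINT x:\<Omega>|lborel. dv x) = (LINT x:U|lborel. dv x)"
    unfolding set_lebesgue_integral_def
    by (rule Bochner_Integration.integral_cong) (use dv0 U in \<open>auto simp: indicator_def\<close>)
  define c where "c = 2 * measure lborel (ball x0 (r + 1))"
  have c: "c \<ge> 0" by (simp add: c_def)
  define NX where "NX x = N x \<bullet> X x" for x
  have NXc: "continuous_on (closure \<Omega>) NX"
    unfolding NX_def by (intro continuous_intros Xc continuous_on_subset[OF N(2)]) auto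
  \<comment> \<open>\<open>E1\<close> is the integral of the cut-off divergence, \<open>E2\<close>
    that of the flux through the layer of heights between \<open>\<epsilon>\<close> and
    \<open>3 * \<epsilon>\<close>. Their sum is the integral of the divergence of a field with
    compact support in \<open>U\<close>.\<close>
  define E1 where "E1 \<epsilon> = (LINT x:U|lborel. ramp (\<rho> x / \<epsilon>) * dv x)" for \<epsilon>
  define E2 where "E2 \<epsilon> = (LINT x:U|lborel. ramp' (\<rho> x / \<epsilon>) / \<epsilon> * NX x)" for \<epsilon>
  have bNX: "bounded (NX ` U)"
    by (rule bounded_subset[of "NX ` closure \<Omega>"])
      (use NXc \<Omega> U in \<open>auto intro!: compact_imp_bounded compact_continuous_image simp: compact_closure\<close>)
  have i2: "set_integrable lborel U (\<lambda>x. ramp' (\<rho> x / \<epsilon>) / \<epsilon> * NX x)" if "\<epsilon> > 0" for \<epsilon>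
  proof (rule set_integrable_bounded_continuous)
    show "continuous_on U (\<lambda>x. ramp' (\<rho> x / \<epsilon>) / \<epsilon> * NX x)"
      by (intro continuous_intros continuous_on_compose2[OF continuous_on_ramp(2)[of UNIV]] \<rho>c
          continuous_on_subset[OF NXc] U) (use that in auto)
    obtain B where B: "\<And>x. x \<in> U \<Longrightarrow> \<bar>NX x\<bar> \<le> B" using bNX by (auto simp: bounded_iff)
    show "bounded ((\<lambda>x. ramp' (\<rho> x / \<epsilon>) / \<epsilon> * NX x) ` U)"
      unfolding bounded_iff
    proof (intro exI[of _ "1 / \<epsilon> * B"] ballI; clarsimp simp only:)
      fix x assume x: "x \<in> U"
      show "norm (ramp' (\<rho> x / \<epsilon>) / \<epsilon> * NX x) \<le> 1 / \<epsilon> * B"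
        unfolding real_norm_def abs_mult
        by (intro mult_mono B[OF x]) (use that ramp'_values(3) in \<open>auto simp: divide_right_mono\<close>)
    qed
  qed (use U in auto)
  have i1: "set_integrable lborel U (\<lambda>x. ramp (\<rho> x / \<epsilon>) * dv x)" if "\<epsilon> > 0" for \<epsilon>
  proof (rule set_integrable_bound[OF dvi])
    show "set_borel_measurable lborel U (\<lambda>x. ramp (\<rho> x / \<epsilon>) * dv x)"
      unfolding set_borel_measurable_def measurable_lborel2 using U(1)
      by (intro borel_measurable_continuous_on_indicator continuous_intros dvc \<rho>c
          continuous_on_compose2[OF continuous_on_ramp(1)[of UNIV]]) (use that in auto)
    show "AE x in lborel. x \<in> U \<longrightarrow> norm (ramp (\<rho> x / \<epsilon>) * dv x) \<le> norm (dv x)"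
      using ramp_values(3) by (auto simp: abs_mult intro!: mult_left_le_one_le)
  qed
  have zero: "E1 \<epsilon> + E2 \<epsilon> = 0" if \<epsilon>: "\<epsilon> > 0" for \<epsilon>
  proof -
    \<comment> \<open>Both conditions are closed: the support of \<open>X\<close> bounds
      \<open>K\<close> away from the edge of the chart since \<open>r' < r\<close>, and the cutoff
      bounds it away from the graph.\<close>
    define K where "K = {x \<in> cball x0 r'. \<rho> x \<ge> \<epsilon>}"
    have K: "compact K"
    proof -
      have "closed {x. \<epsilon> \<le> \<rho> x}" by (intro closed_Collect_le continuous_intros \<rho>c)
      moreover have "K = cball x0 r' \<inter> {x. \<epsilon> \<le> \<rho> x}" by (auto simp: K_def)
      ultimately show ?thesis by (simp add: compact_Int_closed)
    qed
    have KU: "K \<subseteq> U"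
    proof
      fix x assume "x \<in> K"
      then have "x \<in> ball x0 r" "\<rho> x > 0" using r' \<epsilon> by (auto simp: K_def)
      then show "x \<in> U" using \<rho>U by blast
    qed
    define D where "D x v = ramp (\<rho> x / \<epsilon>) *\<^sub>R DX x v + (ramp' (\<rho> x / \<epsilon>) / \<epsilon> * (N x \<bullet> v)) *\<^sub>R X x" for x v
    have cD: "C1_field \<Omega> (\<lambda>x. ramp (\<rho> x / \<epsilon>) *\<^sub>R X x) D"
      unfolding D_def
    proof (rule C1_field_scaleR[OF X])
      show "((\<lambda>x. ramp (\<rho> x / \<epsilon>)) has_derivative (\<lambda>v. ramp' (\<rho> x / \<epsilon>) / \<epsilon> * (N x \<bullet> v))) (at x)" for x
      proof -
        have 1: "((\<lambda>x. \<rho> x / \<epsilon>) has_derivative (\<lambda>v. (N x \<bullet> v) / \<epsilon>)) (at x)"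
          by (rule derivative_eq_intros N refl)+ (use \<epsilon> in auto)
        have 2: "(ramp has_derivative (*) (ramp' (\<rho> x / \<epsilon>))) (at (\<rho> x / \<epsilon>))"
          using ramp_derivative unfolding has_field_derivative_def .
        show ?thesis using has_derivative_compose[OF 1 2] by simp
      qed
      show "continuous_on (closure \<Omega>) (\<lambda>x. ramp (\<rho> x / \<epsilon>))"
        by (intro continuous_intros continuous_on_compose2[OF continuous_on_ramp(1)[of UNIV]] \<rho>c) (use \<epsilon> in auto)
      show "continuous_on (closure \<Omega>) (\<lambda>x. ramp' (\<rho> x / \<epsilon>) / \<epsilon> * (N x \<bullet> v))" for v
        by (intro continuous_intros continuous_on_compose2[OF continuous_on_ramp(2)[of UNIV]] \<rho>c
            continuous_on_subset[OF N(2)]) (use \<epsilon> in auto)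
    qed
    have "(LINT x:U|lborel. \<Sum>i\<in>Basis. D x i \<bullet> i) = 0"
    proof (rule integral_divergence_compact_support[OF U(1,2) _ _ _ K KU])
      show "((\<lambda>x. ramp (\<rho> x / \<epsilon>) *\<^sub>R X x) has_derivative D x) (at x)" if "x \<in> U" for x
        using cD that U by (auto simp: C1_field_def)
      show "continuous_on U (\<lambda>x. D x v)" for v
        using cD U by (auto simp: C1_field_def intro: continuous_on_subset)
      show "bounded ((\<lambda>x. D x v) ` U)" for v
        using C1_field_bounded[OF cD \<Omega>(2)] U(3) by (meson bounded_subset image_mono)
      show "ramp (\<rho> x / \<epsilon>) *\<^sub>R X x = 0" if "x \<notin> K" for x
        using that supp[of x] ramp_values(1)[of "\<rho> x / \<epsilon>"] \<epsilon> by (auto simp: K_def)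
    qed
    moreover have "(\<Sum>i\<in>Basis. D x i \<bullet> i) = ramp (\<rho> x / \<epsilon>) * dv x + ramp' (\<rho> x / \<epsilon>) / \<epsilon> * NX x" for x
    proof -
      have "(\<Sum>i\<in>Basis. D x i \<bullet> i) = ramp (\<rho> x / \<epsilon>) * dv x + ramp' (\<rho> x / \<epsilon>) / \<epsilon> * (\<Sum>i\<in>Basis. (N x \<bullet> i) * (X x \<bullet> i))"
        by (simp add: D_def inner_add_left sum.distrib dv_def sum_distrib_left mult.assoc)
      then show ?thesis by (simp add: NX_def euclidean_inner[of "N x" "X x"])
    qed
    ultimately show ?thesis
      unfolding E1_def E2_def using set_integral_add(2)[OF i1[OF \<epsilon>] i2[OF \<epsilon>]] by simp
  qed
  have lim: "(\<lambda>k. E1 (1 / real (Suc k))) \<longlonglongrightarrow> (LINT x:U|lborel. dv x)"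
    unfolding E1_def set_lebesgue_integral_def
  proof (rule integral_dominated_convergence)
    show "integrable lborel (\<lambda>x. norm (indicat_real U x *\<^sub>R dv x))"
      using dvi unfolding set_integrable_def by (rule integrable_norm)
    show "(\<lambda>x. indicat_real U x *\<^sub>R dv x) \<in> borel_measurable lborel"
      using dvi unfolding set_integrable_def by (rule borel_measurable_integrable)
    show "(\<lambda>x. indicat_real U x *\<^sub>R (ramp (\<rho> x / (1 / real (Suc k))) * dv x)) \<in> borel_measurable lborel" for k
      using i1[of "1 / real (Suc k)"] unfolding set_integrable_def by (intro borel_measurable_integrable) simp
    show "AE x in lborel. norm (indicat_real U x *\<^sub>R (ramp (\<rho> x / (1 / real (Suc k))) * dv x)) \<le> norm (indicat_real U x *\<^sub>R dv x)" for k
    proof (rule AE_I2)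
      fix x
      show "norm (indicat_real U x *\<^sub>R (ramp (\<rho> x / (1 / real (Suc k))) * dv x)) \<le> norm (indicat_real U x *\<^sub>R dv x)"
        using ramp_values(3)[of "\<rho> x / (1 / real (Suc k))"]
        by (auto simp: indicator_def abs_mult simp del: of_nat_Suc intro!: mult_left_le_one_le)
    qed
    show "AE x in lborel. (\<lambda>k. indicat_real U x *\<^sub>R (ramp (\<rho> x / (1 / real (Suc k))) * dv x)) \<longlonglongrightarrow> indicat_real U x *\<^sub>R dv x"
    proof (rule AE_I2)
      fix x
      show "(\<lambda>k. indicat_real U x *\<^sub>R (ramp (\<rho> x / (1 / real (Suc k))) * dv x)) \<longlonglongrightarrow> indicat_real U x *\<^sub>R dv x"
      proof (cases "x \<in> U")
        case True
        then have p: "\<rho> x > 0" using \<rho>U U_def by blast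
        obtain k0 where k0: "real k0 \<ge> 3 / \<rho> x" using real_arch_simple by blast
        have "ramp (\<rho> x / (1 / real (Suc k))) = 1" if "k \<ge> k0" for k
        proof (rule ramp_values(2))
          have "3 / \<rho> x \<le> real (Suc k)" using k0 that by linarith
          then show "3 \<le> \<rho> x / (1 / real (Suc k))" using p by (simp add: field_simps)
        qed
        then have "\<forall>\<^sub>F k in sequentially. indicat_real U x *\<^sub>R (ramp (\<rho> x / (1 / real (Suc k))) * dv x) = indicat_real U x *\<^sub>R dv x"
          by (auto simp: eventually_sequentially)
        then show ?thesis by (rule tendsto_eventually)
      qed simp
    qed
  qed
  \<comment> \<open>Compactness: on the part \<open>S\<close> of the support where the flux density
    is at least \<open>\<eta>\<close>, no boundary point occurs, so the height has a positive
    minimum there. Below that minimum the density is at most \<open>\<eta>\<close>.\<close>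
  have small: "\<exists>\<epsilon>0>0. \<forall>x\<in>U. \<rho> x \<le> \<epsilon>0 \<longrightarrow> \<bar>NX x\<bar> \<le> \<eta>" if \<eta>: "\<eta> > 0" for \<eta>
  proof -
    define S where "S = closure \<Omega> \<inter> cball x0 r' \<inter> {x \<in> closure \<Omega>. \<eta> \<le> \<bar>NX x\<bar>}"
    have "compact S"
    proof -
      have "closed {x \<in> closure \<Omega>. \<eta> \<le> \<bar>NX x\<bar>}"
        by (intro continuous_on_closed_Collect_le continuous_intros NXc) auto
      then show ?thesis unfolding S_def using \<Omega> by (intro compact_Int_closed) (auto simp: compact_closure)
    qed
    have pos: "\<rho> x > 0" if x: "x \<in> S" for x
    proof -
      have b: "x \<in> ball x0 r" using x r' by (auto simp: S_def)
      have "x \<notin> frontier \<Omega>" using flux[of x] b x \<eta> by (auto simp: S_def NX_def)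
      then have "x \<in> \<Omega>" using x \<Omega> by (auto simp: S_def frontier_def interior_open)
      then show ?thesis using C2_graph_at_mem[OF G b] by (simp add: \<rho>_def)
    qed
    have "\<exists>\<epsilon>0>0. \<forall>x\<in>S. \<rho> x > \<epsilon>0"
    proof (cases "S = {}")
      case False
      obtain m where "m \<in> S" "\<And>x. x \<in> S \<Longrightarrow> \<rho> m \<le> \<rho> x"
        using continuous_attains_inf[OF \<open>compact S\<close> False \<rho>c] by blast
      then show ?thesis using pos[of m] by (intro exI[of _ "\<rho> m / 2"]) fastforce
    qed (auto intro: exI[of _ 1])
    then obtain \<epsilon>0 where \<epsilon>0: "\<epsilon>0 > 0" "\<And>x. x \<in> S \<Longrightarrow> \<rho> x > \<epsilon>0" by blast
    have "\<bar>NX x\<bar> \<le> \<eta>" if "x \<in> U" "\<rho> x \<le> \<epsilon>0" for x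
    proof (rule ccontr)
      assume "\<not> ?thesis"
      then have "NX x \<noteq> 0" "\<eta> \<le> \<bar>NX x\<bar>" using \<eta> by auto
      moreover have "x \<in> cball x0 r'"
        by (rule ccontr) (use \<open>NX x \<noteq> 0\<close> supp[of x] in \<open>simp add: NX_def\<close>)
      ultimately have "x \<in> S" using that U by (auto simp: S_def)
      with \<epsilon>0(2)[of x] that show False by simp
    qed
    with \<epsilon>0 show ?thesis by blast
  qed
  have bound: "\<bar>LINT x:U|lborel. dv x\<bar> \<le> 3 * c * \<eta>" if \<eta>: "\<eta> > 0" for \<eta>
  proof -
    obtain \<epsilon>0 where \<epsilon>0: "\<epsilon>0 > 0" "\<And>x. x \<in> U \<Longrightarrow> \<rho> x \<le> \<epsilon>0 \<Longrightarrow> \<bar>NX x\<bar> \<le> \<eta>" using small[OF \<eta>] by blast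
    \<comment> \<open>The layer reaches up to height \<open>3 * \<epsilon>\<close> and has measure
      at most \<open>3 * c * \<epsilon>\<close>, while the integrand on it is at most
      \<open>\<eta> / \<epsilon>\<close>; the powers of \<open>\<epsilon>\<close> cancel.\<close>
    have "\<bar>E2 \<epsilon>\<bar> \<le> 3 * c * \<eta>" if \<epsilon>: "0 < \<epsilon>" "3 * \<epsilon> \<le> 1" "3 * \<epsilon> \<le> \<epsilon>0" for \<epsilon>
    proof -
      define L where "L = {x \<in> ball x0 r. 0 < \<rho> x \<and> \<rho> x \<le> 3 * \<epsilon>}"
      have Lm: "measure lborel L \<le> c * (3 * \<epsilon>)"
        unfolding L_def c_def
        by (rule measure_boundary_layer[where e = e]) (use C2_graph_at_shift[OF G] e \<rho>c \<epsilon> in \<open>auto simp: \<rho>_def\<close>)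
      have [measurable]: "\<rho> \<in> borel_measurable borel"
        using \<rho>c by (rule borel_measurable_continuous_onI)
      have Ls: "L \<in> sets borel" unfolding L_def ball_def by measurable
      have fin: "emeasure lborel L < \<infinity>"
        by (rule emeasure_bounded_finite) (auto simp: L_def intro: bounded_subset[OF bounded_ball[of x0 r]])
      have "\<bar>E2 \<epsilon>\<bar> \<le> (\<integral>x. indicat_real L x * (\<eta> / \<epsilon>) \<partial>lborel)"
        unfolding E2_def set_lebesgue_integral_def
      proof (rule integral_abs_bound_integral)
        show "integrable lborel (\<lambda>x. indicat_real U x *\<^sub>R (ramp' (\<rho> x / \<epsilon>) / \<epsilon> * NX x))"
          using i2[OF \<epsilon>(1)] by (simp add: set_integrable_def)
        show "integrable lborel (\<lambda>x. indicat_real L x * (\<eta> / \<epsilon>))"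
          using Ls fin by (intro integrable_mult_left integrable_real_indicator) auto
        fix x
        show "\<bar>indicat_real U x *\<^sub>R (ramp' (\<rho> x / \<epsilon>) / \<epsilon> * NX x)\<bar> \<le> indicat_real L x * (\<eta> / \<epsilon>)"
        proof (cases "x \<in> L")
          case True
          then have xU: "x \<in> U" using \<rho>U by (auto simp: L_def)
          have "\<bar>ramp' (\<rho> x / \<epsilon>)\<bar> * \<bar>NX x\<bar> \<le> 1 * \<eta>"
            using xU True \<epsilon> by (intro mult_mono ramp'_values \<epsilon>0(2)) (auto simp: L_def)
          then show ?thesis using True xU \<epsilon> by (simp add: abs_mult divide_right_mono)
        next
          case False
          have "x \<in> U \<Longrightarrow> ramp' (\<rho> x / \<epsilon>) = 0"
          proof (rule ramp'_values(2))
            assume x: "x \<in> U"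
            then have "\<rho> x > 3 * \<epsilon>" using False \<rho>U[of x] by (auto simp: L_def U_def)
            then show "3 \<le> \<rho> x / \<epsilon>" using \<epsilon> by (simp add: field_simps)
          qed
          then show ?thesis using False by (auto simp: indicator_def)
        qed
      qed
      also have "\<dots> = measure lborel L * (\<eta> / \<epsilon>)" using Ls by simp
      also have "\<dots> \<le> c * (3 * \<epsilon>) * (\<eta> / \<epsilon>)" by (rule mult_right_mono[OF Lm]) (use \<eta> \<epsilon> in auto)
      also have "\<dots> = 3 * c * \<eta>" using \<epsilon> by (simp add: field_simps)
      finally show ?thesis .
    qed
    then have E1b: "\<bar>E1 \<epsilon>\<bar> \<le> 3 * c * \<eta>" if "0 < \<epsilon>" "3 * \<epsilon> \<le> 1" "3 * \<epsilon> \<le> \<epsilon>0" for \<epsilon>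
      using zero[OF that(1)] that by (smt (verit))
    obtain k0 where k0: "real k0 \<ge> max 3 (3 / \<epsilon>0)" using real_arch_simple by blast
    have ev: "\<bar>E1 (1 / real (Suc k))\<bar> \<le> 3 * c * \<eta>" if "k \<ge> k0" for k
    proof (rule E1b)
      have "3 \<le> real (Suc k)" "3 / \<epsilon>0 \<le> real (Suc k)" using k0 that by auto
      then show "3 * (1 / real (Suc k)) \<le> 1" "3 * (1 / real (Suc k)) \<le> \<epsilon>0"
        using \<epsilon>0 by (simp_all add: field_simps del: of_nat_Suc)
    qed simp
    show ?thesis
      by (rule tendsto_upperbound[OF tendsto_rabs[OF lim]])
        (use ev in \<open>auto simp: eventually_sequentially\<close>)
  qed
  have "\<bar>LINT x:U|lborel. dv x\<bar> \<le> 0"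
  proof (rule field_le_epsilon)
    fix d :: real assume d: "d > 0"
    have "3 * c * (d / (3 * c + 1)) \<le> d" using c d by (simp add: field_simps)
    moreover have "d / (3 * c + 1) > 0" using c d by simp
    ultimately show "\<bar>LINT x:U|lborel. dv x\<bar> \<le> 0 + d"
      using bound[of "d / (3 * c + 1)"] by linarith
  qed
  then show ?thesis using eqU by (simp add: dv_def)
qed


text \<open>At an interior point the ball can be taken inside \<open>\<Omega>\<close>, and the
  support is compact in \<open>\<Omega>\<close>. At a boundary point half of the chart radius is
  used, so that the support stays strictly inside the chart.\<close>

lemma integral_divergence_zero_local:
  fixes \<Omega> :: "'a::euclidean_space set" and n :: "'a \<Rightarrow> 'a"
  assumes dom: "C2_bounded_domain \<Omega>" and n: "\<forall>y\<in>frontier \<Omega>. outward_unit_normal_at \<Omega> y (n y)"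
    and c: "c \<in> closure \<Omega>"
  shows "\<exists>r>0. \<forall>X DX. C1_field \<Omega> X DX \<longrightarrow> (\<forall>y\<in>frontier \<Omega>. X y \<bullet> n y = 0) \<longrightarrow>
     (\<forall>x. x \<notin> cball c r \<longrightarrow> X x = 0) \<longrightarrow> (LINT x:\<Omega>|lborel. \<Sum>i\<in>Basis. DX x i \<bullet> i) = 0"
proof -
  have \<Omega>: "open \<Omega>" "bounded \<Omega>" using dom by (auto simp: C2_bounded_domain_def)
  show ?thesis
  proof (cases "c \<in> \<Omega>")
    case True
    then obtain r where r: "r > 0" "cball c r \<subseteq> \<Omega>" using \<Omega> open_contains_cball by blast
    have "(LINT x:\<Omega>|lborel. \<Sum>i\<in>Basis. DX x i \<bullet> i) = 0"
      if X: "C1_field \<Omega> X DX" and s: "\<forall>x. x \<notin> cball c r \<longrightarrow> X x = 0" for X DX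
    proof (rule integral_divergence_compact_support[OF \<Omega> _ _ _ compact_cball r(2)])
      show "(X has_derivative DX x) (at x)" if "x \<in> \<Omega>" for x
        using X that by (simp add: C1_field_def)
      show "continuous_on \<Omega> (\<lambda>x. DX x v)" for v
        using X by (auto simp: C1_field_def intro: continuous_on_subset[OF _ closure_subset])
      show "bounded ((\<lambda>x. DX x v) ` \<Omega>)" for v
        using C1_field_bounded[OF X \<Omega>(2)] closure_subset by (meson bounded_subset image_mono)
    qed (use s in auto)
    with r show ?thesis by blast
  next
    case False
    then have "c \<in> frontier \<Omega>" using c \<Omega> by (simp add: frontier_def interior_open)
    then obtain r e \<gamma> where G: "C2_graph_at \<Omega> c r e \<gamma>"
      using dom unfolding C2_bounded_domain_def by blast
    then have r: "r > 0" by (simp add: C2_graph_at_def)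
    obtain N where N: "\<And>x. ((\<lambda>x. x \<bullet> e - \<gamma> x) has_derivative (\<lambda>h. N x \<bullet> h)) (at x)"
      "continuous_on UNIV N" using C2_graph_at_normal[OF G] by metis
    have "(LINT x:\<Omega>|lborel. \<Sum>i\<in>Basis. DX x i \<bullet> i) = 0"
      if X: "C1_field \<Omega> X DX" and fl: "\<forall>y\<in>frontier \<Omega>. X y \<bullet> n y = 0"
        and s: "\<forall>x. x \<notin> cball c (r / 2) \<longrightarrow> X x = 0" for X DX
    proof (rule integral_divergence_in_chart[OF \<Omega> G N X])
      show "N y \<bullet> X y = 0" if "y \<in> frontier \<Omega> \<inter> ball c r" for y
        using outward_unit_normal_orthogonal[OF \<Omega>(1) G N(1), of y "n y" "X y"] n fl that by auto
      show "X x = 0" if "x \<notin> cball c (r / 2)" for x using s that by blast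
    qed (use r in auto)
    then show ?thesis using r by (intro exI[of _ "r / 2"]) auto
  qed
qed

text \<open>A partition of unity reduces this to the local form. Multiplication by a scalar function
  preserves tangency at the boundary, so every piece again has zero flux.\<close>

theorem integral_divergence_zero_flux:
  fixes \<Omega> :: "'a::euclidean_space set" and n :: "'a \<Rightarrow> 'a"
  assumes dom: "C2_bounded_domain \<Omega>" and n: "\<forall>y\<in>frontier \<Omega>. outward_unit_normal_at \<Omega> y (n y)"
    and X: "C1_field \<Omega> X DX" and flux: "\<forall>y\<in>frontier \<Omega>. X y \<bullet> n y = 0"
  shows "(LINT x:\<Omega>|lborel. \<Sum>i\<in>Basis. DX x i \<bullet> i) = 0"
proof -
  have \<Omega>: "open \<Omega>" "bounded \<Omega>" using dom by (auto simp: C2_bounded_domain_def)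
  define P where "P c r \<longleftrightarrow> (\<forall>X DX. C1_field \<Omega> X DX \<longrightarrow> (\<forall>y\<in>frontier \<Omega>. X y \<bullet> n y = 0) \<longrightarrow>
     (\<forall>x. x \<notin> cball c r \<longrightarrow> X x = 0) \<longrightarrow> (LINT x:\<Omega>|lborel. \<Sum>i\<in>Basis. DX x i \<bullet> i) = 0)" for c r
  have "\<forall>c\<in>closure \<Omega>. \<exists>r>0. P c r"
    using integral_divergence_zero_local[OF dom n] unfolding P_def by blast
  then obtain r where r: "\<And>c. c \<in> closure \<Omega> \<Longrightarrow> r c > 0" "\<And>c. c \<in> closure \<Omega> \<Longrightarrow> P c (r c)"
    by metis
  have "compact (closure \<Omega>)" using \<Omega> by (simp add: compact_closure)
  then obtain F where F: "F \<subseteq> closure \<Omega>" "finite F" "closure \<Omega> \<subseteq> (\<Union>c\<in>F. ball c (r c))"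
  proof (rule compactE_image[of "closure \<Omega>" "closure \<Omega>" "\<lambda>c. ball c (r c)"])
    show "closure \<Omega> \<subseteq> (\<Union>c\<in>closure \<Omega>. ball c (r c))" using r(1) by force
  qed auto
  define \<sigma> where "\<sigma> x = (\<Sum>c\<in>F. bump c (r c) x)" for x
  define \<sigma>' where "\<sigma>' x h = (\<Sum>c\<in>F. bump' c (r c) x h)" for x h
  have \<sigma>: "(\<sigma> has_derivative \<sigma>' x) (at x)" for x
    unfolding \<sigma>_def[abs_def] \<sigma>'_def[abs_def] by (intro has_derivative_sum bump_derivative)
  have \<sigma>c: "continuous_on S \<sigma>" "continuous_on S (\<lambda>x. \<sigma>' x h)" for S h
    unfolding \<sigma>_def[abs_def] \<sigma>'_def[abs_def] by (intro continuous_intros)+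
  have pos: "\<sigma> x > 0" if x: "x \<in> closure \<Omega>" for x
  proof -
    obtain c where "c \<in> F" "x \<in> ball c (r c)" using F(3) x by blast
    then show ?thesis unfolding \<sigma>_def
      using F(2) by (intro sum_pos2[of F c] bump_pos bump_nonneg)
  qed
  have nz: "\<sigma> x \<noteq> 0" if "x \<in> closure \<Omega>" for x
    using pos[OF that] by simp
  \<comment> \<open>The bumps are normalised by their sum, which is positive on the closure. Outside
    the ball around \<open>c\<close> the numerator is zero, so \<open>\<zeta> c\<close> vanishes
    there even where \<open>\<sigma>\<close> does, division by zero giving zero.\<close>
  define \<zeta> where "\<zeta> c x = bump c (r c) x / \<sigma> x" for c x
  define \<zeta>' where "\<zeta>' c x h = (bump' c (r c) x h * \<sigma> x - bump c (r c) x * \<sigma>' x h) / (\<sigma> x * \<sigma> x)" for c x h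
  have \<zeta>: "(\<zeta> c has_derivative \<zeta>' c x) (at x)" if "x \<in> \<Omega>" for c x
    unfolding \<zeta>_def[abs_def] \<zeta>'_def[abs_def]
    by (intro has_derivative_divide' bump_derivative \<sigma> nz subsetD[OF closure_subset that])
  have \<zeta>c: "continuous_on (closure \<Omega>) (\<zeta> c)" "continuous_on (closure \<Omega>) (\<lambda>x. \<zeta>' c x h)" for c h
    unfolding \<zeta>_def[abs_def] \<zeta>'_def
    by (intro continuous_intros \<sigma>c; use nz in simp)+
  have sum1: "(\<Sum>c\<in>F. \<zeta> c x) = 1" if "x \<in> closure \<Omega>" for x
    using pos[OF that] by (simp add: \<zeta>_def \<sigma>_def flip: sum_divide_distrib)
  define D where "D c x v = \<zeta> c x *\<^sub>R DX x v + \<zeta>' c x v *\<^sub>R X x" for c x v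
  have fld: "C1_field \<Omega> (\<lambda>x. \<zeta> c x *\<^sub>R X x) (D c)" for c
    unfolding D_def[abs_def] by (rule C1_field_scaleR[OF X]) (use \<zeta> \<zeta>c in auto)
  have zero: "(LINT x:\<Omega>|lborel. \<Sum>i\<in>Basis. D c x i \<bullet> i) = 0" if c: "c \<in> F" for c
  proof -
    have "c \<in> closure \<Omega>" using c F by blast
    moreover have "\<zeta> c x *\<^sub>R X x = 0" if "x \<notin> cball c (r c)" for x
      using that r(1)[OF \<open>c \<in> closure \<Omega>\<close>] by (simp add: \<zeta>_def bump_zero)
    ultimately show ?thesis
      using r(2)[of c] fld[of c] flux unfolding P_def by auto
  qed
  have split: "(\<Sum>i\<in>Basis. DX x i \<bullet> i) = (\<Sum>c\<in>F. \<Sum>i\<in>Basis. D c x i \<bullet> i)" if x: "x \<in> \<Omega>" for x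
  proof -
    have "((\<lambda>x. \<Sum>c\<in>F. \<zeta> c x *\<^sub>R X x) has_derivative (\<lambda>v. \<Sum>c\<in>F. D c x v)) (at x)"
      using fld x by (intro has_derivative_sum) (auto simp: C1_field_def)
    then have "(X has_derivative (\<lambda>v. \<Sum>c\<in>F. D c x v)) (at x)"
      by (rule has_derivative_transform_within_open[OF _ \<Omega>(1) x])
        (use sum1 closure_subset[of \<Omega>] in \<open>auto simp flip: scaleR_sum_left\<close>)
    moreover have "(X has_derivative DX x) (at x)" using X x by (simp add: C1_field_def)
    ultimately have "DX x = (\<lambda>v. \<Sum>c\<in>F. D c x v)" by (metis has_derivative_unique)
    then show ?thesis by (simp add: inner_sum_left sum.swap[of _ F])
  qed
  have "(LINT x:\<Omega>|lborel. \<Sum>i\<in>Basis. DX x i \<bullet> i) = (LINT x:\<Omega>|lborel. \<Sum>c\<in>F. \<Sum>i\<in>Basis. D c x i \<bullet> i)"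
    by (rule set_lebesgue_integral_cong) (use split \<Omega> in auto)
  also have "\<dots> = (\<Sum>c\<in>F. LINT x:\<Omega>|lborel. \<Sum>i\<in>Basis. D c x i \<bullet> i)"
    using divergence_integrable[OF fld \<Omega>] unfolding set_integrable_def set_lebesgue_integral_def scaleR_sum_right[of _ _ F]
    by (intro Bochner_Integration.integral_sum)
  also have "\<dots> = 0" using zero by simp
  finally show ?thesis .
qed

section \<open>Sobolev inequality in dimension at most two\<close>

lemma linear_injective_bij:
  fixes L :: "'b::euclidean_space \<Rightarrow> 'a::euclidean_space"
  assumes L: "linear L" "inj L" and dim: "DIM('b) = DIM('a)"
  shows "bij L"
proof -
  have "dim (range L) = dim (UNIV :: 'b set)"
    using L by (intro dim_image_eq) (auto intro: inj_on_subset)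
  then have "span (range L) = UNIV"
    using dim by (subst dim_eq_full[symmetric]) simp
  moreover have "span (range L) = range L"
    using L(1) linear_subspace_image[OF L(1) subspace_UNIV] span_eq_iff by blast
  ultimately show ?thesis using L(2) by (simp add: bij_def)
qed

text \<open>
  Both \<open>B \<mapsto> \<integral>B(L z) dz\<close> and \<open>B \<mapsto> \<integral>B\<close> are translation invariant; averaging the former over the
  unit ball and exchanging the order of integration compares them.
\<close>

lemma nn_integral_linear_pullback_le:
  fixes L :: "'b::euclidean_space \<Rightarrow> 'a::euclidean_space"
  assumes L: "linear L" "bij L"
  shows "\<exists>k::real. k \<ge> 0 \<and> (\<forall>B y. B \<in> borel_measurable borel \<longrightarrow>
     (\<integral>\<^sup>+z. B (y + L z) \<partial>lborel) \<le> ennreal k * (\<integral>\<^sup>+x. B x \<partial>lborel))"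
proof -
  have Lc: "continuous_on UNIV L"
    using L(1) by (simp add: linear_continuous_on linear_linear)
  then have [measurable]: "L \<in> borel_measurable borel" by (rule borel_measurable_continuous_onI)
  define Q :: "'a set" where "Q = ball 0 1"
  have [measurable]: "Q \<in> sets borel" by (simp add: Q_def)
  define q where "q = measure lborel Q"
  have q: "q > 0" "emeasure lborel Q = ennreal q"
    using content_ball_pos[of 1 "0::'a"] emeasure_eq_ennreal_measure[of lborel Q]
      emeasure_lborel_ball_finite[of "0::'a" 1] by (auto simp: q_def Q_def)
  \<comment> \<open>Injectivity bounds the preimage of the unit ball, so its volume \<open>k\<close>
    is finite. The quotient \<open>k / q\<close> plays the role of the inverse absolute determinant
    of \<open>L\<close>.\<close>
  obtain m where m: "m > 0" "\<And>x. m * norm x \<le> norm (L x)"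
    using linear_inj_bounded_below_pos[OF L(1)] L(2) by (metis bij_def)
  have "bounded {z. L z \<in> Q}"
    unfolding bounded_iff
  proof (intro exI[of _ "1 / m"] ballI)
    fix z assume "z \<in> {z. L z \<in> Q}"
    then have "m * norm z \<le> 1" using m(2)[of z] by (simp add: Q_def)
    then show "norm z \<le> 1 / m" using m(1) by (simp add: field_simps)
  qed
  then have fin: "emeasure lborel {z. L z \<in> Q} < \<infinity>" by (rule emeasure_bounded_finite)
  define k where "k = measure lborel {z. L z \<in> Q}"
  have k: "k \<ge> 0" "emeasure lborel {z. L z \<in> Q} = ennreal k"
    using fin emeasure_eq_ennreal_measure[of lborel "{z. L z \<in> Q}"] by (auto simp: k_def)
  define M where "M = inv L"
  have LM: "L (M y) = y" for y using L(2) unfolding M_def by (simp add: bij_is_surj surj_f_inv_f)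
  have Ladd: "L (x + y) = L x + L y" "L (- x) = - L x" for x y
    using L(1) by (auto simp: linear_add linear_neg)
  have main: "ennreal q * (\<integral>\<^sup>+z. B (y + L z) \<partial>lborel) = ennreal k * (\<integral>\<^sup>+x. B x \<partial>lborel)"
    if [measurable]: "B \<in> borel_measurable borel" for B :: "'a \<Rightarrow> ennreal" and y
  proof -
    \<comment> \<open>The shift by \<open>x\<close> is absorbed into the variable of integration
      because \<open>x = L (M x)\<close>; hence the left-hand side may be averaged over all
      \<open>x\<close> in \<open>Q\<close>.\<close>
    have tr: "(\<integral>\<^sup>+z. B (y + L z) \<partial>lborel) = (\<integral>\<^sup>+z. B (x + y + L z) \<partial>lborel)" for x
      using lborel_nn_integral_translate[of "\<lambda>z. B (y + L z)" "M x"] by (simp add: Ladd LM add_ac)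
    have inner: "(\<integral>\<^sup>+z. indicator Q (x - L z - y) \<partial>lborel) = ennreal k" for x
    proof -
      have "(\<integral>\<^sup>+z. indicator Q (x - L z - y) \<partial>lborel) = (\<integral>\<^sup>+z. indicator Q (x - L (z + M (x - y)) - y) \<partial>lborel)"
        using lborel_nn_integral_translate[of "\<lambda>z. indicator Q (x - L z - y)" "M (x - y)"] by simp
      also have "\<dots> = (\<integral>\<^sup>+z. indicator {z. L z \<in> Q} z \<partial>lborel)"
        by (rule nn_integral_cong) (auto simp: Ladd LM Q_def indicator_def)
      also have "\<dots> = ennreal k" using k by simp
      finally show ?thesis .
    qed
    have "ennreal q * (\<integral>\<^sup>+z. B (y + L z) \<partial>lborel) = (\<integral>\<^sup>+x. indicator Q x * (\<integral>\<^sup>+z. B (y + L z) \<partial>lborel) \<partial>lborel)"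
      using q by (simp add: nn_integral_multc)
    also have "\<dots> = (\<integral>\<^sup>+x. (\<integral>\<^sup>+z. indicator Q x * B (x + y + L z) \<partial>lborel) \<partial>lborel)"
    proof (rule nn_integral_cong)
      fix x
      show "indicator Q x * (\<integral>\<^sup>+z. B (y + L z) \<partial>lborel) = (\<integral>\<^sup>+z. indicator Q x * B (x + y + L z) \<partial>lborel)"
        by (subst tr[of x], subst nn_integral_cmult) auto
    qed
    also have "\<dots> = (\<integral>\<^sup>+z. (\<integral>\<^sup>+x. indicator Q x * B (x + y + L z) \<partial>lborel) \<partial>lborel)"
      by (rule lborel_pair.Fubini') measurable
    also have "\<dots> = (\<integral>\<^sup>+z. (\<integral>\<^sup>+x. indicator Q (x - L z - y) * B x \<partial>lborel) \<partial>lborel)"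
    proof (rule nn_integral_cong)
      fix z
      show "(\<integral>\<^sup>+x. indicator Q x * B (x + y + L z) \<partial>lborel) = (\<integral>\<^sup>+x. indicator Q (x - L z - y) * B x \<partial>lborel)"
        using lborel_nn_integral_translate[of "\<lambda>x. indicator Q (x - L z - y) * B x" "y + L z"]
        by (simp add: algebra_simps)
    qed
    also have "\<dots> = (\<integral>\<^sup>+x. (\<integral>\<^sup>+z. indicator Q (x - L z - y) * B x \<partial>lborel) \<partial>lborel)"
      by (rule lborel_pair.Fubini') measurable
    also have "\<dots> = (\<integral>\<^sup>+x. ennreal k * B x \<partial>lborel)"
      by (subst nn_integral_multc) (auto simp: inner)
    also have "\<dots> = ennreal k * (\<integral>\<^sup>+x. B x \<partial>lborel)"
      by (rule nn_integral_cmult) auto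
    finally show ?thesis .
  qed
  have "(\<integral>\<^sup>+z. B (y + L z) \<partial>lborel) \<le> ennreal (k / q) * (\<integral>\<^sup>+x. B x \<partial>lborel)"
    if B: "B \<in> borel_measurable borel" for B :: "'a \<Rightarrow> ennreal" and y
  proof -
    have "(\<integral>\<^sup>+z. B (y + L z) \<partial>lborel) = ennreal (1 / q) * (ennreal q * (\<integral>\<^sup>+z. B (y + L z) \<partial>lborel))"
      using q(1) by (simp add: mult.assoc[symmetric] ennreal_mult[symmetric])
    also have "\<dots> = ennreal (k / q) * (\<integral>\<^sup>+x. B x \<partial>lborel)"
      unfolding main[OF B] using q(1) k(1) by (simp add: mult.assoc[symmetric] ennreal_mult[symmetric])
    finally show ?thesis by simp
  qed
  then show ?thesis using q k by (intro exI[of _ "k / q"]) auto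
qed

text \<open>Gagliardo's argument with oblique axes. Shifting \<open>x\<close> by
  \<open>- s *\<^sub>R v1\<close> turns the integrand into \<open>A x * A (x + L (s, t))\<close>;
  since \<open>L\<close> is a linear bijection from the parameter plane, integrating over
  \<open>s\<close> and \<open>t\<close> gives at most a multiple of the integral of
  \<open>A\<close>.\<close>

lemma nn_integral_line_product_le:
  fixes v1 v2 :: "'a::euclidean_space"
  assumes dim: "DIM('a) = 2" and indep: "\<And>s t. s *\<^sub>R v1 + t *\<^sub>R v2 = 0 \<Longrightarrow> s = 0 \<and> t = 0"
  shows "\<exists>k::real. k \<ge> 0 \<and> (\<forall>A. A \<in> borel_measurable borel \<longrightarrow>
     (\<integral>\<^sup>+x. (\<integral>\<^sup>+s. A (x + s *\<^sub>R v1) \<partial>lborel) * (\<integral>\<^sup>+t. A (x + t *\<^sub>R v2) \<partial>lborel) \<partial>lborel)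
       \<le> ennreal k * (\<integral>\<^sup>+x. A x \<partial>lborel)\<^sup>2)"
proof -
  define L :: "real \<times> real \<Rightarrow> 'a" where "L z = (- fst z) *\<^sub>R v1 + snd z *\<^sub>R v2" for z
  have lin: "linear L"
    unfolding L_def by (intro linearI) (auto simp: algebra_simps)
  have "inj L"
    unfolding linear_injective_0[OF lin]
  proof (intro allI impI)
    fix z assume "L z = 0"
    then show "z = 0" using indep[of "- fst z" "snd z"] by (simp add: L_def prod_eq_iff)
  qed
  then have "bij L" using lin dim by (intro linear_injective_bij) auto
  then obtain k where k: "k \<ge> 0" "\<And>B y. B \<in> borel_measurable borel \<Longrightarrow>
     (\<integral>\<^sup>+z. B (y + L z) \<partial>lborel) \<le> ennreal k * (\<integral>\<^sup>+x. B x \<partial>lborel)"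
    using nn_integral_linear_pullback_le[OF lin] by blast
  have "(\<integral>\<^sup>+x. (\<integral>\<^sup>+s. A (x + s *\<^sub>R v1) \<partial>lborel) * (\<integral>\<^sup>+t. A (x + t *\<^sub>R v2) \<partial>lborel) \<partial>lborel)
       \<le> ennreal k * (\<integral>\<^sup>+x. A x \<partial>lborel)\<^sup>2"
    if [measurable]: "A \<in> borel_measurable borel" for A :: "'a \<Rightarrow> ennreal"
  proof -
    have "(\<integral>\<^sup>+x. (\<integral>\<^sup>+s. A (x + s *\<^sub>R v1) \<partial>lborel) * (\<integral>\<^sup>+t. A (x + t *\<^sub>R v2) \<partial>lborel) \<partial>lborel)
      = (\<integral>\<^sup>+x. (\<integral>\<^sup>+s. A (x + s *\<^sub>R v1) * (\<integral>\<^sup>+t. A (x + t *\<^sub>R v2) \<partial>lborel) \<partial>lborel) \<partial>lborel)"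
      by (subst nn_integral_multc) auto
    also have "\<dots> = (\<integral>\<^sup>+x. (\<integral>\<^sup>+s. (\<integral>\<^sup>+t. A (x + s *\<^sub>R v1) * A (x + t *\<^sub>R v2) \<partial>lborel) \<partial>lborel) \<partial>lborel)"
      by (subst nn_integral_cmult) auto
    also have "\<dots> = (\<integral>\<^sup>+s. (\<integral>\<^sup>+x. (\<integral>\<^sup>+t. A (x + s *\<^sub>R v1) * A (x + t *\<^sub>R v2) \<partial>lborel) \<partial>lborel) \<partial>lborel)"
      by (rule lborel_pair.Fubini') measurable
    also have "\<dots> = (\<integral>\<^sup>+s. (\<integral>\<^sup>+t. (\<integral>\<^sup>+x. A (x + s *\<^sub>R v1) * A (x + t *\<^sub>R v2) \<partial>lborel) \<partial>lborel) \<partial>lborel)"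
      by (rule nn_integral_cong, rule lborel_pair.Fubini') measurable
    also have "\<dots> = (\<integral>\<^sup>+s. (\<integral>\<^sup>+t. (\<integral>\<^sup>+x. A x * A (x + L (s, t)) \<partial>lborel) \<partial>lborel) \<partial>lborel)"
    proof (rule nn_integral_cong, rule nn_integral_cong)
      fix s t :: real
      show "(\<integral>\<^sup>+x. A (x + s *\<^sub>R v1) * A (x + t *\<^sub>R v2) \<partial>lborel) = (\<integral>\<^sup>+x. A x * A (x + L (s, t)) \<partial>lborel)"
        using lborel_nn_integral_translate[of "\<lambda>x. A x * A (x + L (s, t))" "s *\<^sub>R v1"]
        by (simp add: L_def algebra_simps)
    qed
    also have "\<dots> = (\<integral>\<^sup>+s. (\<integral>\<^sup>+x. (\<integral>\<^sup>+t. A x * A (x + L (s, t)) \<partial>lborel) \<partial>lborel) \<partial>lborel)"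
      unfolding L_def fst_conv snd_conv by (rule nn_integral_cong, rule lborel_pair.Fubini') measurable
    also have "\<dots> = (\<integral>\<^sup>+x. (\<integral>\<^sup>+s. (\<integral>\<^sup>+t. A x * A (x + L (s, t)) \<partial>lborel) \<partial>lborel) \<partial>lborel)"
      unfolding L_def fst_conv snd_conv by (rule lborel_pair.Fubini') measurable
    also have "\<dots> = (\<integral>\<^sup>+x. A x * (\<integral>\<^sup>+s. (\<integral>\<^sup>+t. A (x + L (s, t)) \<partial>lborel) \<partial>lborel) \<partial>lborel)"
      unfolding L_def fst_conv snd_conv by (subst nn_integral_cmult, measurable)+ 
    also have "\<dots> = (\<integral>\<^sup>+x. A x * (\<integral>\<^sup>+z. A (x + L z) \<partial>lborel) \<partial>lborel)"
    proof (intro nn_integral_cong arg_cong2[of _ _ _ _ "(*)"] refl)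
      fix x
      have "(\<lambda>z. A (x + L z)) \<in> borel_measurable (lborel \<Otimes>\<^sub>M lborel)"
        unfolding L_def by measurable
      from lborel.nn_integral_fst[OF this]
      show "(\<integral>\<^sup>+s. (\<integral>\<^sup>+t. A (x + L (s, t)) \<partial>lborel) \<partial>lborel) = (\<integral>\<^sup>+z. A (x + L z) \<partial>lborel)"
        by (simp add: lborel_prod)
    qed
    also have "\<dots> \<le> (\<integral>\<^sup>+x. A x * (ennreal k * (\<integral>\<^sup>+x. A x \<partial>lborel)) \<partial>lborel)"
      by (intro nn_integral_mono mult_left_mono k) auto
    also have "\<dots> = ennreal k * (\<integral>\<^sup>+x. A x \<partial>lborel)\<^sup>2"
      by (subst nn_integral_multc) (auto simp: power2_eq_square mult_ac)
    finally show ?thesis .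
  qed
  with k(1) show ?thesis by blast
qed

text \<open>This form covers dimensions one and two at once. In dimension one both directions are
  \<open>N\<close>, each line integral is bounded uniformly in \<open>x\<close>, and the ball makes
  the outer integral finite. In dimension two the product estimate for independent directions
  applies.\<close>

lemma two_directions:
  fixes N c :: "'a::euclidean_space"
  assumes dim: "DIM('a) \<le> 2" and N: "N \<noteq> 0"
  shows "\<exists>v1 v2. N \<bullet> v1 > 0 \<and> N \<bullet> v2 > 0 \<and> (\<forall>r. \<exists>k::real. k \<ge> 0 \<and> (\<forall>A. A \<in> borel_measurable borel \<longrightarrow>
     (\<integral>\<^sup>+x. indicator (ball c r) x * ((\<integral>\<^sup>+s. A (x + s *\<^sub>R v1) \<partial>lborel) * (\<integral>\<^sup>+t. A (x + t *\<^sub>R v2) \<partial>lborel)) \<partial>lborel)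
       \<le> ennreal k * (\<integral>\<^sup>+x. A x \<partial>lborel)\<^sup>2))"
proof -
  have NN: "N \<bullet> N > 0" using N by simp
  have "DIM('a) \<ge> 1" using DIM_positive[where 'a='a] by simp
  then consider "DIM('a) = 1" | "DIM('a) = 2" using dim by linarith
  then show ?thesis
  proof cases
    case 1
    have lin: "linear (\<lambda>t::real. t *\<^sub>R N)" by (intro linearI) (auto simp: algebra_simps)
    have "inj (\<lambda>t::real. t *\<^sub>R N)" using N by (auto simp: inj_def)
    then have "bij (\<lambda>t::real. t *\<^sub>R N)" using lin 1 by (intro linear_injective_bij) auto
    then obtain k where k: "k \<ge> 0" "\<And>B y. B \<in> borel_measurable borel \<Longrightarrow>
       (\<integral>\<^sup>+z. B (y + z *\<^sub>R N) \<partial>lborel) \<le> ennreal k * (\<integral>\<^sup>+x. B x \<partial>lborel)"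
      using nn_integral_linear_pullback_le[OF lin] by blast
    have "(\<integral>\<^sup>+x. indicator (ball c r) x * ((\<integral>\<^sup>+s. A (x + s *\<^sub>R N) \<partial>lborel) * (\<integral>\<^sup>+t. A (x + t *\<^sub>R N) \<partial>lborel)) \<partial>lborel)
       \<le> ennreal (measure lborel (ball c r) * (k * k)) * (\<integral>\<^sup>+x. A x \<partial>lborel)\<^sup>2"
      if A: "A \<in> borel_measurable borel" for A r
    proof -
      define I where "I = (\<integral>\<^sup>+x. A x \<partial>lborel)"
      have "(\<integral>\<^sup>+x. indicator (ball c r) x * ((\<integral>\<^sup>+s. A (x + s *\<^sub>R N) \<partial>lborel) * (\<integral>\<^sup>+t. A (x + t *\<^sub>R N) \<partial>lborel)) \<partial>lborel)
        \<le> (\<integral>\<^sup>+x. indicator (ball c r) x * ((ennreal k * I) * (ennreal k * I)) \<partial>lborel)"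
        unfolding I_def by (intro nn_integral_mono mult_mono k A) auto
      also have "\<dots> = emeasure lborel (ball c r) * ((ennreal k * I) * (ennreal k * I))"
        by (subst nn_integral_multc) (auto intro!: borel_measurable_indicator)
      also have "emeasure lborel (ball c r) = ennreal (measure lborel (ball c r))"
        using emeasure_lborel_ball_finite[of c r] by (intro emeasure_eq_ennreal_measure) auto
      also have "\<dots> * ((ennreal k * I) * (ennreal k * I)) = ennreal (measure lborel (ball c r) * (k * k)) * I\<^sup>2"
        using k(1) by (simp add: ennreal_mult power2_eq_square mult_ac)
      finally show ?thesis by (simp add: I_def)
    qed
    then show ?thesis using NN k(1)
      by (intro exI[of _ N] conjI allI) (auto intro!: exI[of _ "measure lborel (ball c r) * (k * k)" for r])
  next
    case 2
    \<comment> \<open>As \<open>N\<close> has a nonzero component along \<open>i\<close>, the other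
      basis vector is independent of \<open>N\<close>.\<close>
    obtain w where w: "\<And>s t. s *\<^sub>R N + t *\<^sub>R w = 0 \<Longrightarrow> s = 0 \<and> t = 0"
    proof -
      obtain i where i: "i \<in> Basis" "N \<bullet> i \<noteq> 0" using N euclidean_all_zero_iff by blast
      have "card (Basis - {i}) = 1" using 2 i by simp
      then obtain j where j: "j \<in> Basis" "j \<noteq> i" by (metis Diff_iff card_1_singletonE insertI1)
      have "s = 0 \<and> t = 0" if "s *\<^sub>R N + t *\<^sub>R j = 0" for s t
      proof -
        have "(s *\<^sub>R N + t *\<^sub>R j) \<bullet> i = 0" using that by simp
        then have "s = 0" using i j by (simp add: inner_add_left inner_not_same_Basis)
        then show ?thesis using that j by (auto simp: nonzero_Basis)
      qed
      then show ?thesis using that by blast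
    qed
    \<comment> \<open>The perturbation is so small that the second direction stays inward:
      \<open>N \<bullet> (N + \<delta> *\<^sub>R w)\<close> is at least half of
      \<open>N \<bullet> N\<close>.\<close>
    define \<delta> where "\<delta> = (N \<bullet> N) / (2 * (\<bar>N \<bullet> w\<bar> + 1))"
    have \<delta>: "\<delta> > 0" using NN by (simp add: \<delta>_def add_nonneg_pos)
    have "N \<bullet> (N + \<delta> *\<^sub>R w) > 0"
    proof -
      have "\<delta> * \<bar>N \<bullet> w\<bar> \<le> (N \<bullet> N) / 2"
        using NN unfolding \<delta>_def by (simp add: field_simps add_nonneg_pos)
      moreover have "\<bar>\<delta> * (N \<bullet> w)\<bar> = \<delta> * \<bar>N \<bullet> w\<bar>" using \<delta> by (simp add: abs_mult)
      ultimately show ?thesis using NN unfolding inner_add_right inner_scaleR_right by linarith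
    qed
    moreover have "s = 0 \<and> t = 0" if "s *\<^sub>R N + t *\<^sub>R (N + \<delta> *\<^sub>R w) = 0" for s t
    proof -
      have "(s + t) *\<^sub>R N + (t * \<delta>) *\<^sub>R w = 0" using that by (simp add: algebra_simps)
      from w[OF this] \<delta> show ?thesis by auto
    qed
    then obtain k where k: "k \<ge> 0" "\<And>A. A \<in> borel_measurable borel \<Longrightarrow>
       (\<integral>\<^sup>+x. (\<integral>\<^sup>+s. A (x + s *\<^sub>R N) \<partial>lborel) * (\<integral>\<^sup>+t. A (x + t *\<^sub>R (N + \<delta> *\<^sub>R w)) \<partial>lborel) \<partial>lborel)
       \<le> ennreal k * (\<integral>\<^sup>+x. A x \<partial>lborel)\<^sup>2"
      using nn_integral_line_product_le[OF 2, of N "N + \<delta> *\<^sub>R w"] by blast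
    have "(\<integral>\<^sup>+x. indicator (ball c r) x * ((\<integral>\<^sup>+s. A (x + s *\<^sub>R N) \<partial>lborel) * (\<integral>\<^sup>+t. A (x + t *\<^sub>R (N + \<delta> *\<^sub>R w)) \<partial>lborel)) \<partial>lborel)
       \<le> ennreal k * (\<integral>\<^sup>+x. A x \<partial>lborel)\<^sup>2" if A: "A \<in> borel_measurable borel" for A r
      by (rule order_trans[OF nn_integral_mono k(2)[OF A]]) (auto simp: indicator_def)
    then show ?thesis using NN k(1) calculation by blast
  qed
qed


text \<open>A class that is stable under taking powers and contains the time integrals of
  \<open>w\<close>. Boundedness makes all integrals over the bounded domain finite; at the boundary
  of \<open>\<Omega>\<close> no values are prescribed.\<close>

definition C1_bounded :: "'a::euclidean_space set \<Rightarrow> ('a \<Rightarrow> real) \<Rightarrow> ('a \<Rightarrow> 'a) \<Rightarrow> bool" where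
  "C1_bounded \<Omega> v G \<longleftrightarrow> (\<forall>x\<in>\<Omega>. (v has_derivative (\<lambda>h. G x \<bullet> h)) (at x)) \<and> continuous_on \<Omega> G \<and>
     bounded (v ` \<Omega>) \<and> bounded (G ` \<Omega>)"

lemma C1_bounded_continuous: "C1_bounded \<Omega> v G \<Longrightarrow> continuous_on \<Omega> v"
  unfolding C1_bounded_def
  by (intro continuous_at_imp_continuous_on ballI) (blast intro: has_derivative_continuous)

text \<open>Serves to differentiate the product of a bump and \<open>v\<close>, extended by zero, at
  points outside the open ball, where nothing is known about \<open>v\<close>: the product is
  dominated by the bump, whose value and derivative both vanish there.\<close>

lemma has_derivative_zero_squeeze:
  fixes P \<psi> :: "'a::euclidean_space \<Rightarrow> real"
  assumes le: "\<And>z. \<bar>P z\<bar> \<le> M * \<psi> z" and \<psi>: "(\<psi> has_derivative (\<lambda>_. 0)) (at y)" "\<psi> y = 0"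
  shows "(P has_derivative (\<lambda>_. 0)) (at y)"
proof -
  have P0: "P y = 0" using le[of y] \<psi>(2) by simp
  have "((\<lambda>h. norm (\<psi> (y + h) - \<psi> y - 0) / norm h) \<longlongrightarrow> 0) (at 0)"
    using \<psi>(1) unfolding has_derivative_at by simp
  then have "((\<lambda>h. \<bar>M\<bar> * (norm (\<psi> (y + h) - \<psi> y - 0) / norm h)) \<longlongrightarrow> \<bar>M\<bar> * 0) (at 0)"
    by (intro tendsto_intros)
  then have lim: "((\<lambda>h. \<bar>M\<bar> * (norm (\<psi> (y + h) - \<psi> y - 0) / norm h)) \<longlongrightarrow> 0) (at 0)" by simp
  have "((\<lambda>h. norm (P (y + h) - P y - 0) / norm h) \<longlongrightarrow> 0) (at 0)"
  proof (rule Lim_null_comparison[OF always_eventually lim], rule allI)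
    fix h
    have "\<bar>P (y + h)\<bar> \<le> \<bar>M\<bar> * \<bar>\<psi> (y + h)\<bar>"
      using le[of "y + h"] abs_ge_self[of "M * \<psi> (y + h)"] by (simp add: abs_mult)
    then show "norm (norm (P (y + h) - P y - 0) / norm h) \<le> \<bar>M\<bar> * (norm (\<psi> (y + h) - \<psi> y - 0) / norm h)"
      using P0 \<psi>(2) by (simp add: divide_right_mono)
  qed
  then show ?thesis unfolding has_derivative_at by simp
qed

lemma bump_le:
  assumes "r \<ge> 0"
  shows "bump c r x \<le> r ^ 4" "x \<in> ball c r \<Longrightarrow> \<bar>bump' c r x h\<bar> \<le> 4 * r ^ 3 * norm h"
proof -
  have "max 0 (r\<^sup>2 - (x - c) \<bullet> (x - c)) \<le> r\<^sup>2" by simp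
  then have "(max 0 (r\<^sup>2 - (x - c) \<bullet> (x - c)))\<^sup>2 \<le> (r\<^sup>2)\<^sup>2" by (intro power_mono) auto
  then show "bump c r x \<le> r ^ 4" by (simp add: bump_def flip: power_mult)
  assume x: "x \<in> ball c r"
  have "\<bar>bump' c r x h\<bar> = 4 * max 0 (r\<^sup>2 - (x - c) \<bullet> (x - c)) * \<bar>(x - c) \<bullet> h\<bar>"
    by (simp add: bump'_def abs_mult)
  also have "\<dots> \<le> 4 * r\<^sup>2 * (r * norm h)"
  proof (intro mult_mono)
    have "\<bar>(x - c) \<bullet> h\<bar> \<le> norm (x - c) * norm h" by (rule Cauchy_Schwarz_ineq2)
    also have "\<dots> \<le> r * norm h" using x by (intro mult_right_mono) (auto simp: dist_norm norm_minus_commute)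
    finally show "\<bar>(x - c) \<bullet> h\<bar> \<le> r * norm h" .
  qed auto
  also have "\<dots> = 4 * r ^ 3 * norm h" by (simp add: power2_eq_square power3_eq_cube)
  finally show "\<bar>bump' c r x h\<bar> \<le> 4 * r ^ 3 * norm h" .
qed

text \<open>The ray from \<open>x\<close> in the direction \<open>d\<close> stays in
  \<open>\<Omega>\<close> as long as it stays in the ball, and the product of bump and
  \<open>v\<close> vanishes once it has left. The value at \<open>x\<close> is therefore minus the
  integral of the derivative along the ray, and no boundary values of \<open>v\<close>
  occur.\<close>

lemma bump_le_line_integral:
  fixes \<Omega> :: "'a::euclidean_space set"
  assumes op: "open \<Omega>" and v: "C1_bounded \<Omega> v G" and r: "r > 0" and d: "d \<noteq> 0"
    and cone: "\<And>x t. x \<in> \<Omega> \<inter> ball c r \<Longrightarrow> t \<ge> 0 \<Longrightarrow> x + t *\<^sub>R d \<in> ball c r \<Longrightarrow> x + t *\<^sub>R d \<in> \<Omega>"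
    and x: "x \<in> \<Omega> \<inter> ball c r" and C: "C \<ge> norm d * (r ^ 4 + 4 * r ^ 3)"
  shows "ennreal (bump c r x * \<bar>v x\<bar>) \<le>
    (\<integral>\<^sup>+s. ennreal (indicator \<Omega> (x + s *\<^sub>R d) * (C * (\<bar>v (x + s *\<^sub>R d)\<bar> + norm (G (x + s *\<^sub>R d))))) \<partial>lborel)"
proof -
  define U where "U = \<Omega> \<inter> ball c r"
  have U: "open U" using op by (auto simp: U_def)
  obtain M where M: "\<And>x. x \<in> \<Omega> \<Longrightarrow> \<bar>v x\<bar> \<le> M" "M \<ge> 0"
    using v unfolding C1_bounded_def bounded_iff
    by (metis abs_ge_zero image_eqI order_trans real_norm_def x Int_iff)
  obtain M' where M': "\<And>x. x \<in> \<Omega> \<Longrightarrow> norm (G x) \<le> M'"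
    using v unfolding C1_bounded_def bounded_iff by blast
  define F where "F y = bump c r y * (G y \<bullet> d) + bump' c r y d * v y" for y
  \<comment> \<open>Set to zero off \<open>U\<close>, \<open>P\<close> is differentiable at every
    point of the ray: points of the ray inside the ball belong to \<open>U\<close>, and at all
    others \<open>P\<close> is squeezed by the bump.\<close>
  define P where "P y = (if y \<in> U then bump c r y * v y else 0)" for y
  have der: "((\<lambda>t. P (x + t *\<^sub>R d)) has_vector_derivative indicator U (x + t *\<^sub>R d) * F (x + t *\<^sub>R d)) (at t within S)"
    if t: "t \<ge> 0" for t S
  proof (cases "x + t *\<^sub>R d \<in> ball c r")
    case True
    then have y: "x + t *\<^sub>R d \<in> U" using cone[OF x t] by (simp add: U_def)
    have "((\<lambda>y. bump c r y * v y) has_derivative (\<lambda>h. bump c r (x + t *\<^sub>R d) * (G (x + t *\<^sub>R d) \<bullet> h) + bump' c r (x + t *\<^sub>R d) h * v (x + t *\<^sub>R d)))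
       (at (x + t *\<^sub>R d))"
      using v y by (intro has_derivative_mult bump_derivative) (auto simp: C1_bounded_def U_def)
    then have "(P has_derivative (\<lambda>h. bump c r (x + t *\<^sub>R d) * (G (x + t *\<^sub>R d) \<bullet> h) + bump' c r (x + t *\<^sub>R d) h * v (x + t *\<^sub>R d)))
       (at (x + t *\<^sub>R d))"
      by (rule has_derivative_transform_within_open[OF _ U y]) (simp add: P_def)
    from has_derivative_along_line[OF this] show ?thesis using y by (simp add: F_def)
  next
    case False
    then have b0: "bump c r (x + t *\<^sub>R d) = 0" using r by (intro bump_zero) auto
    then have "bump' c r (x + t *\<^sub>R d) = (\<lambda>_. 0)" by (auto simp: bump_def bump'_def)
    then have b1: "(bump c r has_derivative (\<lambda>_. 0)) (at (x + t *\<^sub>R d))" by (metis bump_derivative)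
    have Pb: "\<bar>P z\<bar> \<le> M * bump c r z" for z
    proof (cases "z \<in> U")
      case True
      then have "\<bar>v z\<bar> * bump c r z \<le> M * bump c r z"
        by (intro mult_right_mono M bump_nonneg) (simp add: U_def)
      then show ?thesis using True by (simp add: P_def abs_mult bump_nonneg mult.commute)
    qed (simp add: P_def M bump_nonneg)
    from has_derivative_along_line[OF has_derivative_zero_squeeze[OF Pb b1 b0]] show ?thesis using False by (simp add: U_def)
  qed
  define f' where "f' t = indicator U (x + t *\<^sub>R d) * F (x + t *\<^sub>R d)" for t
  define a where "a y = indicator \<Omega> y * (C * (\<bar>v y\<bar> + norm (G y)))" for y
  have C0: "C \<ge> 0" using C r by (smt (verit) norm_ge_zero mult_nonneg_nonneg zero_le_power)
  have f'a: "\<bar>f' t\<bar> \<le> a (x + t *\<^sub>R d)" for t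
  proof (cases "x + t *\<^sub>R d \<in> U")
    case True
    define y where "y = x + t *\<^sub>R d"
    have y: "y \<in> \<Omega>" "y \<in> ball c r" using True by (auto simp: y_def U_def)
    have "\<bar>F y\<bar> \<le> \<bar>bump c r y\<bar> * \<bar>G y \<bullet> d\<bar> + \<bar>bump' c r y d\<bar> * \<bar>v y\<bar>"
      unfolding F_def by (metis abs_mult abs_triangle_ineq)
    also have "\<dots> \<le> r ^ 4 * (norm (G y) * norm d) + 4 * r ^ 3 * norm d * \<bar>v y\<bar>"
      using bump_le(1)[of r c y] bump_le(2)[of r y c d] bump_nonneg[of c r y] r y Cauchy_Schwarz_ineq2[of "G y" d]
      by (intro add_mono mult_mono) auto
    also have "\<dots> \<le> (norm d * (r ^ 4 + 4 * r ^ 3)) * (\<bar>v y\<bar> + norm (G y))"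
      using r by (simp add: algebra_simps)
    also have "\<dots> \<le> C * (\<bar>v y\<bar> + norm (G y))" by (intro mult_right_mono C) auto
    finally show ?thesis using True y by (simp add: f'_def a_def y_def)
  next
    case False
    then show ?thesis using C0 by (simp add: f'_def a_def)
  qed
  \<comment> \<open>At parameter \<open>R\<close> the ray has moved by \<open>2 * r\<close>, the
    diameter of the ball, so its end point lies outside.\<close>
  define R where "R = 2 * r / norm d"
  have R: "R \<ge> 0" using r by (simp add: R_def)
  have out: "x + R *\<^sub>R d \<notin> ball c r"
  proof -
    have "norm (R *\<^sub>R d) = 2 * r" using d r by (simp add: R_def)
    moreover have "norm (R *\<^sub>R d) \<le> norm (x + R *\<^sub>R d - c) + norm (c - x)"
      using norm_triangle_ineq[of "x + R *\<^sub>R d - c" "c - x"] by simp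
    moreover have "norm (c - x) < r" using x by (simp add: dist_norm)
    ultimately show ?thesis by (simp add: dist_norm norm_minus_commute)
  qed
  have FTC: "(f' has_integral P (x + R *\<^sub>R d) - P (x + 0 *\<^sub>R d)) {0..R}"
    unfolding f'_def by (rule fundamental_theorem_of_calculus[OF R]) (use der in auto)
  have Fc: "continuous_on U F"
    unfolding F_def[abs_def] using v C1_bounded_continuous[OF v]
    by (auto intro!: continuous_intros simp: C1_bounded_def U_def intro: continuous_on_subset)
  have [measurable]: "(\<lambda>y. indicator U y *\<^sub>R F y) \<in> borel_measurable borel"
    using U Fc by (intro borel_measurable_continuous_on_indicator) auto
  have f'm[measurable]: "f' \<in> borel_measurable borel"
  proof -
    have "(\<lambda>t. (\<lambda>y. indicator U y *\<^sub>R F y) (x + t *\<^sub>R d)) \<in> borel_measurable borel" by measurable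
    then show ?thesis by (simp add: f'_def[abs_def])
  qed
  have bd: "\<bar>f' t\<bar> \<le> C * (M + \<bar>M'\<bar>)" for t
  proof (rule order_trans[OF f'a])
    show "a (x + t *\<^sub>R d) \<le> C * (M + \<bar>M'\<bar>)"
      using M M'[of "x + t *\<^sub>R d"] C0 by (auto simp: a_def indicator_def intro!: mult_left_mono add_mono)
  qed
  have int: "set_integrable lborel {0..R} f'"
    unfolding set_integrable_def
  proof (rule Bochner_Integration.integrable_bound)
    show "integrable lborel (\<lambda>t. indicator {0..R} t * (C * (M + \<bar>M'\<bar>)))"
      by (intro integrable_mult_left integrable_real_indicator) (auto simp: R emeasure_lborel_Icc)
    show "AE t in lborel. norm (indicat_real {0..R} t *\<^sub>R f' t) \<le> norm (indicat_real {0..R} t * (C * (M + \<bar>M'\<bar>)))"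
      using bd by (auto simp: indicator_def intro: order_trans[OF _ abs_ge_self])
  qed measurable
  have "(LINT t:{0..R}|lborel. f' t) = - (bump c r x * v x)"
    using set_borel_integral_eq_integral(2)[OF int] integral_unique[OF FTC] x out
    by (simp add: P_def U_def)
  then have "bump c r x * \<bar>v x\<bar> = norm (LINT t:{0..R}|lborel. f' t)"
    by (simp add: abs_mult bump_nonneg)
  then have "ennreal (bump c r x * \<bar>v x\<bar>) \<le> (\<integral>\<^sup>+t. norm (indicator {0..R} t *\<^sub>R f' t) \<partial>lborel)"
    using integral_norm_bound_ennreal[OF int[unfolded set_integrable_def]]
    by (simp add: set_lebesgue_integral_def)
  also have "\<dots> \<le> (\<integral>\<^sup>+s. ennreal (a (x + s *\<^sub>R d)) \<partial>lborel)"
    by (intro nn_integral_mono ennreal_leI) (use f'a in \<open>auto simp: indicator_def intro: order_trans[OF abs_ge_zero]\<close>)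
  finally show ?thesis by (simp add: a_def)
qed

text \<open>On the half ball the bump is bounded below, so the absolute value of \<open>v\<close> is
  bounded by each of two line integrals. Their product bounds the square of \<open>v\<close>, and
  integrating the product gives the square of the W^{1,1} norm: one factor per direction yields the
  exponent 2.\<close>

lemma W11_embedding_local:
  fixes \<Omega> :: "'a::euclidean_space set"
  assumes dom: "C2_bounded_domain \<Omega>" and dim: "DIM('a) \<le> 2" and c: "c \<in> closure \<Omega>"
  shows "\<exists>r>0. \<exists>K\<ge>0. \<forall>v G. C1_bounded \<Omega> v G \<longrightarrow>
    (\<integral>\<^sup>+x. indicator (\<Omega> \<inter> ball c (r / 2)) x * ennreal ((v x)\<^sup>2) \<partial>lborel)
      \<le> ennreal K * (\<integral>\<^sup>+x. ennreal (indicator \<Omega> x * (\<bar>v x\<bar> + norm (G x))) \<partial>lborel)\<^sup>2"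
proof -
  have \<Omega>: "open \<Omega>" using dom by (auto simp: C2_bounded_domain_def)
  obtain N where N: "N \<noteq> 0" "\<And>v. N \<bullet> v > 0 \<Longrightarrow> (\<exists>r>0. \<forall>x\<in>\<Omega> \<inter> ball c r. \<forall>t\<ge>0.
           x + t *\<^sub>R v \<in> ball c r \<longrightarrow> x + t *\<^sub>R v \<in> \<Omega>)"
    using inward_directions[OF dom c] by blast
  obtain v1 v2 where v12: "N \<bullet> v1 > 0" "N \<bullet> v2 > 0"
    and kk: "\<And>r. \<exists>k::real. k \<ge> 0 \<and> (\<forall>A. A \<in> borel_measurable borel \<longrightarrow>
     (\<integral>\<^sup>+x. indicator (ball c r) x * ((\<integral>\<^sup>+s. A (x + s *\<^sub>R v1) \<partial>lborel) * (\<integral>\<^sup>+t. A (x + t *\<^sub>R v2) \<partial>lborel)) \<partial>lborel)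
       \<le> ennreal k * (\<integral>\<^sup>+x. A x \<partial>lborel)\<^sup>2)"
    using two_directions[OF dim N(1), of c] by blast
  obtain r1 where r1: "r1 > 0" "\<And>x t. x\<in>\<Omega> \<inter> ball c r1 \<Longrightarrow> t\<ge>0 \<Longrightarrow> x + t *\<^sub>R v1 \<in> ball c r1 \<Longrightarrow> x + t *\<^sub>R v1 \<in> \<Omega>"
    using N(2)[OF v12(1)] by blast
  obtain r2 where r2: "r2 > 0" "\<And>x t. x\<in>\<Omega> \<inter> ball c r2 \<Longrightarrow> t\<ge>0 \<Longrightarrow> x + t *\<^sub>R v2 \<in> ball c r2 \<Longrightarrow> x + t *\<^sub>R v2 \<in> \<Omega>"
    using N(2)[OF v12(2)] by blast
  define r where "r = min r1 r2"
  have r: "r > 0" using r1 r2 by (simp add: r_def)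
  obtain k where k: "k \<ge> 0" "\<And>A. A \<in> borel_measurable borel \<Longrightarrow>
     (\<integral>\<^sup>+x. indicator (ball c r) x * ((\<integral>\<^sup>+s. A (x + s *\<^sub>R v1) \<partial>lborel) * (\<integral>\<^sup>+t. A (x + t *\<^sub>R v2) \<partial>lborel)) \<partial>lborel)
       \<le> ennreal k * (\<integral>\<^sup>+x. A x \<partial>lborel)\<^sup>2"
    using kk[of r] by blast
  define D where "D = (norm v1 + norm v2) * (r ^ 4 + 4 * r ^ 3)"
  have D: "D \<ge> 0" "norm v1 * (r ^ 4 + 4 * r ^ 3) \<le> D" "norm v2 * (r ^ 4 + 4 * r ^ 3) \<le> D"
    using r unfolding D_def by (auto intro!: mult_right_mono)
  \<comment> \<open>Within distance \<open>r / 2\<close> of the centre, the squared radius minus the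
    squared distance is at least \<open>3 / 4 * r\<^sup>2\<close>, and the bump is the square of
    this quantity.\<close>
  define \<kappa> where "\<kappa> = (3 / 4 * r\<^sup>2)\<^sup>2"
  have \<kappa>: "\<kappa> > 0" using r by (simp add: \<kappa>_def)
  have \<kappa>b: "\<kappa> \<le> bump c r x" if "x \<in> ball c (r / 2)" for x
  proof -
    have "norm (x - c) \<le> r / 2" using that by (simp add: dist_norm norm_minus_commute)
    then have "(norm (x - c))\<^sup>2 \<le> (r / 2)\<^sup>2" by (intro power_mono) auto
    then have "3 / 4 * r\<^sup>2 \<le> r\<^sup>2 - (x - c) \<bullet> (x - c)" by (simp add: power2_norm_eq_inner power_divide)
    then show ?thesis unfolding \<kappa>_def bump_def
      by (intro power_mono max.coboundedI2) auto
  qed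
  have "(\<integral>\<^sup>+x. indicator (\<Omega> \<inter> ball c (r / 2)) x * ennreal ((v x)\<^sup>2) \<partial>lborel)
      \<le> ennreal (k * D\<^sup>2 / \<kappa>\<^sup>2) * (\<integral>\<^sup>+x. ennreal (indicator \<Omega> x * (\<bar>v x\<bar> + norm (G x))) \<partial>lborel)\<^sup>2"
    if v: "C1_bounded \<Omega> v G" for v G
  proof -
    have vc: "continuous_on \<Omega> v" "continuous_on \<Omega> G" using C1_bounded_continuous[OF v] v by (auto simp: C1_bounded_def)
    define g where "g x = indicator \<Omega> x * (\<bar>v x\<bar> + norm (G x))" for x
    have g0: "g x \<ge> 0" for x by (simp add: g_def)
    have [measurable]: "g \<in> borel_measurable borel"
    proof -
      have "(\<lambda>x. indicator \<Omega> x *\<^sub>R (\<bar>v x\<bar> + norm (G x))) \<in> borel_measurable borel"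
        using \<Omega> by (intro borel_measurable_continuous_on_indicator continuous_intros vc) auto
      then show ?thesis by (simp add: g_def[abs_def])
    qed
    define A where "A x = ennreal (D * g x)" for x
    have [measurable]: "A \<in> borel_measurable borel" unfolding A_def by measurable
    have Ag: "A y = ennreal (indicator \<Omega> y * (D * (\<bar>v y\<bar> + norm (G y))))" for y
      by (simp add: A_def g_def mult_ac)
    have pt: "indicator (\<Omega> \<inter> ball c (r / 2)) x * ennreal ((v x)\<^sup>2) \<le>
        ennreal (1 / \<kappa>\<^sup>2) * (indicator (ball c r) x * ((\<integral>\<^sup>+s. A (x + s *\<^sub>R v1) \<partial>lborel) * (\<integral>\<^sup>+t. A (x + t *\<^sub>R v2) \<partial>lborel)))" for x
    proof (cases "x \<in> \<Omega> \<inter> ball c (r / 2)")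
      case True
      have xr: "x \<in> \<Omega> \<inter> ball c r" using True r by auto
      have "ennreal (\<kappa> * \<bar>v x\<bar>) \<le> ennreal (bump c r x * \<bar>v x\<bar>)"
        using \<kappa>b[of x] True by (intro ennreal_leI mult_right_mono) auto
      also have "\<dots> \<le> (\<integral>\<^sup>+s. A (x + s *\<^sub>R v1) \<partial>lborel)"
        unfolding Ag by (rule bump_le_line_integral[OF \<Omega> v r _ _ xr D(2)])
          (use v12 r1 in \<open>auto simp: r_def\<close>)
      finally have 1: "ennreal (\<kappa> * \<bar>v x\<bar>) \<le> (\<integral>\<^sup>+s. A (x + s *\<^sub>R v1) \<partial>lborel)" .
      have "ennreal (\<kappa> * \<bar>v x\<bar>) \<le> ennreal (bump c r x * \<bar>v x\<bar>)"
        using \<kappa>b[of x] True by (intro ennreal_leI mult_right_mono) auto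
      also have "\<dots> \<le> (\<integral>\<^sup>+s. A (x + s *\<^sub>R v2) \<partial>lborel)"
        unfolding Ag by (rule bump_le_line_integral[OF \<Omega> v r _ _ xr D(3)])
          (use v12 r2 in \<open>auto simp: r_def\<close>)
      finally have 2: "ennreal (\<kappa> * \<bar>v x\<bar>) \<le> (\<integral>\<^sup>+s. A (x + s *\<^sub>R v2) \<partial>lborel)" .
      have "ennreal ((v x)\<^sup>2) = ennreal (1 / \<kappa>\<^sup>2) * (ennreal (\<kappa> * \<bar>v x\<bar>) * ennreal (\<kappa> * \<bar>v x\<bar>))"
        using \<kappa> by (simp add: ennreal_mult[symmetric] power2_eq_square field_simps)
      also have "\<dots> \<le> ennreal (1 / \<kappa>\<^sup>2) * ((\<integral>\<^sup>+s. A (x + s *\<^sub>R v1) \<partial>lborel) * (\<integral>\<^sup>+t. A (x + t *\<^sub>R v2) \<partial>lborel))"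
        by (intro mult_left_mono mult_mono 1 2) auto
      finally show ?thesis using True xr by simp
    qed simp
    have "(\<integral>\<^sup>+x. indicator (\<Omega> \<inter> ball c (r / 2)) x * ennreal ((v x)\<^sup>2) \<partial>lborel)
      \<le> (\<integral>\<^sup>+x. ennreal (1 / \<kappa>\<^sup>2) * (indicator (ball c r) x * ((\<integral>\<^sup>+s. A (x + s *\<^sub>R v1) \<partial>lborel) * (\<integral>\<^sup>+t. A (x + t *\<^sub>R v2) \<partial>lborel))) \<partial>lborel)"
      by (intro nn_integral_mono pt)
    also have "\<dots> = ennreal (1 / \<kappa>\<^sup>2) * (\<integral>\<^sup>+x. indicator (ball c r) x * ((\<integral>\<^sup>+s. A (x + s *\<^sub>R v1) \<partial>lborel) * (\<integral>\<^sup>+t. A (x + t *\<^sub>R v2) \<partial>lborel)) \<partial>lborel)"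
      by (rule nn_integral_cmult) (auto intro!: borel_measurable_indicator borel_measurable_times_ennreal)
    also have "\<dots> \<le> ennreal (1 / \<kappa>\<^sup>2) * (ennreal k * (\<integral>\<^sup>+x. A x \<partial>lborel)\<^sup>2)"
      by (intro mult_left_mono k) auto
    also have "(\<integral>\<^sup>+x. A x \<partial>lborel) = ennreal D * (\<integral>\<^sup>+x. ennreal (g x) \<partial>lborel)"
      unfolding A_def using D(1) g0 by (simp add: ennreal_mult nn_integral_cmult)
    also have "ennreal (1 / \<kappa>\<^sup>2) * (ennreal k * (ennreal D * (\<integral>\<^sup>+x. ennreal (g x) \<partial>lborel))\<^sup>2)
       = ennreal (k * D\<^sup>2 / \<kappa>\<^sup>2) * (\<integral>\<^sup>+x. ennreal (g x) \<partial>lborel)\<^sup>2"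
    proof -
      have "ennreal (k * D\<^sup>2 / \<kappa>\<^sup>2) = ennreal (1 / \<kappa>\<^sup>2) * (ennreal k * (ennreal D * ennreal D))"
        using k(1) D(1) by (simp add: ennreal_mult[symmetric] power2_eq_square)
      then show ?thesis by (simp add: power2_eq_square mult_ac)
    qed
    finally show ?thesis by (simp add: g_def)
  qed
  moreover have "k * D\<^sup>2 / \<kappa>\<^sup>2 \<ge> 0" using k(1) by simp
  ultimately show ?thesis using r by blast
qed

text \<open>Compactness of the closure leaves finitely many half balls. The local bounds already
  have the integral over all of \<open>\<Omega>\<close> on the right, so their constants simply add
  up.\<close>

lemma W11_embedding_nn:
  fixes \<Omega> :: "'a::euclidean_space set"
  assumes dom: "C2_bounded_domain \<Omega>" and dim: "DIM('a) \<le> 2"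
  shows "\<exists>K\<ge>0. \<forall>v G. C1_bounded \<Omega> v G \<longrightarrow>
    (\<integral>\<^sup>+x. indicator \<Omega> x * ennreal ((v x)\<^sup>2) \<partial>lborel)
      \<le> ennreal K * (\<integral>\<^sup>+x. ennreal (indicator \<Omega> x * (\<bar>v x\<bar> + norm (G x))) \<partial>lborel)\<^sup>2"
proof -
  have \<Omega>: "open \<Omega>" "bounded \<Omega>" using dom by (auto simp: C2_bounded_domain_def)
  define P where "P c r K \<longleftrightarrow> K \<ge> 0 \<and> (\<forall>v G. C1_bounded \<Omega> v G \<longrightarrow>
    (\<integral>\<^sup>+x. indicator (\<Omega> \<inter> ball c (r / 2)) x * ennreal ((v x)\<^sup>2) \<partial>lborel)
      \<le> ennreal K * (\<integral>\<^sup>+x. ennreal (indicator \<Omega> x * (\<bar>v x\<bar> + norm (G x))) \<partial>lborel)\<^sup>2)" for c r K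
  have "\<forall>c\<in>closure \<Omega>. \<exists>r K. r > 0 \<and> P c r K"
    using W11_embedding_local[OF dom dim] unfolding P_def by blast
  then obtain r K where rK: "\<And>c. c \<in> closure \<Omega> \<Longrightarrow> r c > 0" "\<And>c. c \<in> closure \<Omega> \<Longrightarrow> P c (r c) (K c)"
    by metis
  have "compact (closure \<Omega>)" using \<Omega> by (simp add: compact_closure)
  then obtain F where F: "F \<subseteq> closure \<Omega>" "finite F" "closure \<Omega> \<subseteq> (\<Union>c\<in>F. ball c (r c / 2))"
  proof (rule compactE_image[of "closure \<Omega>" "closure \<Omega>" "\<lambda>c. ball c (r c / 2)"])
    show "closure \<Omega> \<subseteq> (\<Union>c\<in>closure \<Omega>. ball c (r c / 2))" using rK(1) by force
  qed auto
  have K0: "K c \<ge> 0" if "c \<in> F" for c using rK(2)[of c] that F(1) by (auto simp: P_def)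
  show ?thesis
  proof (intro exI[of _ "\<Sum>c\<in>F. K c"] conjI allI impI)
    show "(\<Sum>c\<in>F. K c) \<ge> 0" by (intro sum_nonneg K0)
    fix v G assume v: "C1_bounded \<Omega> v G"
    define I where "I = (\<integral>\<^sup>+x. ennreal (indicator \<Omega> x * (\<bar>v x\<bar> + norm (G x))) \<partial>lborel)\<^sup>2"
    have m: "(\<lambda>x. indicator (\<Omega> \<inter> ball c q) x * ennreal ((v x)\<^sup>2)) \<in> borel_measurable borel" for c q
    proof -
      have "(\<lambda>x. indicator (\<Omega> \<inter> ball c q) x *\<^sub>R (v x)\<^sup>2) \<in> borel_measurable borel"
        using \<Omega> C1_bounded_continuous[OF v]
        by (intro borel_measurable_continuous_on_indicator continuous_intros) (auto intro: continuous_on_subset)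
      then have "(\<lambda>x. ennreal (indicator (\<Omega> \<inter> ball c q) x *\<^sub>R (v x)\<^sup>2)) \<in> borel_measurable borel" by measurable
      also have "(\<lambda>x. ennreal (indicator (\<Omega> \<inter> ball c q) x *\<^sub>R (v x)\<^sup>2)) = (\<lambda>x. indicator (\<Omega> \<inter> ball c q) x * ennreal ((v x)\<^sup>2))"
        by (auto simp: indicator_def)
      finally show ?thesis .
    qed
    have "(\<integral>\<^sup>+x. indicator \<Omega> x * ennreal ((v x)\<^sup>2) \<partial>lborel)
      \<le> (\<integral>\<^sup>+x. (\<Sum>c\<in>F. indicator (\<Omega> \<inter> ball c (r c / 2)) x * ennreal ((v x)\<^sup>2)) \<partial>lborel)"
    proof (rule nn_integral_mono)
      fix x
      show "indicator \<Omega> x * ennreal ((v x)\<^sup>2) \<le> (\<Sum>c\<in>F. indicator (\<Omega> \<inter> ball c (r c / 2)) x * ennreal ((v x)\<^sup>2))"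
      proof (cases "x \<in> \<Omega>")
        case True
        then have "x \<in> closure \<Omega>" using closure_subset by blast
        then obtain c where c: "c \<in> F" "x \<in> ball c (r c / 2)" using F(3) by blast
        then have "indicator \<Omega> x * ennreal ((v x)\<^sup>2) = indicator (\<Omega> \<inter> ball c (r c / 2)) x * ennreal ((v x)\<^sup>2)"
          using True by (simp add: indicator_def)
        also have "\<dots> \<le> (\<Sum>c\<in>F. indicator (\<Omega> \<inter> ball c (r c / 2)) x * ennreal ((v x)\<^sup>2))"
          using c F(2) by (intro member_le_sum) auto
        finally show ?thesis .
      qed simp
    qed
    also have "\<dots> = (\<Sum>c\<in>F. \<integral>\<^sup>+x. indicator (\<Omega> \<inter> ball c (r c / 2)) x * ennreal ((v x)\<^sup>2) \<partial>lborel)"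
      using m by (intro nn_integral_sum) auto
    also have "\<dots> \<le> (\<Sum>c\<in>F. ennreal (K c) * I)"
      using rK(2) F(1) v by (intro sum_mono) (auto simp: P_def I_def)
    also have "\<dots> = ennreal (\<Sum>c\<in>F. K c) * I"
      using K0 by (simp add: sum_distrib_right[symmetric])
    finally show "(\<integral>\<^sup>+x. indicator \<Omega> x * ennreal ((v x)\<^sup>2) \<partial>lborel) \<le> ennreal (\<Sum>c\<in>F. K c) *
        (\<integral>\<^sup>+x. ennreal (indicator \<Omega> x * (\<bar>v x\<bar> + norm (G x))) \<partial>lborel)\<^sup>2" by (simp add: I_def)
  qed
qed

lemma set_integrable_C1_bounded_square:
  assumes \<Omega>: "open \<Omega>" "bounded \<Omega>" and v: "C1_bounded \<Omega> v G"
  shows "set_integrable lborel \<Omega> (\<lambda>x. (v x)\<^sup>2 + (norm (G x))\<^sup>2)"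
proof -
  obtain M where M: "\<And>x. x \<in> \<Omega> \<Longrightarrow> \<bar>v x\<bar> \<le> M" using v by (auto simp: C1_bounded_def bounded_iff)
  obtain M' where M': "\<And>x. x \<in> \<Omega> \<Longrightarrow> norm (G x) \<le> M'" using v by (auto simp: C1_bounded_def bounded_iff)
  show ?thesis
  proof (rule set_integrable_bounded_continuous)
    show "continuous_on \<Omega> (\<lambda>x. (v x)\<^sup>2 + (norm (G x))\<^sup>2)"
      using v C1_bounded_continuous[OF v] by (auto simp: C1_bounded_def intro!: continuous_intros)
    show "bounded ((\<lambda>x. (v x)\<^sup>2 + (norm (G x))\<^sup>2) ` \<Omega>)"
    proof (rule boundedI[where B = "M\<^sup>2 + M'\<^sup>2"]; clarify)
      fix x assume x: "x \<in> \<Omega>"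
      have "(v x)\<^sup>2 \<le> M\<^sup>2" using power_mono[OF M[OF x], of 2] by simp
      moreover have "(norm (G x))\<^sup>2 \<le> M'\<^sup>2" using power_mono[OF M'[OF x], of 2] by simp
      ultimately show "norm ((v x)\<^sup>2 + (norm (G x))\<^sup>2) \<le> M\<^sup>2 + M'\<^sup>2" by simp
    qed
  qed (use \<Omega> in auto)
qed

lemma set_integrable_on_domain:
  fixes f :: "'a::euclidean_space \<Rightarrow> real"
  assumes "open \<Omega>" "bounded \<Omega>" "continuous_on \<Omega> f" "\<And>x. x \<in> \<Omega> \<Longrightarrow> \<bar>f x\<bar> \<le> B"
  shows "set_integrable lborel \<Omega> f"
  using assms by (intro set_integrable_bounded_continuous) (auto simp: bounded_iff)

lemma W11_embedding:
  fixes \<Omega> :: "'a::euclidean_space set"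
  assumes dom: "C2_bounded_domain \<Omega>" and dim: "DIM('a) \<le> 2"
  shows "\<exists>K\<ge>0. \<forall>v G. C1_bounded \<Omega> v G \<longrightarrow>
    (LINT x:\<Omega>|lborel. (v x)\<^sup>2) \<le> K * (LINT x:\<Omega>|lborel. \<bar>v x\<bar> + norm (G x))\<^sup>2"
proof -
  have \<Omega>: "open \<Omega>" "bounded \<Omega>" using dom by (auto simp: C2_bounded_domain_def)
  obtain K where K: "K \<ge> 0" "\<And>v G. C1_bounded \<Omega> v G \<Longrightarrow>
    (\<integral>\<^sup>+x. indicator \<Omega> x * ennreal ((v x)\<^sup>2) \<partial>lborel)
      \<le> ennreal K * (\<integral>\<^sup>+x. ennreal (indicator \<Omega> x * (\<bar>v x\<bar> + norm (G x))) \<partial>lborel)\<^sup>2"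
    using W11_embedding_nn[OF dom dim] by blast
  have "(LINT x:\<Omega>|lborel. (v x)\<^sup>2) \<le> K * (LINT x:\<Omega>|lborel. \<bar>v x\<bar> + norm (G x))\<^sup>2"
    if v: "C1_bounded \<Omega> v G" for v G
  proof -
    have c: "continuous_on \<Omega> v" "continuous_on \<Omega> G"
      using C1_bounded_continuous[OF v] v by (auto simp: C1_bounded_def)
    obtain M where M: "\<And>x. x \<in> \<Omega> \<Longrightarrow> \<bar>v x\<bar> \<le> M" using v by (auto simp: C1_bounded_def bounded_iff)
    obtain M' where M': "\<And>x. x \<in> \<Omega> \<Longrightarrow> norm (G x) \<le> M'" using v by (auto simp: C1_bounded_def bounded_iff)
    have i1: "set_integrable lborel \<Omega> (\<lambda>x. \<bar>v x\<bar> + norm (G x))"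
      by (rule set_integrable_on_domain[OF \<Omega>, where B = "M + M'"])
        (use M M' in \<open>auto intro!: continuous_intros c add_mono\<close>)
    have i2: "set_integrable lborel \<Omega> (\<lambda>x. (v x)\<^sup>2)"
      by (rule set_integrable_on_domain[OF \<Omega>, where B = "M\<^sup>2"])
        (use power_mono[OF M, of _ 2] in \<open>auto intro!: continuous_intros c\<close>)
    have 1: "(\<integral>\<^sup>+x. ennreal (indicator \<Omega> x * (\<bar>v x\<bar> + norm (G x))) \<partial>lborel) = ennreal (LINT x:\<Omega>|lborel. \<bar>v x\<bar> + norm (G x))"
      unfolding set_lebesgue_integral_def using i1 unfolding set_integrable_def
      by (subst nn_integral_eq_integral) auto
    have "(\<integral>\<^sup>+x. indicator \<Omega> x * ennreal ((v x)\<^sup>2) \<partial>lborel) = (\<integral>\<^sup>+x. ennreal (indicator \<Omega> x *\<^sub>R (v x)\<^sup>2) \<partial>lborel)"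
      by (rule nn_integral_cong) (auto simp: indicator_def)
    also have "\<dots> = ennreal (LINT x:\<Omega>|lborel. (v x)\<^sup>2)"
      unfolding set_lebesgue_integral_def using i2 unfolding set_integrable_def
      by (subst nn_integral_eq_integral) auto
    finally have 2: "(\<integral>\<^sup>+x. indicator \<Omega> x * ennreal ((v x)\<^sup>2) \<partial>lborel) = ennreal (LINT x:\<Omega>|lborel. (v x)\<^sup>2)" .
    have J0: "(LINT x:\<Omega>|lborel. \<bar>v x\<bar> + norm (G x)) \<ge> 0"
      unfolding set_lebesgue_integral_def by (intro Bochner_Integration.integral_nonneg) auto
    have "ennreal (LINT x:\<Omega>|lborel. (v x)\<^sup>2) \<le> ennreal (K * (LINT x:\<Omega>|lborel. \<bar>v x\<bar> + norm (G x))\<^sup>2)"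
      using K(2)[OF v] K(1) J0 unfolding 1 2 by (simp add: ennreal_mult' ennreal_power)
    then show ?thesis using K(1) by (subst (asm) ennreal_le_iff) auto
  qed
  with K(1) show ?thesis by blast
qed

lemma Cauchy_Schwarz_integral:
  fixes f g :: "'a \<Rightarrow> real"
  assumes "integrable M (\<lambda>x. f x * g x)" "integrable M (\<lambda>x. (f x)\<^sup>2)" "integrable M (\<lambda>x. (g x)\<^sup>2)"
  shows "(\<integral>x. f x * g x \<partial>M)\<^sup>2 \<le> (\<integral>x. (f x)\<^sup>2 \<partial>M) * (\<integral>x. (g x)\<^sup>2 \<partial>M)"
proof -
  define P where "P = (\<integral>x. f x * g x \<partial>M)"
  define F where "F = (\<integral>x. (f x)\<^sup>2 \<partial>M)"
  define G where "G = (\<integral>x. (g x)\<^sup>2 \<partial>M)"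
  have q: "0 \<le> F - 2 * l * P + l\<^sup>2 * G" for l
  proof -
    have "0 \<le> (\<integral>x. (f x - l * g x)\<^sup>2 \<partial>M)" by (intro Bochner_Integration.integral_nonneg) auto
    also have "\<dots> = (\<integral>x. (f x)\<^sup>2 - (2 * l) * (f x * g x) + l\<^sup>2 * (g x)\<^sup>2 \<partial>M)"
      by (intro Bochner_Integration.integral_cong) (auto simp: power2_eq_square algebra_simps)
    also have "\<dots> = F - (2 * l) * P + l\<^sup>2 * G"
      using assms by (simp add: F_def P_def G_def)
    finally show ?thesis by simp
  qed
  have F0: "F \<ge> 0" "G \<ge> 0" unfolding F_def G_def by (intro Bochner_Integration.integral_nonneg; simp)+
  show ?thesis
  proof (cases "G = 0")
    case True
    have "P = 0"
    proof (rule ccontr)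
      assume "P \<noteq> 0"
      \<comment> \<open>With \<open>G = 0\<close> the quadratic is affine in its parameter, and this
        choice would give it the value -1.\<close>
      then show False using q[of "(F + 1) / (2 * P)"] True by simp
    qed
    then show ?thesis using F0 by (simp add: P_def F_def G_def)
  next
    case False
    then have G: "G > 0" using F0 by simp
    have "0 \<le> F - 2 * (P / G) * P + (P / G)\<^sup>2 * G" by (rule q)
    also have "\<dots> = F - P\<^sup>2 / G" using G by (simp add: power2_eq_square field_simps)
    finally have "P\<^sup>2 \<le> F * G" using G by (simp add: field_simps)
    then show ?thesis by (simp add: P_def F_def G_def)
  qed
qed

lemma Cauchy_Schwarz_set_integral:
  fixes f g :: "'a \<Rightarrow> real"
  assumes "set_integrable M S (\<lambda>x. f x * g x)" "set_integrable M S (\<lambda>x. (f x)\<^sup>2)" "set_integrable M S (\<lambda>x. (g x)\<^sup>2)"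
  shows "(LINT x:S|M. f x * g x)\<^sup>2 \<le> (LINT x:S|M. (f x)\<^sup>2) * (LINT x:S|M. (g x)\<^sup>2)"
proof -
  have *: "indicator S x *\<^sub>R (f x * g x) = (indicator S x * f x) * (indicator S x * g x)"
    "indicator S x *\<^sub>R (f x)\<^sup>2 = (indicator S x * f x)\<^sup>2" "indicator S x *\<^sub>R (g x)\<^sup>2 = (indicator S x * g x)\<^sup>2" for x
    by (auto simp: indicator_def)
  show ?thesis
    using assms unfolding set_integrable_def set_lebesgue_integral_def *
    by (intro Cauchy_Schwarz_integral)
qed

text \<open>Apply the embedding of \<open>W\<^sup>1\<^sup>,\<^sup>1\<close> into \<open>L\<^sup>2\<close> to \<open>v\<^sup>k\<close> and iterate.\<close>

theorem sobolev_even_power: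
  fixes \<Omega> :: "'a::euclidean_space set"
  assumes dom: "C2_bounded_domain \<Omega>" and dim: "DIM('a) \<le> 2"
  shows "\<exists>K\<ge>0. \<forall>v G. C1_bounded \<Omega> v G \<longrightarrow> (\<forall>x\<in>\<Omega>. v x \<ge> 0) \<longrightarrow>
    (LINT x:\<Omega>|lborel. v x ^ (2 * k)) \<le> K * (LINT x:\<Omega>|lborel. (v x)\<^sup>2 + (norm (G x))\<^sup>2) ^ k"
proof (induction k)
  have \<Omega>: "open \<Omega>" "bounded \<Omega>" using dom by (auto simp: C2_bounded_domain_def)
  case 0
  have "(LINT x:\<Omega>|lborel. 1) = measure lborel \<Omega>"
    using \<Omega> emeasure_bounded_finite[of \<Omega>] by (subst set_integral_const) auto
  then show ?case
    by (intro exI[of _ "measure lborel \<Omega>"]) auto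
next
  have \<Omega>: "open \<Omega>" "bounded \<Omega>" using dom by (auto simp: C2_bounded_domain_def)
  case (Suc k)
  then obtain K where K: "K \<ge> 0" "\<And>v G. C1_bounded \<Omega> v G \<Longrightarrow> (\<forall>x\<in>\<Omega>. v x \<ge> 0) \<Longrightarrow>
    (LINT x:\<Omega>|lborel. v x ^ (2 * k)) \<le> K * (LINT x:\<Omega>|lborel. (v x)\<^sup>2 + (norm (G x))\<^sup>2) ^ k"
    by blast
  obtain K1 where K1: "K1 \<ge> 0" "\<And>v G. C1_bounded \<Omega> v G \<Longrightarrow>
    (LINT x:\<Omega>|lborel. (v x)\<^sup>2) \<le> K1 * (LINT x:\<Omega>|lborel. \<bar>v x\<bar> + norm (G x))\<^sup>2"
    using W11_embedding[OF dom dim] by blast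
  define n where "n = real (Suc k)"
  have n1: "n \<ge> 1" by (simp add: n_def)
  \<comment> \<open>The gradient of the power \<open>Suc k\<close> carries the factor
    \<open>n\<close>, so value plus gradient norm is
    \<open>v x ^ k * (v x + n * norm (G x))\<close>. Cauchy-Schwarz separates the two factors: the
    first is bounded by the induction hypothesis, the second contributes
    \<open>2 * n\<^sup>2\<close> times the squared H^1 norm.\<close>
  have "(LINT x:\<Omega>|lborel. v x ^ (2 * Suc k)) \<le> (K1 * K * (2 * n\<^sup>2)) * (LINT x:\<Omega>|lborel. (v x)\<^sup>2 + (norm (G x))\<^sup>2) ^ Suc k"
    if v: "C1_bounded \<Omega> v G" and pos: "\<forall>x\<in>\<Omega>. v x \<ge> 0" for v G
  proof -
    have c: "continuous_on \<Omega> v" "continuous_on \<Omega> G"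
      using C1_bounded_continuous[OF v] v by (auto simp: C1_bounded_def)
    obtain M where M: "\<And>x. x \<in> \<Omega> \<Longrightarrow> \<bar>v x\<bar> \<le> M" using v by (auto simp: C1_bounded_def bounded_iff)
    obtain M' where M': "\<And>x. x \<in> \<Omega> \<Longrightarrow> norm (G x) \<le> M'" using v by (auto simp: C1_bounded_def bounded_iff)
    define H where "H = (LINT x:\<Omega>|lborel. (v x)\<^sup>2 + (norm (G x))\<^sup>2)"
    have H0: "H \<ge> 0" unfolding H_def set_lebesgue_integral_def by (intro Bochner_Integration.integral_nonneg) auto
    define G' where "G' x = (n * v x ^ k) *\<^sub>R G x" for x
    have bdp: "\<bar>v x ^ j\<bar> \<le> M ^ j" if "x \<in> \<Omega>" for x j
      using M[OF that] by (simp add: power_abs power_mono)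
    have v': "C1_bounded \<Omega> (\<lambda>x. v x ^ Suc k) G'"
      unfolding C1_bounded_def
    proof (intro conjI ballI)
      fix x assume x: "x \<in> \<Omega>"
      have "(v has_derivative (\<lambda>h. G x \<bullet> h)) (at x)" using v x by (simp add: C1_bounded_def)
      then have "((\<lambda>x. v x ^ Suc k) has_derivative (\<lambda>h. of_nat (Suc k) * (G x \<bullet> h) * v x ^ k)) (at x)"
        using has_derivative_power[of v "\<lambda>h. G x \<bullet> h" x UNIV "Suc k"] by simp
      moreover have "(\<lambda>h. of_nat (Suc k) * (G x \<bullet> h) * v x ^ k) = (\<lambda>h. G' x \<bullet> h)"
        by (auto simp: G'_def n_def)
      ultimately show "((\<lambda>x. v x ^ Suc k) has_derivative (\<bullet>) (G' x)) (at x)" by simp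
    next
      show "continuous_on \<Omega> G'" unfolding G'_def[abs_def] by (intro continuous_intros c)
      show "bounded ((\<lambda>x. v x ^ Suc k) ` \<Omega>)"
        using bdp[of _ "Suc k"] by (auto intro!: boundedI simp del: power_Suc)
      show "bounded (G' ` \<Omega>)"
      proof (rule boundedI; clarify)
        fix x assume x: "x \<in> \<Omega>"
        have "norm (G' x) = n * \<bar>v x ^ k\<bar> * norm (G x)" using n1 by (simp add: G'_def abs_mult)
        also have "\<dots> \<le> n * M ^ k * M'"
        proof (intro mult_mono M' x bdp)
          have "0 \<le> M" using M[OF x] by linarith
          then show "0 \<le> n * M ^ k" using n1 by simp
        qed (use n1 in auto)
        finally show "norm (G' x) \<le> n * M ^ k * M'" .
      qed
    qed
    have i1: "set_integrable lborel \<Omega> (\<lambda>x. v x ^ k * (v x + n * norm (G x)))"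
    proof (rule set_integrable_bounded_continuous)
      show "continuous_on \<Omega> (\<lambda>x. v x ^ k * (v x + n * norm (G x)))" by (intro continuous_intros c)
      show "bounded ((\<lambda>x. v x ^ k * (v x + n * norm (G x))) ` \<Omega>)"
      proof (rule boundedI; clarify)
        fix x assume x: "x \<in> \<Omega>"
        have "\<bar>v x + n * norm (G x)\<bar> \<le> \<bar>v x\<bar> + n * norm (G x)" using n1 by (simp add: abs_triangle_ineq[THEN order_trans])
        also have "\<dots> \<le> M + n * M'" using n1 M[OF x] M'[OF x] by (intro add_mono mult_left_mono) auto
        finally have "\<bar>v x ^ k\<bar> * \<bar>v x + n * norm (G x)\<bar> \<le> M ^ k * (M + n * M')"
          using bdp[OF x, of k] by (intro mult_mono) auto
        then show "norm (v x ^ k * (v x + n * norm (G x))) \<le> M ^ k * (M + n * M')"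
          by (simp add: abs_mult)
      qed
    qed (use \<Omega> in auto)
    have i2: "set_integrable lborel \<Omega> (\<lambda>x. (v x ^ k)\<^sup>2)"
      by (rule set_integrable_on_domain[OF \<Omega>, where B = "(M ^ k)\<^sup>2"])
        (use power_mono[OF bdp, of _ k 2] in \<open>auto intro!: continuous_intros c\<close>)
    have iH: "set_integrable lborel \<Omega> (\<lambda>x. 2 * n\<^sup>2 * ((v x)\<^sup>2 + (norm (G x))\<^sup>2))"
      using set_integrable_C1_bounded_square[OF \<Omega> v] by simp
    have le: "(v x + n * norm (G x))\<^sup>2 \<le> 2 * n\<^sup>2 * ((v x)\<^sup>2 + (norm (G x))\<^sup>2)" for x
    proof -
      have "(v x + n * norm (G x))\<^sup>2 \<le> 2 * ((v x)\<^sup>2 + (n * norm (G x))\<^sup>2)"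
        using sum_squares_bound[of "v x" "n * norm (G x)"] by (simp add: power2_sum)
      moreover have "1 * (v x)\<^sup>2 \<le> n\<^sup>2 * (v x)\<^sup>2" using n1 by (intro mult_right_mono) auto
      ultimately show ?thesis by (simp add: power_mult_distrib algebra_simps)
    qed
    have i3: "set_integrable lborel \<Omega> (\<lambda>x. (v x + n * norm (G x))\<^sup>2)"
    proof (rule set_integrable_bound[OF iH])
      show "set_borel_measurable lborel \<Omega> (\<lambda>x. (v x + n * norm (G x))\<^sup>2)"
        unfolding set_borel_measurable_def measurable_lborel2 using \<Omega>
        by (intro borel_measurable_continuous_on_indicator continuous_intros c) auto
    qed (use le in auto)
    have "(LINT x:\<Omega>|lborel. v x ^ (2 * Suc k)) = (LINT x:\<Omega>|lborel. (v x ^ Suc k)\<^sup>2)"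
      by (simp only: power_even_eq)
    also have "\<dots> \<le> K1 * (LINT x:\<Omega>|lborel. \<bar>v x ^ Suc k\<bar> + norm (G' x))\<^sup>2"
      by (rule K1(2)[OF v'])
    also have "(LINT x:\<Omega>|lborel. \<bar>v x ^ Suc k\<bar> + norm (G' x)) = (LINT x:\<Omega>|lborel. v x ^ k * (v x + n * norm (G x)))"
      by (rule set_lebesgue_integral_cong) (use \<Omega> pos n1 in \<open>auto simp: G'_def abs_mult algebra_simps\<close>)
    also have "(LINT x:\<Omega>|lborel. v x ^ k * (v x + n * norm (G x)))\<^sup>2 \<le>
       (LINT x:\<Omega>|lborel. (v x ^ k)\<^sup>2) * (LINT x:\<Omega>|lborel. (v x + n * norm (G x))\<^sup>2)"
      by (rule Cauchy_Schwarz_set_integral[OF i1 i2 i3])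
    also have "(LINT x:\<Omega>|lborel. (v x ^ k)\<^sup>2) = (LINT x:\<Omega>|lborel. v x ^ (2 * k))"
      by (simp only: power_even_eq)
    also have "(LINT x:\<Omega>|lborel. v x ^ (2 * k)) * (LINT x:\<Omega>|lborel. (v x + n * norm (G x))\<^sup>2)
      \<le> (K * H ^ k) * (2 * n\<^sup>2 * H)"
    proof (rule mult_mono)
      show "(LINT x:\<Omega>|lborel. v x ^ (2 * k)) \<le> K * H ^ k" unfolding H_def by (rule K(2)[OF v pos])
      have "(LINT x:\<Omega>|lborel. (v x + n * norm (G x))\<^sup>2) \<le> (LINT x:\<Omega>|lborel. 2 * n\<^sup>2 * ((v x)\<^sup>2 + (norm (G x))\<^sup>2))"
        by (rule set_integral_mono[OF i3 iH]) (rule le)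
      then show "(LINT x:\<Omega>|lborel. (v x + n * norm (G x))\<^sup>2) \<le> 2 * n\<^sup>2 * H" by (simp add: H_def)
      show "0 \<le> (LINT x:\<Omega>|lborel. (v x + n * norm (G x))\<^sup>2)"
        unfolding set_lebesgue_integral_def by (intro Bochner_Integration.integral_nonneg) auto
    qed (use K H0 in simp)
    finally have "(LINT x:\<Omega>|lborel. v x ^ (2 * Suc k)) \<le> K1 * ((K * H ^ k) * (2 * n\<^sup>2 * H))"
      using K1(1) by (simp add: mult_left_mono)
    then show ?thesis by (simp add: H_def mult_ac)
  qed
  moreover have "K1 * K * (2 * n\<^sup>2) \<ge> 0" using K1 K by simp
  ultimately show ?case by blast
qed

section \<open>Energy inequality\<close>

locale cylinder =
  fixes T :: real and \<Omega> :: "'a::euclidean_space set"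
  assumes T: "T > 0" and op: "open \<Omega>" and bd: "bounded \<Omega>"
begin

abbreviation "Q \<equiv> {0..T} \<times> closure \<Omega>"

lemma compact_Q: "compact Q"
  using bd by (intro compact_Times) (auto simp: compact_closure)

lemma bounded_on_Q:
  fixes h :: "real \<times> 'a \<Rightarrow> 'b::real_normed_vector"
  assumes "continuous_on Q h"
  obtains B where "B \<ge> 0" "\<And>t x. t \<in> {0..T} \<Longrightarrow> x \<in> closure \<Omega> \<Longrightarrow> norm (h (t, x)) \<le> B"
proof -
  have "bounded (h ` Q)"
    using compact_continuous_image[OF assms compact_Q] by (rule compact_imp_bounded)
  then obtain B where B: "\<And>z. z \<in> Q \<Longrightarrow> norm (h z) \<le> B" by (auto simp: bounded_iff)
  show ?thesis
    by (rule that[of "\<bar>B\<bar>"]) (use B in \<open>auto intro: order_trans[OF _ abs_ge_self]\<close>)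
qed

lemma continuous_on_slice_space:
  assumes "continuous_on Q h" "t \<in> {0..T}"
  shows "continuous_on (closure \<Omega>) (\<lambda>x. h (t, x))"
  by (rule continuous_on_compose2[OF assms(1)]) (use assms(2) in \<open>auto intro!: continuous_intros\<close>)

lemma continuous_on_slice_time:
  assumes "continuous_on Q h" "x \<in> closure \<Omega>" "t \<le> T"
  shows "continuous_on {0..t} (\<lambda>s. h (s, x))"
  by (rule continuous_on_compose2[OF assms(1)]) (use assms(2,3) in \<open>auto intro!: continuous_intros\<close>)

lemma set_integrable_closure:
  fixes f :: "'a \<Rightarrow> real"
  assumes "continuous_on (closure \<Omega>) f"
  shows "set_integrable lborel \<Omega> f"
proof (rule set_integrable_bounded_continuous)
  have "bounded (f ` closure \<Omega>)"
    using assms bd by (intro compact_imp_bounded compact_continuous_image) (auto simp: compact_closure)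
  then show "bounded (f ` \<Omega>)" by (meson bounded_subset closure_subset image_mono)
  show "continuous_on \<Omega> f" using assms closure_subset continuous_on_subset by blast
qed (use op bd in auto)

text \<open>The interval of integration moves with the point, so it is rescaled to [0,1]; continuity
  of an integral with a parameter over a fixed interval then applies.\<close>

lemma continuous_on_time_integral:
  fixes h :: "real \<times> 'a \<Rightarrow> 'b::euclidean_space"
  assumes h: "continuous_on Q h"
  shows "continuous_on Q (\<lambda>z. integral {0..fst z} (\<lambda>s. h (s, snd z)))"
proof -
  have eq: "integral {0..t} (\<lambda>s. h (s, x)) = t *\<^sub>R integral {0..1} (\<lambda>s. h (t * s, x))"
    if t: "t \<in> {0..T}" and x: "x \<in> closure \<Omega>" for t x
  proof (cases "t = 0")
    case False
    then have t0: "t > 0" using t by simp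
    have "(\<lambda>s. h (s, x)) integrable_on {0..t}"
      using t x by (intro integrable_continuous_real continuous_on_slice_time[OF h]) auto
    then have "((\<lambda>s. h (s, x)) has_integral integral {0..t} (\<lambda>s. h (s, x))) {0..t}"
      by (rule integrable_integral)
    from has_integral_stretch_real[OF this, of t]
    have "((\<lambda>s. h (t * s, x)) has_integral (1 / t) *\<^sub>R integral {0..t} (\<lambda>s. h (s, x))) ((\<lambda>x. x / t) ` {0..t})"
      using t0 by simp
    moreover have "(\<lambda>x. x / t) ` {0..t} = {0..1}"
    proof -
      have "x \<in> (\<lambda>x. x / t) ` {0..t}" if "x \<in> {0..1}" for x
        by (rule image_eqI[of _ _ "t * x"]) (use that t0 in \<open>auto simp: mult_left_le\<close>)
      then show ?thesis using t0 by auto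
    qed
    ultimately have "integral {0..1} (\<lambda>s. h (t * s, x)) = (1 / t) *\<^sub>R integral {0..t} (\<lambda>s. h (s, x))"
      by (simp add: integral_unique)
    then show ?thesis using t0 by simp
  qed simp
  have "continuous_on Q (\<lambda>z. integral (cbox 0 1) (\<lambda>s. h (fst z * s, snd z)))"
  proof (rule integral_continuous_on_param)
    have "fst z * s \<in> {0..T}" if "fst z \<in> {0..T}" "s \<in> {0..1}" for z :: "real \<times> 'a" and s
      using that mult_left_le[of s "fst z"] by auto
    then show "continuous_on (Q \<times> cbox 0 1) (\<lambda>(z, s). h (fst z * s, snd z))"
      unfolding split_beta
      by (intro continuous_on_compose2[OF h] continuous_intros) (auto simp: mem_Times_iff)
  qed
  then have "continuous_on Q (\<lambda>z. fst z *\<^sub>R integral {0..1} (\<lambda>s. h (fst z * s, snd z)))"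
    by (intro continuous_intros) simp
  then show ?thesis
    by (rule continuous_on_eq) (auto simp: eq)
qed

lemma continuous_on_time_integral_space:
  fixes h :: "real \<times> 'a \<Rightarrow> 'b::euclidean_space"
  assumes "continuous_on Q h" "t \<in> {0..T}"
  shows "continuous_on (closure \<Omega>) (\<lambda>x. integral {0..t} (\<lambda>s. h (s, x)))"
  using continuous_on_slice_space[OF continuous_on_time_integral[OF assms(1)] assms(2)] by simp

lemma continuous_on_space_integral:
  fixes h :: "real \<times> 'a \<Rightarrow> real"
  assumes h: "continuous_on Q h"
  shows "continuous_on {0..T} (\<lambda>t. LINT x:\<Omega>|lborel. h (t, x))"
proof (rule continuous_on_sequentiallyI)
  fix f :: "nat \<Rightarrow> real" and t assume f: "\<forall>n. f n \<in> {0..T}" "t \<in> {0..T}" "f \<longlonglongrightarrow> t"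
  obtain B where B: "B \<ge> 0" "\<And>t x. t \<in> {0..T} \<Longrightarrow> x \<in> closure \<Omega> \<Longrightarrow> norm (h (t, x)) \<le> B"
    using bounded_on_Q[OF h] by blast
  have int: "set_integrable lborel \<Omega> (\<lambda>x. h (s, x))" if "s \<in> {0..T}" for s
    using continuous_on_slice_space[OF h that] by (rule set_integrable_closure)
  show "(\<lambda>n. LINT x:\<Omega>|lborel. h (f n, x)) \<longlonglongrightarrow> (LINT x:\<Omega>|lborel. h (t, x))"
    unfolding set_lebesgue_integral_def
  proof (rule integral_dominated_convergence)
    show "integrable lborel (\<lambda>x. indicator \<Omega> x * B)"
      using op bd by (intro integrable_mult_left integrable_real_indicator emeasure_bounded_finite) auto
    show "(\<lambda>x. indicat_real \<Omega> x *\<^sub>R h (t, x)) \<in> borel_measurable lborel"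
      using int[OF f(2)] unfolding set_integrable_def by (rule borel_measurable_integrable)
    show "(\<lambda>x. indicat_real \<Omega> x *\<^sub>R h (f n, x)) \<in> borel_measurable lborel" for n
      using int[of "f n"] f(1) unfolding set_integrable_def by (intro borel_measurable_integrable) auto
    show "AE x in lborel. (\<lambda>n. indicat_real \<Omega> x *\<^sub>R h (f n, x)) \<longlonglongrightarrow> indicat_real \<Omega> x *\<^sub>R h (t, x)"
    proof (rule AE_I2)
      fix x
      show "(\<lambda>n. indicat_real \<Omega> x *\<^sub>R h (f n, x)) \<longlonglongrightarrow> indicat_real \<Omega> x *\<^sub>R h (t, x)"
      proof (cases "x \<in> \<Omega>")
        case True
        then have "x \<in> closure \<Omega>" using closure_subset by blast
        from continuous_on_slice_time[OF h this order_refl]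
        have "(\<lambda>n. h (f n, x)) \<longlonglongrightarrow> h (t, x)"
          using f by (auto simp: continuous_on_sequentially o_def)
        then show ?thesis by (intro tendsto_intros)
      qed simp
    qed
    show "AE x in lborel. norm (indicat_real \<Omega> x *\<^sub>R h (f n, x)) \<le> indicat_real \<Omega> x * B" for n
    proof (rule AE_I2)
      fix x
      show "norm (indicat_real \<Omega> x *\<^sub>R h (f n, x)) \<le> indicat_real \<Omega> x * B"
      proof (cases "x \<in> \<Omega>")
        case True
        then show ?thesis using B(2)[of "f n" x] f(1) closure_subset[of \<Omega>] by auto
      qed simp
    qed
  qed
qed

text \<open>Time integrals are gauge integrals, space integrals are Lebesgue integrals. Both
  iterated integrals are identified with the Lebesgue integral over the cylinder, which is the form
  in which the space-time norms of the final estimate appear.\<close>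

lemma integral_space_time:
  fixes h :: "real \<times> 'a \<Rightarrow> real"
  assumes h: "continuous_on Q h" and t: "t \<in> {0..T}"
  shows "integral {0..t} (\<lambda>s. LINT x:\<Omega>|lborel. h (s, x)) = (LINT z:{0..t} \<times> \<Omega>|lborel. h z)"
    and "(LINT x:\<Omega>|lborel. integral {0..t} (\<lambda>s. h (s, x))) = (LINT z:{0..t} \<times> \<Omega>|lborel. h z)"
proof -
  define k where "k s x = indicator ({0..t} \<times> \<Omega>) (s, x) *\<^sub>R h (s, x)" for s x
  have sub: "{0..t} \<times> \<Omega> \<subseteq> Q" using t closure_subset by auto
  have S: "{0..t} \<times> \<Omega> \<in> sets (borel :: (real \<times> 'a) measure)"
    using op by (intro borel_Times) auto
  have "set_integrable lborel ({0..t} \<times> \<Omega>) h"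
  proof (rule set_integrable_bounded_continuous[OF S])
    show "bounded ({0..t} \<times> \<Omega>)" using bd by (intro bounded_Times) auto
    show "continuous_on ({0..t} \<times> \<Omega>) h" using h sub by (rule continuous_on_subset)
    have "bounded (h ` Q)" using compact_continuous_image[OF h compact_Q] by (rule compact_imp_bounded)
    then show "bounded (h ` ({0..t} \<times> \<Omega>))" by (rule bounded_subset) (use sub in blast)
  qed
  then have int: "integrable (lborel \<Otimes>\<^sub>M lborel) (case_prod k)"
    by (simp add: set_integrable_def lborel_prod k_def split_beta')
  have tot: "(LINT z:{0..t} \<times> \<Omega>|lborel. h z) = (\<integral>z. case_prod k z \<partial>(lborel \<Otimes>\<^sub>M lborel))"
    by (simp add: set_lebesgue_integral_def lborel_prod k_def split_beta')
  have si: "set_integrable lborel {0..t} (\<lambda>s. LINT x:\<Omega>|lborel. h (s, x))"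
    using t by (intro borel_integrable_atLeastAtMost' continuous_on_subset[OF continuous_on_space_integral[OF h]]) auto
  have "integral {0..t} (\<lambda>s. LINT x:\<Omega>|lborel. h (s, x)) = (LINT s:{0..t}|lborel. LINT x:\<Omega>|lborel. h (s, x))"
    using set_borel_integral_eq_integral(2)[OF si] by simp
  also have "\<dots> = (\<integral>s. (\<integral>x. k s x \<partial>lborel) \<partial>lborel)"
    unfolding set_lebesgue_integral_def k_def
    by (intro Bochner_Integration.integral_cong refl) (auto simp: indicator_def intro!: Bochner_Integration.integral_cong)
  also have "\<dots> = (\<integral>z. case_prod k z \<partial>(lborel \<Otimes>\<^sub>M lborel))"
    by (rule lborel_pair.integral_fst[OF int])
  finally show "integral {0..t} (\<lambda>s. LINT x:\<Omega>|lborel. h (s, x)) = (LINT z:{0..t} \<times> \<Omega>|lborel. h z)"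
    using tot by simp
  have "(LINT x:\<Omega>|lborel. integral {0..t} (\<lambda>s. h (s, x))) = (\<integral>x. (\<integral>s. k s x \<partial>lborel) \<partial>lborel)"
    unfolding set_lebesgue_integral_def
  proof (rule Bochner_Integration.integral_cong[OF refl])
    fix x
    show "indicat_real \<Omega> x *\<^sub>R integral {0..t} (\<lambda>s. h (s, x)) = (\<integral>s. k s x \<partial>lborel)"
    proof (cases "x \<in> \<Omega>")
      case True
      then have "x \<in> closure \<Omega>" using closure_subset by blast
      then have "set_integrable lborel {0..t} (\<lambda>s. h (s, x))"
        using t by (intro borel_integrable_atLeastAtMost' continuous_on_slice_time[OF h]) auto
      from set_borel_integral_eq_integral(2)[OF this]
      have "integral {0..t} (\<lambda>s. h (s, x)) = (\<integral>s. indicator {0..t} s *\<^sub>R h (s, x) \<partial>lborel)"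
        by (simp add: set_lebesgue_integral_def)
      also have "\<dots> = (\<integral>s. k s x \<partial>lborel)"
        by (rule Bochner_Integration.integral_cong) (use True in \<open>auto simp: k_def indicator_def\<close>)
      finally show ?thesis using True by simp
    qed (simp add: k_def)
  qed
  also have "\<dots> = (\<integral>z. case_prod k z \<partial>(lborel \<Otimes>\<^sub>M lborel))"
    by (rule lborel_pair.integral_snd[OF int])
  finally show "(LINT x:\<Omega>|lborel. integral {0..t} (\<lambda>s. h (s, x))) = (LINT z:{0..t} \<times> \<Omega>|lborel. h z)"
    using tot by simp
qed

lemma Fubini_space_time:
  fixes h :: "real \<times> 'a \<Rightarrow> real"
  assumes "continuous_on Q h" and "t \<in> {0..T}"
  shows "(LINT x:\<Omega>|lborel. integral {0..t} (\<lambda>s. h (s, x))) = integral {0..t} (\<lambda>s. LINT x:\<Omega>|lborel. h (s, x))"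
  using integral_space_time[OF assms] by simp

lemma time_integrable:
  fixes h :: "real \<times> 'a \<Rightarrow> 'b::euclidean_space"
  assumes "continuous_on Q h" "x \<in> closure \<Omega>" "t \<in> {0..T}"
  shows "(\<lambda>s. h (s, x)) integrable_on {0..t}"
  using assms by (intro integrable_continuous_real continuous_on_slice_time[OF assms(1)]) auto

lemma space_integral_integrable:
  fixes h :: "real \<times> 'a \<Rightarrow> real"
  assumes "continuous_on Q h" "t \<in> {0..T}"
  shows "(\<lambda>s. LINT x:\<Omega>|lborel. h (s, x)) integrable_on {0..t}"
  using assms(2)
  by (intro integrable_continuous_real continuous_on_subset[OF continuous_on_space_integral[OF assms(1)]]) auto

lemma has_time_derivative_integral:
  fixes h :: "real \<times> 'a \<Rightarrow> 'b::euclidean_space"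
  assumes h: "continuous_on Q h" and x: "x \<in> closure \<Omega>" and t: "t \<in> {0..r}" and r: "r \<le> T"
  shows "((\<lambda>t. integral {0..t} (\<lambda>s. h (s, x))) has_vector_derivative h (t, x)) (at t within {0..r})"
  using integral_has_vector_derivative[OF continuous_on_slice_time[OF h x r] t] .

text \<open>
  The energy identity behind the estimate: with \<open>m = \<integral>\<^sub>0\<^sup>t w\<close>, testing the time-integrated
  inequality with \<open>w = \<partial>\<^sub>t m\<close> produces \<open>\<integral>\<integral> \<nabla>m \<bullet> \<nabla>\<partial>\<^sub>t m = 1/2 \<integral> \<bar>\<nabla>m\<bar>\<^sup>2\<close>.
\<close>

lemma energy_inequality:
  fixes w u g :: "real \<times> 'a \<Rightarrow> real" and G :: "real \<times> 'a \<Rightarrow> 'a" and DG :: "real \<times> 'a \<Rightarrow> 'a \<Rightarrow> 'a"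
    and u0 :: "'a \<Rightarrow> real"
  assumes dom: "C2_bounded_domain \<Omega>" and n: "\<forall>y\<in>frontier \<Omega>. outward_unit_normal_at \<Omega> y (n y)"
    and w: "continuous_on Q w" "\<And>t x. t \<in> {0..T} \<Longrightarrow> x \<in> closure \<Omega> \<Longrightarrow> w (t, x) \<ge> 0"
    and u: "continuous_on Q u" "\<And>t x. t \<in> {0..T} \<Longrightarrow> x \<in> closure \<Omega> \<Longrightarrow> u (t, x) \<ge> 0"
    and g: "continuous_on Q g" "\<And>t x. t \<in> {0..T} \<Longrightarrow> x \<in> closure \<Omega> \<Longrightarrow> g (t, x) \<ge> 0"
    and u0: "continuous_on (closure \<Omega>) u0"
    and wG: "\<And>t x. t \<in> {0..T} \<Longrightarrow> x \<in> \<Omega> \<Longrightarrow> ((\<lambda>y. w (t, y)) has_derivative (\<lambda>h. G (t, x) \<bullet> h)) (at x)"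
    and G: "continuous_on Q G"
    and GD: "\<And>t x. t \<in> {0..T} \<Longrightarrow> x \<in> \<Omega> \<Longrightarrow> ((\<lambda>y. G (t, y)) has_derivative DG (t, x)) (at x)"
    and DG: "\<And>v. continuous_on Q (\<lambda>z. DG z v)"
    and flux: "\<And>t x. t \<in> {0..T} \<Longrightarrow> x \<in> frontier \<Omega> \<Longrightarrow> G (t, x) \<bullet> n x = 0"
    and ineq: "\<And>t x. t \<in> {0..T} \<Longrightarrow> x \<in> \<Omega> \<Longrightarrow>
       u (t, x) \<le> u0 x + integral {0..t} (\<lambda>s. \<Sum>i\<in>Basis. DG (s, x) i \<bullet> i) + integral {0..t} (\<lambda>s. u (s, x) * g (s, x))"
    and r: "r \<in> {0..T}"
  shows "integral {0..r} (\<lambda>t. LINT x:\<Omega>|lborel. u (t, x) * w (t, x))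
      + (LINT x:\<Omega>|lborel. (norm (integral {0..r} (\<lambda>s. G (s, x))))\<^sup>2) / 2
    \<le> integral {0..r} (\<lambda>t. LINT x:\<Omega>|lborel. u0 x * w (t, x))
      + (LINT x:\<Omega>|lborel. integral {0..r} (\<lambda>s. w (s, x)) * integral {0..r} (\<lambda>s. u (s, x) * g (s, x)))"
proof -
  define L where "L z = (\<Sum>i\<in>Basis. DG z i \<bullet> i)" for z
  have L: "continuous_on Q L" unfolding L_def[abs_def] by (intro continuous_intros DG)
  define GM where "GM z = integral {0..fst z} (\<lambda>s. G (s, snd z))" for z
  have GM: "continuous_on Q GM" unfolding GM_def[abs_def] by (rule continuous_on_time_integral[OF G])
  define LM where "LM z = integral {0..fst z} (\<lambda>s. L (s, snd z))" for z
  have LM: "continuous_on Q LM" unfolding LM_def[abs_def] by (rule continuous_on_time_integral[OF L])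
  define F where "F z = integral {0..fst z} (\<lambda>s. u (s, snd z) * g (s, snd z))" for z
  have ug: "continuous_on Q (\<lambda>z. u z * g z)" by (intro continuous_intros u g)
  have F: "continuous_on Q F"
    unfolding F_def[abs_def] using continuous_on_time_integral[OF ug] by simp
  have u0Q: "continuous_on Q (\<lambda>z. u0 (snd z))"
    by (rule continuous_on_compose2[OF u0]) (auto intro!: continuous_intros)
  have cl: "x \<in> \<Omega> \<Longrightarrow> x \<in> closure \<Omega>" for x using closure_subset by blast
  \<comment> \<open>Green's formula with two independent times: the field
    \<open>w (t, x) *\<^sub>R G (s, x)\<close> is tangential because \<open>G (s, x)\<close> is. The
    times are decoupled since \<open>LM\<close> at time \<open>t\<close> collects all earlier times
    \<open>s\<close>.\<close>
  have green: "(LINT x:\<Omega>|lborel. L (s, x) * w (t, x)) = - (LINT x:\<Omega>|lborel. G (s, x) \<bullet> G (t, x))"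
    if s: "s \<in> {0..T}" and t: "t \<in> {0..T}" for s t
  proof -
    have fld: "C1_field \<Omega> (\<lambda>x. w (t, x) *\<^sub>R G (s, x)) (\<lambda>x v. w (t, x) *\<^sub>R DG (s, x) v + (G (t, x) \<bullet> v) *\<^sub>R G (s, x))"
    proof (rule C1_field_scaleR)
      show "C1_field \<Omega> (\<lambda>x. G (s, x)) (\<lambda>x. DG (s, x))"
        unfolding C1_field_def using GD s continuous_on_slice_space[OF DG s] continuous_on_slice_space[OF G s] by auto
      show "continuous_on (closure \<Omega>) (\<lambda>x. G (t, x) \<bullet> v)" for v
        by (intro continuous_intros continuous_on_slice_space[OF G t])
    qed (use wG t continuous_on_slice_space[OF w(1) t] in auto)
    have "(LINT x:\<Omega>|lborel. \<Sum>i\<in>Basis. (w (t, x) *\<^sub>R DG (s, x) i + (G (t, x) \<bullet> i) *\<^sub>R G (s, x)) \<bullet> i) = 0"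
      by (rule integral_divergence_zero_flux[OF dom n fld]) (use flux[OF s] in auto)
    moreover have "(\<Sum>i\<in>Basis. (w (t, x) *\<^sub>R DG (s, x) i + (G (t, x) \<bullet> i) *\<^sub>R G (s, x)) \<bullet> i)
      = L (s, x) * w (t, x) + G (s, x) \<bullet> G (t, x)" for x
    proof -
      have "(\<Sum>i\<in>Basis. (w (t, x) *\<^sub>R DG (s, x) i + (G (t, x) \<bullet> i) *\<^sub>R G (s, x)) \<bullet> i)
        = w (t, x) * L (s, x) + (\<Sum>i\<in>Basis. (G (s, x) \<bullet> i) * (G (t, x) \<bullet> i))"
        by (simp add: inner_add_left sum.distrib L_def sum_distrib_left mult.commute)
      then show ?thesis by (simp add: euclidean_inner[of "G (s, x)" "G (t, x)"] mult.commute)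
    qed
    moreover have "(LINT x:\<Omega>|lborel. L (s, x) * w (t, x) + G (s, x) \<bullet> G (t, x)) =
       (LINT x:\<Omega>|lborel. L (s, x) * w (t, x)) + (LINT x:\<Omega>|lborel. G (s, x) \<bullet> G (t, x))"
      by (rule set_integral_add(2))
        (intro set_integrable_closure continuous_intros continuous_on_slice_space[OF L s]
          continuous_on_slice_space[OF w(1) t] continuous_on_slice_space[OF G s] continuous_on_slice_space[OF G t])+
    ultimately show ?thesis by simp
  qed
  have LMw: "(LINT x:\<Omega>|lborel. LM (t, x) * w (t, x)) = - (LINT x:\<Omega>|lborel. GM (t, x) \<bullet> G (t, x))"
    if t: "t \<in> {0..T}" for t
  proof -
    have wt: "continuous_on Q (\<lambda>z. w (t, snd z))" "continuous_on Q (\<lambda>z. G (t, snd z))"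
      by (rule continuous_on_compose2[OF continuous_on_slice_space[OF w(1) t]]; auto intro!: continuous_intros)
        (rule continuous_on_compose2[OF continuous_on_slice_space[OF G t]]; auto intro!: continuous_intros)
    have 1: "continuous_on Q (\<lambda>z. L z * w (t, snd z))" "continuous_on Q (\<lambda>z. G z \<bullet> G (t, snd z))"
      by (intro continuous_intros L G wt)+
    have "(LINT x:\<Omega>|lborel. LM (t, x) * w (t, x)) = (LINT x:\<Omega>|lborel. integral {0..t} (\<lambda>s. L (s, x) * w (t, x)))"
      by (simp add: LM_def)
    also have "\<dots> = integral {0..t} (\<lambda>s. LINT x:\<Omega>|lborel. L (s, x) * w (t, x))"
      using Fubini_space_time[OF 1(1) t] by simp
    also have "\<dots> = integral {0..t} (\<lambda>s. - (LINT x:\<Omega>|lborel. G (s, x) \<bullet> G (t, x)))"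
      by (rule integral_cong) (use green t in auto)
    also have "\<dots> = - (LINT x:\<Omega>|lborel. integral {0..t} (\<lambda>s. G (s, x) \<bullet> G (t, x)))"
      using Fubini_space_time[OF 1(2) t] by simp
    also have "(LINT x:\<Omega>|lborel. integral {0..t} (\<lambda>s. G (s, x) \<bullet> G (t, x))) = (LINT x:\<Omega>|lborel. GM (t, x) \<bullet> G (t, x))"
    proof (rule set_lebesgue_integral_cong)
      show "\<forall>x. x \<in> \<Omega> \<longrightarrow> integral {0..t} (\<lambda>s. G (s, x) \<bullet> G (t, x)) = GM (t, x) \<bullet> G (t, x)"
        using integral_linear[OF time_integrable[OF G cl t] bounded_linear_inner_left]
        by (auto simp: GM_def o_def)
    qed (use op in simp)
    finally show ?thesis .
  qed
  have c1: "continuous_on Q (\<lambda>z. u z * w z)" "continuous_on Q (\<lambda>z. u0 (snd z) * w z)"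
    "continuous_on Q (\<lambda>z. LM z * w z)" "continuous_on Q (\<lambda>z. F z * w z)" "continuous_on Q (\<lambda>z. GM z \<bullet> G z)"
    by (intro continuous_intros u w u0Q LM F GM G)+
  note si = set_integrable_closure[OF continuous_on_slice_space]
  \<comment> \<open>Here the pointwise inequality is multiplied by \<open>w\<close>, whose
    nonnegativity preserves its direction, and integrated over \<open>\<Omega>\<close>.\<close>
  have step: "(LINT x:\<Omega>|lborel. u (t, x) * w (t, x)) \<le> (LINT x:\<Omega>|lborel. u0 x * w (t, x))
      - (LINT x:\<Omega>|lborel. GM (t, x) \<bullet> G (t, x)) + (LINT x:\<Omega>|lborel. F (t, x) * w (t, x))" if t: "t \<in> {0..T}" for t
  proof -
    note si1 = si[OF c1(1) t] si[OF c1(2) t] si[OF c1(3) t] si[OF c1(4) t]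
    have "(LINT x:\<Omega>|lborel. u (t, x) * w (t, x)) \<le>
      (LINT x:\<Omega>|lborel. u0 x * w (t, x) + LM (t, x) * w (t, x) + F (t, x) * w (t, x))"
    proof (rule set_integral_mono)
      show "set_integrable lborel \<Omega> (\<lambda>x. u0 x * w (t, x) + LM (t, x) * w (t, x) + F (t, x) * w (t, x))"
        using si1 by (intro set_integral_add) auto
      fix x assume x: "x \<in> \<Omega>"
      have "u (t, x) \<le> u0 x + LM (t, x) + F (t, x)"
        using ineq[OF t x] by (simp add: LM_def F_def L_def)
      from mult_right_mono[OF this w(2)[OF t cl[OF x]]]
      show "u (t, x) * w (t, x) \<le> u0 x * w (t, x) + LM (t, x) * w (t, x) + F (t, x) * w (t, x)"
        by (simp add: algebra_simps)
    qed (use si1 in auto)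
    also have "\<dots> = (LINT x:\<Omega>|lborel. u0 x * w (t, x)) + (LINT x:\<Omega>|lborel. LM (t, x) * w (t, x)) + (LINT x:\<Omega>|lborel. F (t, x) * w (t, x))"
      using si1 by simp
    finally show ?thesis using LMw[OF t] by simp
  qed
  note ci = space_integral_integrable[OF _ r]
  have "integral {0..r} (\<lambda>t. LINT x:\<Omega>|lborel. u (t, x) * w (t, x)) \<le>
     integral {0..r} (\<lambda>t. (LINT x:\<Omega>|lborel. u0 x * w (t, x)) - (LINT x:\<Omega>|lborel. GM (t, x) \<bullet> G (t, x))
        + (LINT x:\<Omega>|lborel. F (t, x) * w (t, x)))"
    using ci[OF c1(1)] ci[OF c1(2)] ci[OF c1(4)] ci[OF c1(5)] step r
    by (intro integral_le integrable_add integrable_diff) auto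
  also have "\<dots> = integral {0..r} (\<lambda>t. LINT x:\<Omega>|lborel. u0 x * w (t, x))
       - integral {0..r} (\<lambda>t. LINT x:\<Omega>|lborel. GM (t, x) \<bullet> G (t, x))
       + integral {0..r} (\<lambda>t. LINT x:\<Omega>|lborel. F (t, x) * w (t, x))"
    using ci[OF c1(2)] ci[OF c1(4)] ci[OF c1(5)]
    by (simp add: integral_add integral_diff integrable_diff)
  also have "integral {0..r} (\<lambda>t. LINT x:\<Omega>|lborel. GM (t, x) \<bullet> G (t, x))
     = (LINT x:\<Omega>|lborel. (norm (integral {0..r} (\<lambda>s. G (s, x))))\<^sup>2) / 2"
  proof -
    \<comment> \<open>\<open>GM\<close> has time derivative \<open>G\<close> and vanishes at time 0,
      so the integrand is the derivative of half its squared norm. This is done for each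
      \<open>x\<close> before integrating in space.\<close>
    have "integral {0..r} (\<lambda>t. GM (t, x) \<bullet> G (t, x)) = (norm (GM (r, x)))\<^sup>2 / 2" if x: "x \<in> \<Omega>" for x
    proof -
      have "((\<lambda>t. GM (t, x) \<bullet> G (t, x)) has_integral (GM (r, x) \<bullet> GM (r, x) / 2 - GM (0, x) \<bullet> GM (0, x) / 2)) {0..r}"
      proof (rule fundamental_theorem_of_calculus)
        fix t assume t: "t \<in> {0..r}"
        have "((\<lambda>t. GM (t, x)) has_vector_derivative G (t, x)) (at t within {0..r})"
          using has_time_derivative_integral[OF G cl[OF x] t] r by (simp add: GM_def)
        then show "((\<lambda>t. GM (t, x) \<bullet> GM (t, x) / 2) has_vector_derivative GM (t, x) \<bullet> G (t, x)) (at t within {0..r})"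
          unfolding has_vector_derivative_def
          by (auto intro!: derivative_eq_intros simp: inner_commute algebra_simps)
      qed (use r in auto)
      then show ?thesis by (simp add: integral_unique power2_norm_eq_inner GM_def)
    qed
    then have "(LINT x:\<Omega>|lborel. integral {0..r} (\<lambda>t. GM (t, x) \<bullet> G (t, x))) = (LINT x:\<Omega>|lborel. (norm (GM (r, x)))\<^sup>2 / 2)"
      using op by (intro set_lebesgue_integral_cong) auto
    then show ?thesis using Fubini_space_time[OF c1(5) r] by (simp add: GM_def)
  qed
  also have "integral {0..r} (\<lambda>t. LINT x:\<Omega>|lborel. F (t, x) * w (t, x)) \<le>
     (LINT x:\<Omega>|lborel. integral {0..r} (\<lambda>s. w (s, x)) * integral {0..r} (\<lambda>s. u (s, x) * g (s, x)))"
  proof -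
    \<comment> \<open>\<open>F\<close> integrates the nonnegative product \<open>u * g\<close>, so
      its value at the final time dominates and, as \<open>w\<close> is nonnegative, may be taken
      out of the time integral.\<close>
    have "integral {0..r} (\<lambda>t. F (t, x) * w (t, x)) \<le> integral {0..r} (\<lambda>s. w (s, x)) * F (r, x)" if x: "x \<in> \<Omega>" for x
    proof -
      have mono: "F (t, x) \<le> F (r, x)" if t: "t \<in> {0..r}" for t
      proof -
        have "integral {0..t} (\<lambda>s. u (s, x) * g (s, x)) \<le> integral {0..r} (\<lambda>s. u (s, x) * g (s, x))"
          using time_integrable[OF ug cl[OF x], of t] time_integrable[OF ug cl[OF x] r] t r u(2)[OF _ cl[OF x]] g(2)[OF _ cl[OF x]]
          by (intro integral_subset_le) auto
        then show ?thesis by (simp add: F_def)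
      qed
      have "integral {0..r} (\<lambda>t. F (t, x) * w (t, x)) \<le> integral {0..r} (\<lambda>t. F (r, x) * w (t, x))"
      proof (rule integral_le)
        show "(\<lambda>t. F (t, x) * w (t, x)) integrable_on {0..r}" using time_integrable[OF c1(4) cl[OF x] r] .
        show "(\<lambda>t. F (r, x) * w (t, x)) integrable_on {0..r}"
          using time_integrable[OF w(1) cl[OF x] r] by (rule integrable_on_mult_right)
        show "F (t, x) * w (t, x) \<le> F (r, x) * w (t, x)" if "t \<in> {0..r}" for t
          using mono[OF that] w(2)[OF _ cl[OF x], of t] that r by (intro mult_right_mono) auto
      qed
      then show ?thesis by (simp add: mult.commute)
    qed
    then have "(LINT x:\<Omega>|lborel. integral {0..r} (\<lambda>t. F (t, x) * w (t, x))) \<le> (LINT x:\<Omega>|lborel. integral {0..r} (\<lambda>s. w (s, x)) * F (r, x))"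
      by (intro set_integral_mono set_integrable_closure continuous_on_time_integral_space[OF c1(4) r] continuous_intros
          continuous_on_time_integral_space[OF w(1) r] continuous_on_slice_space[OF F r])
    then show ?thesis using Fubini_space_time[OF c1(4) r] by (simp add: F_def)
  qed
  finally show ?thesis by simp
qed

end

section \<open>Closing the estimate\<close>

text \<open>A form of Young's inequality with the conjugate exponents p/2 and p/(p-2), proved by
  comparing \<open>a\<^sup>2\<close> with \<open>g powr (p - 2)\<close>. The summand 1 covers
  \<open>a \<le> 1\<close> and so allows the real exponent 2p/(p-2) to be raised to an even integer,
  for which the Sobolev bound is available.\<close>

lemma product_square_powr_bound:
  fixes a g p :: real
  assumes "a \<ge> 0" "g \<ge> 0" "p > 2" and k: "2 * real k \<ge> 2 * p / (p - 2)"
  shows "a\<^sup>2 * g\<^sup>2 \<le> 1 + a ^ (2 * k) + g powr p"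
proof (cases "a = 0 \<or> g = 0")
  case True
  then show ?thesis using assms(1) by auto
next
  case False
  then have a: "a > 0" and g: "g > 0" using assms by auto
  show ?thesis
  proof (cases "a\<^sup>2 \<le> g powr (p - 2)")
    case True
    have "a\<^sup>2 * g\<^sup>2 \<le> g powr (p - 2) * g powr 2"
      using True g by (simp add: powr_numeral)
    also have "\<dots> = g powr p" by (simp add: powr_add[symmetric])
    finally show ?thesis using a by (simp add: add_nonneg_nonneg add_increasing)
  next
    case False
    have "g = (g powr (p - 2)) powr (1 / (p - 2))" using g assms by (simp add: powr_powr)
    also have "\<dots> \<le> (a\<^sup>2) powr (1 / (p - 2))" using False assms by (intro powr_mono2) auto
    also have "\<dots> = (a powr 2) powr (1 / (p - 2))" using a by (simp add: powr_numeral)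
    also have "\<dots> = a powr (2 / (p - 2))" by (simp add: powr_powr)
    finally have "g\<^sup>2 \<le> (a powr (2 / (p - 2)))\<^sup>2" using g by (intro power_mono) auto
    also have "\<dots> = (a powr (2 / (p - 2))) powr 2" by (simp add: powr_numeral)
    also have "\<dots> = a powr (4 / (p - 2))" by (simp add: powr_powr)
    finally have "a\<^sup>2 * g\<^sup>2 \<le> a powr 2 * a powr (4 / (p - 2))" using a by (simp add: powr_numeral)
    also have "\<dots> = a powr (2 * p / (p - 2))"
    proof -
      have "2 + 4 / (p - 2) = 2 * p / (p - 2)" using assms by (simp add: field_simps)
      then show ?thesis by (simp add: powr_add[symmetric])
    qed
    also have "\<dots> \<le> 1 + a ^ (2 * k)"
    proof (cases "a \<le> 1")
      case True
      then have "a powr (2 * p / (p - 2)) \<le> 1" using a assms by (intro powr_le1) auto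
      moreover have "a ^ (2 * k) \<ge> 0" using a by simp
      ultimately show ?thesis by linarith
    next
      case False
      then have "a powr (2 * p / (p - 2)) \<le> a powr (real (2 * k))" using k by (intro powr_mono) auto
      then show ?thesis using a by (simp add: powr_realpow del: of_nat_mult)
    qed
    finally show ?thesis by (simp add: add_increasing2)
  qed
qed

text \<open>The pointwise inequality is not homogeneous in \<open>v\<close>, so it is applied to
  \<open>v\<close> divided by its H^1 norm. The Sobolev term then reduces to the constant
  \<open>K\<close> and the summand 1 to the measure of \<open>\<Omega>\<close>, which together form
  \<open>C0\<close>; undoing the scaling leaves the squared H^1 norm as a factor.\<close>

lemma weighted_sobolev:
  fixes \<Omega> :: "'a::euclidean_space set"
  assumes dom: "C2_bounded_domain \<Omega>" and dim: "DIM('a) \<le> 2" and p: "p > 2"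
  shows "\<exists>C0\<ge>0. \<forall>v G g. C1_bounded \<Omega> v G \<longrightarrow> (\<forall>x\<in>\<Omega>. v x \<ge> 0) \<longrightarrow> continuous_on \<Omega> g \<longrightarrow> bounded (g ` \<Omega>) \<longrightarrow>
    (\<forall>x\<in>\<Omega>. g x \<ge> 0) \<longrightarrow>
    (LINT x:\<Omega>|lborel. (v x)\<^sup>2 * (g x)\<^sup>2) \<le>
      (LINT x:\<Omega>|lborel. (v x)\<^sup>2 + (norm (G x))\<^sup>2) * (C0 + (LINT x:\<Omega>|lborel. g x powr p))"
proof -
  have \<Omega>: "open \<Omega>" "bounded \<Omega>" using dom by (auto simp: C2_bounded_domain_def)
  obtain k :: nat where k: "real k \<ge> 2 * p / (p - 2)" using real_arch_simple by blast
  then have k2: "2 * real k \<ge> 2 * p / (p - 2)" by simp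
  obtain K where K: "K \<ge> 0" "\<And>v G. C1_bounded \<Omega> v G \<Longrightarrow> (\<forall>x\<in>\<Omega>. v x \<ge> 0) \<Longrightarrow>
    (LINT x:\<Omega>|lborel. v x ^ (2 * k)) \<le> K * (LINT x:\<Omega>|lborel. (v x)\<^sup>2 + (norm (G x))\<^sup>2) ^ k"
    using sobolev_even_power[OF dom dim, of k] by blast
  define C0 where "C0 = measure lborel \<Omega> + K"
  have C0: "C0 \<ge> 0" using K by (simp add: C0_def)
  have "(LINT x:\<Omega>|lborel. (v x)\<^sup>2 * (g x)\<^sup>2) \<le>
      (LINT x:\<Omega>|lborel. (v x)\<^sup>2 + (norm (G x))\<^sup>2) * (C0 + (LINT x:\<Omega>|lborel. g x powr p))"
    if v: "C1_bounded \<Omega> v G" and v0: "\<forall>x\<in>\<Omega>. v x \<ge> 0" and gc: "continuous_on \<Omega> g" and gb: "bounded (g ` \<Omega>)"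
      and g0: "\<forall>x\<in>\<Omega>. g x \<ge> 0" for v G g
  proof -
    define N where "N = (LINT x:\<Omega>|lborel. (v x)\<^sup>2 + (norm (G x))\<^sup>2)"
    define P where "P = C0 + (LINT x:\<Omega>|lborel. g x powr p)"
    have N0: "N \<ge> 0" unfolding N_def set_lebesgue_integral_def by (intro Bochner_Integration.integral_nonneg) auto
    have Ip: "(LINT x:\<Omega>|lborel. g x powr p) \<ge> 0"
      unfolding set_lebesgue_integral_def by (intro Bochner_Integration.integral_nonneg) auto
    have P0: "P \<ge> 0" using C0 Ip by (simp add: P_def)
    have vc: "continuous_on \<Omega> v" using C1_bounded_continuous[OF v] .
    obtain M where "\<And>x. x \<in> \<Omega> \<Longrightarrow> norm (v x) \<le> M" using v by (auto simp: C1_bounded_def bounded_iff)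
    then have M: "\<And>x. x \<in> \<Omega> \<Longrightarrow> v x \<le> M" by (simp add: abs_le_iff)
    obtain B where "\<And>x. x \<in> \<Omega> \<Longrightarrow> norm (g x) \<le> B" using gb by (auto simp: bounded_iff)
    then have B: "\<And>x. x \<in> \<Omega> \<Longrightarrow> g x \<le> B" by (simp add: abs_le_iff)
    have ip: "set_integrable lborel \<Omega> (\<lambda>x. g x powr p)"
    proof (rule set_integrable_on_domain[OF \<Omega>])
      show "continuous_on \<Omega> (\<lambda>x. g x powr p)"
        using g0 p by (intro continuous_on_powr' gc continuous_intros) auto
      show "\<bar>g x powr p\<bar> \<le> B powr p" if "x \<in> \<Omega>" for x
        using g0 B[OF that] that p by (auto intro!: powr_mono2)
    qed
    have ivg: "set_integrable lborel \<Omega> (\<lambda>x. (v x)\<^sup>2 * (g x)\<^sup>2)"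
    proof (rule set_integrable_on_domain[OF \<Omega>])
      show "continuous_on \<Omega> (\<lambda>x. (v x)\<^sup>2 * (g x)\<^sup>2)" by (intro continuous_intros vc gc)
      show "\<bar>(v x)\<^sup>2 * (g x)\<^sup>2\<bar> \<le> M\<^sup>2 * B\<^sup>2" if "x \<in> \<Omega>" for x
      proof -
        have "(v x)\<^sup>2 * (g x)\<^sup>2 \<le> M\<^sup>2 * B\<^sup>2"
          using v0 g0 M[OF that] B[OF that] that by (intro mult_mono power_mono) auto
        then show ?thesis by simp
      qed
    qed
    have ivk: "set_integrable lborel \<Omega> (\<lambda>x. v x ^ (2 * k))"
    proof (rule set_integrable_on_domain[OF \<Omega>])
      show "continuous_on \<Omega> (\<lambda>x. v x ^ (2 * k))" by (intro continuous_intros vc)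
      show "\<bar>v x ^ (2 * k)\<bar> \<le> M ^ (2 * k)" if "x \<in> \<Omega>" for x
        using v0 M[OF that] that by (auto simp: power_abs intro!: power_mono)
    qed
    have i1: "set_integrable lborel \<Omega> (\<lambda>x. 1 :: real)"
      using \<Omega> by (intro set_integrable_on_domain[of _ _ 1]) auto
    have one: "(LINT x:\<Omega>|lborel. 1) = measure lborel \<Omega>"
      using \<Omega> emeasure_bounded_finite[of \<Omega>] by (subst set_integral_const) auto
    \<comment> \<open>The squared norm \<open>N\<close> may be zero, so the scaling uses an
      arbitrary positive majorant \<open>H\<close>; its excess over \<open>N\<close> is sent to 0
      afterwards.\<close>
    have bound: "(LINT x:\<Omega>|lborel. (v x)\<^sup>2 * (g x)\<^sup>2) \<le> H * P" if H: "H > 0" "N \<le> H" for H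
    proof -
      define h where "h = sqrt H"
      have h: "h > 0" "h\<^sup>2 = H" using H by (auto simp: h_def)
      have hk: "h ^ (2 * k) = H ^ k" using h(2) by (simp add: power_mult)
      have "(LINT x:\<Omega>|lborel. (v x)\<^sup>2 * (g x)\<^sup>2) \<le> (LINT x:\<Omega>|lborel. H * (1 + (1 / H ^ k) * v x ^ (2 * k) + g x powr p))"
      proof (rule set_integral_mono[OF ivg])
        show "set_integrable lborel \<Omega> (\<lambda>x. H * (1 + (1 / H ^ k) * v x ^ (2 * k) + g x powr p))"
          using i1 ivk ip by (intro set_integrable_mult_right set_integral_add) auto
        fix x assume x: "x \<in> \<Omega>"
        have "(v x / h)\<^sup>2 * (g x)\<^sup>2 \<le> 1 + (v x / h) ^ (2 * k) + g x powr p"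
          using v0 g0 x h p k2 by (intro product_square_powr_bound) auto
        then have "(v x)\<^sup>2 / H * (g x)\<^sup>2 \<le> 1 + v x ^ (2 * k) / H ^ k + g x powr p"
          by (simp add: power_divide h hk)
        from mult_left_mono[OF this, of H] H(1)
        show "(v x)\<^sup>2 * (g x)\<^sup>2 \<le> H * (1 + (1 / H ^ k) * v x ^ (2 * k) + g x powr p)" by simp
      qed
      also have "\<dots> = H * (measure lborel \<Omega> + (1 / H ^ k) * (LINT x:\<Omega>|lborel. v x ^ (2 * k)) + (LINT x:\<Omega>|lborel. g x powr p))"
        using i1 ivk ip by (simp add: one set_integral_add set_integral_mult_right)
      also have "\<dots> \<le> H * P"
      proof (rule mult_left_mono)
        have "(LINT x:\<Omega>|lborel. v x ^ (2 * k)) \<le> K * N ^ k" unfolding N_def by (rule K(2)[OF v v0])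
        also have "\<dots> \<le> K * H ^ k" using H N0 K(1) by (intro mult_left_mono power_mono) auto
        finally have "(1 / H ^ k) * (LINT x:\<Omega>|lborel. v x ^ (2 * k)) \<le> K"
          using H(1) by (simp add: field_simps)
        then show "measure lborel \<Omega> + (1 / H ^ k) * (LINT x:\<Omega>|lborel. v x ^ (2 * k)) + (LINT x:\<Omega>|lborel. g x powr p) \<le> P"
          by (simp add: P_def C0_def)
      qed (use H in simp)
      finally show ?thesis .
    qed
    have "(LINT x:\<Omega>|lborel. (v x)\<^sup>2 * (g x)\<^sup>2) \<le> N * P"
    proof (rule field_le_epsilon)
      fix e :: real assume e: "e > 0"
      define d where "d = e / (P + 1)"
      have d: "d > 0" "d * P \<le> e" using e P0 by (auto simp: d_def field_simps)
      have "(LINT x:\<Omega>|lborel. (v x)\<^sup>2 * (g x)\<^sup>2) \<le> (N + d) * P"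
        by (rule bound) (use N0 d in auto)
      then show "(LINT x:\<Omega>|lborel. (v x)\<^sup>2 * (g x)\<^sup>2) \<le> N * P + e" using d by (simp add: algebra_simps)
    qed
    then show ?thesis by (simp add: N_def P_def)
  qed
  with C0 show ?thesis by blast
qed

text \<open>Young's inequality applied to \<open>(Z\<^sup>2)' = 2 Z y sqrt P\<close> reduces the claim to the linear Gronwall lemma.\<close>

lemma quadratic_gronwall:
  fixes y P :: "real \<Rightarrow> real"
  assumes T: "T > 0" and yc: "continuous_on {0..T} y" and Pc: "continuous_on {0..T} P"
    and P0: "\<And>t. t \<in> {0..T} \<Longrightarrow> P t \<ge> 0" and A: "A \<ge> 0" and C: "C > 0"
    and le: "\<And>r. r \<in> {0..T} \<Longrightarrow>
      integral {0..r} (\<lambda>t. (y t)\<^sup>2) \<le> A + C * (integral {0..r} (\<lambda>t. y t * sqrt (P t)))\<^sup>2"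
  shows "integral {0..T} (\<lambda>t. (y t)\<^sup>2) \<le> A * (1 + exp (4 * C * integral {0..T} P))"
proof -
  define Z where "Z r = integral {0..r} (\<lambda>t. y t * sqrt (P t))" for r
  have yPc: "continuous_on {0..T} (\<lambda>t. y t * sqrt (P t))" by (intro continuous_intros yc Pc)
  have Z: "(Z has_real_derivative y t * sqrt (P t)) (at t within {0..T})" if "t \<in> {0..T}" for t
    unfolding Z_def[abs_def] using integral_has_vector_derivative[OF yPc that]
    by (simp add: has_real_derivative_iff_has_vector_derivative)
  have Zc: "continuous_on {0..T} Z"
    by (rule DERIV_continuous_on[OF Z])
  have Z0: "Z 0 = 0" by (simp add: Z_def)
  define S where "S r = integral {0..r} (\<lambda>t. (Z t)\<^sup>2 * P t)" for r
  have ZPc: "continuous_on {0..T} (\<lambda>t. (Z t)\<^sup>2 * P t)" by (intro continuous_intros Zc Pc)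
  have sub: "continuous_on {0..r} f" if "continuous_on {0..T} f" "r \<in> {0..T}" for r and f :: "real \<Rightarrow> real"
    using that by (auto intro: continuous_on_subset)
  have main: "(Z r)\<^sup>2 \<le> A / C + 4 * C * S r" if r: "r \<in> {0..T}" for r
  proof -
    have FTC: "((\<lambda>t. 2 * Z t * (y t * sqrt (P t))) has_integral ((Z r)\<^sup>2 - (Z 0)\<^sup>2)) {0..r}"
    proof (rule fundamental_theorem_of_calculus)
      fix t assume t: "t \<in> {0..r}"
      have "(Z has_real_derivative y t * sqrt (P t)) (at t within {0..r})"
        by (rule DERIV_subset[OF Z]) (use t r in auto)
      then have "((\<lambda>t. (Z t)\<^sup>2) has_real_derivative 2 * Z t * (y t * sqrt (P t))) (at t within {0..r})"
        by (auto intro!: derivative_eq_intros)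
      then show "((\<lambda>t. (Z t)\<^sup>2) has_vector_derivative 2 * Z t * (y t * sqrt (P t))) (at t within {0..r})"
        by (simp add: has_real_derivative_iff_has_vector_derivative)
    qed (use r in auto)
    have i1: "(\<lambda>t. (y t)\<^sup>2 / (2 * C)) integrable_on {0..r}" "(\<lambda>t. 2 * C * ((Z t)\<^sup>2 * P t)) integrable_on {0..r}"
      using r C by (auto intro!: integrable_continuous_real continuous_intros sub[OF yc] sub[OF ZPc] sub[OF Zc] sub[OF Pc])
    have "(Z r)\<^sup>2 = integral {0..r} (\<lambda>t. 2 * Z t * (y t * sqrt (P t)))"
      using integral_unique[OF FTC] Z0 by simp
    \<comment> \<open>With this weight in Young's inequality the hypothesis bounds the first part by
      \<open>A / (2 * C) + (Z r)\<^sup>2 / 2\<close>. The last term is absorbed on the left, and the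
      doubling of the rest produces the factor \<open>4 * C\<close>.\<close>
    also have "\<dots> \<le> integral {0..r} (\<lambda>t. (y t)\<^sup>2 / (2 * C) + 2 * C * ((Z t)\<^sup>2 * P t))"
    proof (rule integral_le)
      show "(\<lambda>t. 2 * Z t * (y t * sqrt (P t))) integrable_on {0..r}" using FTC by blast
      show "(\<lambda>t. (y t)\<^sup>2 / (2 * C) + 2 * C * ((Z t)\<^sup>2 * P t)) integrable_on {0..r}"
        by (intro integrable_add i1)
      fix t assume t: "t \<in> {0..r}"
      define q where "q = sqrt (P t)"
      have q: "q\<^sup>2 = P t" using P0[of t] t r by (simp add: q_def)
      have "0 \<le> (y t - 2 * C * Z t * q)\<^sup>2 / (2 * C)" using C by simp
      also have "\<dots> = (y t)\<^sup>2 / (2 * C) + 2 * C * ((Z t)\<^sup>2 * q\<^sup>2) - 2 * Z t * (y t * q)"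
        using C by (simp add: power2_eq_square field_simps)
      finally show "2 * Z t * (y t * sqrt (P t)) \<le> (y t)\<^sup>2 / (2 * C) + 2 * C * ((Z t)\<^sup>2 * P t)"
        using q by (simp add: q_def)
    qed
    also have "\<dots> = integral {0..r} (\<lambda>t. (y t)\<^sup>2) / (2 * C) + 2 * C * S r"
      using i1 by (simp add: integral_add S_def)
    also have "\<dots> \<le> (A + C * (Z r)\<^sup>2) / (2 * C) + 2 * C * S r"
      using le[OF r] C by (simp add: Z_def divide_right_mono)
    finally show ?thesis using C by (simp add: field_simps)
  qed
  define I where "I r = integral {0..r} P" for r
  define R where "R r = A / C + 4 * C * S r" for r
  have dS: "(S has_real_derivative (Z t)\<^sup>2 * P t) (at t within {0..T})" if "t \<in> {0..T}" for t
    unfolding S_def[abs_def] using integral_has_vector_derivative[OF ZPc that]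
    by (simp add: has_real_derivative_iff_has_vector_derivative)
  have dI: "(I has_real_derivative P t) (at t within {0..T})" if "t \<in> {0..T}" for t
    unfolding I_def[abs_def] using integral_has_vector_derivative[OF Pc that]
    by (simp add: has_real_derivative_iff_has_vector_derivative)
  \<comment> \<open>Integrating factor: the inequality \<open>(Z t)\<^sup>2 \<le> R t\<close> just
    proved says exactly that the derivative of \<open>E\<close> is nonpositive.\<close>
  define E where "E t = R t * exp (- 4 * C * I t)" for t
  define E' where "E' t = 4 * C * P t * exp (- 4 * C * I t) * ((Z t)\<^sup>2 - R t)" for t
  have dE: "(E has_real_derivative E' t) (at t within {0..T})" if "t \<in> {0..T}" for t
    unfolding E_def[abs_def] R_def[abs_def] E'_def
    by (rule derivative_eq_intros dS dI that refl)+ (simp add: algebra_simps R_def)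
  have "(E' has_integral (E T - E 0)) {0..T}"
    using T dE by (intro fundamental_theorem_of_calculus) (auto simp: has_real_derivative_iff_has_vector_derivative)
  then have "E T - E 0 \<le> 0"
  proof (rule has_integral_le[OF _ has_integral_0])
    fix t assume t: "t \<in> {0..T}"
    have "4 * C * P t * exp (- 4 * C * I t) \<ge> 0" using C P0[OF t] by simp
    moreover have "(Z t)\<^sup>2 - R t \<le> 0" using main[OF t] by (simp add: R_def)
    ultimately show "E' t \<le> 0" unfolding E'_def by (rule mult_nonneg_nonpos)
  qed
  moreover have "E 0 = A / C" by (simp add: E_def R_def S_def I_def)
  ultimately have "R T * exp (- 4 * C * I T) \<le> A / C" by (simp add: E_def)
  then have "R T \<le> A / C * exp (4 * C * I T)" by (simp add: exp_minus field_simps)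
  then have "(Z T)\<^sup>2 \<le> A / C * exp (4 * C * I T)"
    using main[of T] T by (simp add: R_def)
  then have "C * (Z T)\<^sup>2 \<le> A * exp (4 * C * I T)" using C by (simp add: field_simps)
  moreover have "integral {0..T} (\<lambda>t. (y t)\<^sup>2) \<le> A + C * (Z T)\<^sup>2" using le[of T] T by (simp add: Z_def)
  ultimately show ?thesis by (simp add: I_def algebra_simps)
qed

context cylinder
begin

text \<open>Differentiation under the time integral is carried out on a ball around \<open>x\<close>
  inside \<open>\<Omega>\<close>, because the Leibniz rule works on a convex parameter set. The
  gradient is carried as a bounded linear functional and turned back into a vector by commuting this
  identification with the integral.\<close>

lemma C1_bounded_time_integral:
  fixes w :: "real \<times> 'a \<Rightarrow> real" and G :: "real \<times> 'a \<Rightarrow> 'a"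
  assumes w: "continuous_on Q w" and G: "continuous_on Q G"
    and wG: "\<And>t x. t \<in> {0..T} \<Longrightarrow> x \<in> \<Omega> \<Longrightarrow> ((\<lambda>y. w (t, y)) has_derivative (\<lambda>h. G (t, x) \<bullet> h)) (at x)"
    and r: "r \<in> {0..T}"
  shows "C1_bounded \<Omega> (\<lambda>x. integral {0..r} (\<lambda>s. w (s, x))) (\<lambda>x. integral {0..r} (\<lambda>s. G (s, x)))"
  unfolding C1_bounded_def
proof (intro conjI ballI)
  have cl: "x \<in> \<Omega> \<Longrightarrow> x \<in> closure \<Omega>" for x using closure_subset by blast
  have c: "continuous_on (closure \<Omega>) (\<lambda>x. integral {0..r} (\<lambda>s. w (s, x)))"
    "continuous_on (closure \<Omega>) (\<lambda>x. integral {0..r} (\<lambda>s. G (s, x)))"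
    by (intro continuous_on_time_integral_space w G r)+
  show "continuous_on \<Omega> (\<lambda>x. integral {0..r} (\<lambda>s. G (s, x)))"
    using c(2) closure_subset continuous_on_subset by blast
  have "compact (closure \<Omega>)" using bd by (simp add: compact_closure)
  then show "bounded ((\<lambda>x. integral {0..r} (\<lambda>s. w (s, x))) ` \<Omega>)" "bounded ((\<lambda>x. integral {0..r} (\<lambda>s. G (s, x))) ` \<Omega>)"
    using c by (meson bounded_subset closure_subset compact_continuous_image compact_imp_bounded image_mono)+
  fix x assume x: "x \<in> \<Omega>"
  obtain e where e: "e > 0" "ball x e \<subseteq> \<Omega>" using op x openE by blast
  have rT: "t \<in> cbox 0 r \<Longrightarrow> t \<in> {0..T}" for t using r by auto
  have "((\<lambda>y. integral (cbox 0 r) (\<lambda>s. w (s, y))) has_derivative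
      blinfun_apply (integral (cbox 0 r) (\<lambda>s. blinfun_inner_right (G (s, x))))) (at x within ball x e)"
  proof (rule leibniz_rule[where fx = "\<lambda>y s. blinfun_inner_right (G (s, y))"])
    fix y t assume y: "y \<in> ball x e" and t: "t \<in> cbox 0 r"
    then show "((\<lambda>y. w (t, y)) has_derivative blinfun_apply (blinfun_inner_right (G (t, y)))) (at y within ball x e)"
      using wG[OF rT[OF t] subsetD[OF e(2) y]] by (simp add: has_derivative_at_withinI)
  next
    fix y assume "y \<in> ball x e"
    then show "(\<lambda>s. w (s, y)) integrable_on cbox 0 r"
      using time_integrable[OF w cl[of y] r] e by auto
  next
    have "continuous_on (ball x e \<times> cbox 0 r) (\<lambda>z. G (snd z, fst z))"
      by (rule continuous_on_compose2[OF G]) (use r e cl in \<open>auto intro!: continuous_intros\<close>)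
    then show "continuous_on (ball x e \<times> cbox 0 r) (\<lambda>(y, s). blinfun_inner_right (G (s, y)))"
      unfolding split_beta by (rule bounded_linear.continuous_on[OF bounded_linear_blinfun_inner_right])
  qed (use e in auto)
  then have "((\<lambda>y. integral {0..r} (\<lambda>s. w (s, y))) has_derivative
      blinfun_apply (integral {0..r} (\<lambda>s. blinfun_inner_right (G (s, x))))) (at x)"
    using e by (simp add: at_within_open[of x "ball x e"])
  moreover have "integral {0..r} (\<lambda>s. blinfun_inner_right (G (s, x))) = blinfun_inner_right (integral {0..r} (\<lambda>s. G (s, x)))"
    using integral_linear[OF time_integrable[OF G cl[OF x] r] bounded_linear_blinfun_inner_right] by (simp add: o_def)
  ultimately show "((\<lambda>x. integral {0..r} (\<lambda>s. w (s, x))) has_derivative (\<bullet>) (integral {0..r} (\<lambda>s. G (s, x)))) (at x)"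
    by simp
qed

end

context cylinder
begin

text \<open>For a fixed final time the function \<open>v\<close> does not depend on
  \<open>s\<close>. After Fubini each time slice is treated by Cauchy-Schwarz, pairing
  \<open>u\<close> with \<open>v * g\<close>; the weighted bound makes \<open>N\<close> a common
  factor of all slices, which then leaves the time integral.\<close>

lemma source_term_bound:
  fixes u g :: "real \<times> 'a \<Rightarrow> real" and v :: "'a \<Rightarrow> real"
  assumes u: "continuous_on Q u" and g: "continuous_on Q g"
    and g0: "\<And>t x. t \<in> {0..T} \<Longrightarrow> x \<in> closure \<Omega> \<Longrightarrow> g (t, x) \<ge> 0" and p: "p > 0"
    and v: "continuous_on (closure \<Omega>) v" and N: "N \<ge> 0" and C0: "C0 \<ge> 0"
    and weighted: "\<And>t. t \<in> {0..T} \<Longrightarrow> (LINT x:\<Omega>|lborel. (v x)\<^sup>2 * (g (t, x))\<^sup>2) \<le> N * (C0 + (LINT x:\<Omega>|lborel. g (t, x) powr p))"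
    and r: "r \<in> {0..T}"
  shows "(LINT x:\<Omega>|lborel. v x * integral {0..r} (\<lambda>s. u (s, x) * g (s, x))) \<le>
    sqrt N * integral {0..r} (\<lambda>s. sqrt (LINT x:\<Omega>|lborel. (u (s, x))\<^sup>2) * sqrt (C0 + (LINT x:\<Omega>|lborel. g (s, x) powr p)))"
proof -
  have vQ: "continuous_on Q (\<lambda>z. v (snd z))"
    by (rule continuous_on_compose2[OF v]) (auto intro!: continuous_intros)
  have c1: "continuous_on Q (\<lambda>z. u z * (v (snd z) * g z))" "continuous_on Q (\<lambda>z. (u z)\<^sup>2)"
    "continuous_on Q (\<lambda>z. (v (snd z) * g z)\<^sup>2)" "continuous_on Q (\<lambda>z. u z * g z)"
    by (intro continuous_intros u g vQ)+
  have c2: "continuous_on Q (\<lambda>z. g z powr p)"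
    using g0 p by (intro continuous_on_powr' g continuous_intros) auto
  define y where "y s = sqrt (LINT x:\<Omega>|lborel. (u (s, x))\<^sup>2)" for s
  define P where "P s = C0 + (LINT x:\<Omega>|lborel. g (s, x) powr p)" for s
  have yc: "continuous_on {0..T} y" and Pc: "continuous_on {0..T} P"
    unfolding y_def[abs_def] P_def[abs_def]
    by (intro continuous_intros continuous_on_space_integral c1 c2)+
  have slice: "(LINT x:\<Omega>|lborel. u (s, x) * (v x * g (s, x))) \<le> sqrt N * (y s * sqrt (P s))" if s: "s \<in> {0..T}" for s
  proof -
    note si = set_integrable_closure[OF continuous_on_slice_space[OF _ s]]
    have "(LINT x:\<Omega>|lborel. u (s, x) * (v x * g (s, x)))\<^sup>2 \<le> (LINT x:\<Omega>|lborel. (u (s, x))\<^sup>2) * (LINT x:\<Omega>|lborel. (v x * g (s, x))\<^sup>2)"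
      using si[OF c1(1)] si[OF c1(2)] si[OF c1(3)] by (intro Cauchy_Schwarz_set_integral) simp_all
    also have "\<dots> \<le> (LINT x:\<Omega>|lborel. (u (s, x))\<^sup>2) * (N * P s)"
      using weighted[OF s] by (intro mult_left_mono)
        (auto simp: P_def power_mult_distrib set_lebesgue_integral_def intro!: Bochner_Integration.integral_nonneg)
    finally have "(LINT x:\<Omega>|lborel. u (s, x) * (v x * g (s, x))) \<le> sqrt ((LINT x:\<Omega>|lborel. (u (s, x))\<^sup>2) * (N * P s))"
      by (rule real_le_rsqrt)
    then show ?thesis by (simp add: real_sqrt_mult y_def mult_ac)
  qed
  have "(LINT x:\<Omega>|lborel. v x * integral {0..r} (\<lambda>s. u (s, x) * g (s, x))) =
    (LINT x:\<Omega>|lborel. integral {0..r} (\<lambda>s. u (s, x) * (v x * g (s, x))))"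
    by (simp add: mult.left_commute)
  also have "\<dots> = integral {0..r} (\<lambda>s. LINT x:\<Omega>|lborel. u (s, x) * (v x * g (s, x)))"
    using Fubini_space_time[OF c1(1) r] by simp
  also have "\<dots> \<le> integral {0..r} (\<lambda>s. sqrt N * (y s * sqrt (P s)))"
  proof (rule integral_le)
    show "(\<lambda>s. LINT x:\<Omega>|lborel. u (s, x) * (v x * g (s, x))) integrable_on {0..r}"
      using space_integral_integrable[OF c1(1) r] by simp
    have "continuous_on {0..T} (\<lambda>s. sqrt N * (y s * sqrt (P s)))" by (intro continuous_intros yc Pc)
    then show "(\<lambda>s. sqrt N * (y s * sqrt (P s))) integrable_on {0..r}"
      using r by (intro integrable_continuous_real) (auto intro: continuous_on_subset)
  qed (use slice r in auto)
  finally show ?thesis by (simp add: y_def P_def)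
qed

text \<open>Cauchy-Schwarz in time against the constant 1 costs the length of the interval, at most
  \<open>T\<close>. This supplies the L^2 part of the H^1 norm of the time integral, whereas the
  energy inequality supplies only its gradient.\<close>

lemma time_integral_square_le:
  fixes w u :: "real \<times> 'a \<Rightarrow> real"
  assumes w: "continuous_on Q w" and u: "continuous_on Q u"
    and wu: "\<And>t x. t \<in> {0..T} \<Longrightarrow> x \<in> closure \<Omega> \<Longrightarrow> \<bar>w (t, x)\<bar> \<le> b * u (t, x)"
    and r: "r \<in> {0..T}"
  shows "(LINT x:\<Omega>|lborel. (integral {0..r} (\<lambda>s. w (s, x)))\<^sup>2) \<le> b\<^sup>2 * T * integral {0..r} (\<lambda>s. LINT x:\<Omega>|lborel. (u (s, x))\<^sup>2)"
proof -
  have cl: "x \<in> \<Omega> \<Longrightarrow> x \<in> closure \<Omega>" for x using closure_subset by blast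
  have u2: "continuous_on Q (\<lambda>z. (u z)\<^sup>2)" by (intro continuous_intros u)
  have pt: "(integral {0..r} (\<lambda>s. w (s, x)))\<^sup>2 \<le> b\<^sup>2 * T * integral {0..r} (\<lambda>s. (u (s, x))\<^sup>2)" if x: "x \<in> \<Omega>" for x
  proof -
    have wc: "continuous_on {0..r} (\<lambda>s. w (s, x))" "continuous_on {0..r} (\<lambda>s. u (s, x))"
      using continuous_on_slice_time[OF w cl[OF x]] continuous_on_slice_time[OF u cl[OF x]] r by auto
    have i: "set_integrable lborel {0..r} (\<lambda>s. 1 * w (s, x))" "set_integrable lborel {0..r} (\<lambda>s. 1\<^sup>2 :: real)"
      "set_integrable lborel {0..r} (\<lambda>s. (w (s, x))\<^sup>2)"
      by (intro borel_integrable_atLeastAtMost' continuous_intros wc)+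
    have "(LINT s:{0..r}|lborel. 1 * w (s, x))\<^sup>2 \<le> (LINT s:{0..r}|lborel. 1\<^sup>2) * (LINT s:{0..r}|lborel. (w (s, x))\<^sup>2)"
      by (rule Cauchy_Schwarz_set_integral[OF i])
    then have "(integral {0..r} (\<lambda>s. w (s, x)))\<^sup>2 \<le> r * integral {0..r} (\<lambda>s. (w (s, x))\<^sup>2)"
      using r set_borel_integral_eq_integral(2)[OF i(1)] set_borel_integral_eq_integral(2)[OF i(2)]
        set_borel_integral_eq_integral(2)[OF i(3)] by simp
    also have "\<dots> \<le> T * integral {0..r} (\<lambda>s. b\<^sup>2 * (u (s, x))\<^sup>2)"
    proof (rule mult_mono)
      show "integral {0..r} (\<lambda>s. (w (s, x))\<^sup>2) \<le> integral {0..r} (\<lambda>s. b\<^sup>2 * (u (s, x))\<^sup>2)"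
      proof (rule integral_le)
        fix s assume s: "s \<in> {0..r}"
        have "\<bar>w (s, x)\<bar>\<^sup>2 \<le> (b * u (s, x))\<^sup>2"
          using wu[OF _ cl[OF x], of s] s r by (intro power_mono) auto
        then show "(w (s, x))\<^sup>2 \<le> b\<^sup>2 * (u (s, x))\<^sup>2" by (simp add: power_mult_distrib)
      qed (intro integrable_continuous_real continuous_intros wc)+
      show "0 \<le> integral {0..r} (\<lambda>s. (w (s, x))\<^sup>2)"
        by (intro integral_nonneg integrable_continuous_real continuous_intros wc) auto
    qed (use r T in auto)
    finally show ?thesis by (simp add: mult_ac)
  qed
  have "(LINT x:\<Omega>|lborel. (integral {0..r} (\<lambda>s. w (s, x)))\<^sup>2) \<le> (LINT x:\<Omega>|lborel. b\<^sup>2 * T * integral {0..r} (\<lambda>s. (u (s, x))\<^sup>2))"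
    by (intro set_integral_mono set_integrable_closure continuous_intros continuous_on_time_integral_space[OF w r]
        continuous_on_time_integral_space[OF u2 r] pt)
  then show ?thesis using Fubini_space_time[OF u2 r] by simp
qed

text \<open>\<open>\<epsilon>\<close> is the weight in Young's inequality for
  \<open>sqrt N * Z\<close>. The bound 1/2 lets the energy absorb the gradient part of
  \<open>\<epsilon> * N\<close>; the bound \<open>a / 4\<close> lets \<open>a * Y\<close> absorb its
  L^2 part. The initial datum uses up another quarter of \<open>a * Y\<close>, so half of it
  survives, and dividing by \<open>a / 2\<close> produces the constants
  \<open>2 * b\<^sup>2 * T / a\<^sup>2\<close> and \<open>1 / (2 * a * \<epsilon>)\<close>.\<close>

lemma L2_estimate:
  fixes w u g :: "real \<times> 'a \<Rightarrow> real" and G :: "real \<times> 'a \<Rightarrow> 'a" and u0 :: "'a \<Rightarrow> real"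
  assumes w: "continuous_on Q w" and u: "continuous_on Q u" and g: "continuous_on Q g"
    and u0: "continuous_on (closure \<Omega>) u0" and G: "continuous_on Q G"
    and g0: "\<And>t x. t \<in> {0..T} \<Longrightarrow> x \<in> closure \<Omega> \<Longrightarrow> g (t, x) \<ge> 0"
    and un: "\<And>t x. t \<in> {0..T} \<Longrightarrow> x \<in> closure \<Omega> \<Longrightarrow> u (t, x) \<ge> 0"
    and u0n: "\<And>x. x \<in> closure \<Omega> \<Longrightarrow> u0 x \<ge> 0"
    and ab: "0 < a" "a \<le> b" "\<And>t x. t \<in> {0..T} \<Longrightarrow> x \<in> closure \<Omega> \<Longrightarrow> a * u (t, x) \<le> w (t, x) \<and> w (t, x) \<le> b * u (t, x)"
    and wG: "\<And>t x. t \<in> {0..T} \<Longrightarrow> x \<in> \<Omega> \<Longrightarrow> ((\<lambda>y. w (t, y)) has_derivative (\<lambda>h. G (t, x) \<bullet> h)) (at x)"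
    and p: "p > 0" and C0: "C0 \<ge> 0"
    and weighted: "\<And>v G g. C1_bounded \<Omega> v G \<Longrightarrow> (\<forall>x\<in>\<Omega>. v x \<ge> 0) \<Longrightarrow> continuous_on \<Omega> g \<Longrightarrow> bounded (g ` \<Omega>) \<Longrightarrow>
      (\<forall>x\<in>\<Omega>. g x \<ge> 0) \<Longrightarrow>
      (LINT x:\<Omega>|lborel. (v x)\<^sup>2 * (g x)\<^sup>2) \<le>
        (LINT x:\<Omega>|lborel. (v x)\<^sup>2 + (norm (G x))\<^sup>2) * (C0 + (LINT x:\<Omega>|lborel. g x powr p))"
    and energy: "\<And>r. r \<in> {0..T} \<Longrightarrow> integral {0..r} (\<lambda>t. LINT x:\<Omega>|lborel. u (t, x) * w (t, x))
      + (LINT x:\<Omega>|lborel. (norm (integral {0..r} (\<lambda>s. G (s, x))))\<^sup>2) / 2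
    \<le> integral {0..r} (\<lambda>t. LINT x:\<Omega>|lborel. u0 x * w (t, x))
      + (LINT x:\<Omega>|lborel. integral {0..r} (\<lambda>s. w (s, x)) * integral {0..r} (\<lambda>s. u (s, x) * g (s, x)))"
    and \<epsilon>: "\<epsilon> > 0" "\<epsilon> \<le> 1 / 2" "\<epsilon> * (b\<^sup>2 * T) \<le> a / 4"
  shows "(LINT z:{0..T} \<times> \<Omega>|lborel. (u z)\<^sup>2) \<le> 2 * b\<^sup>2 * T / a\<^sup>2 * (LINT x:\<Omega>|lborel. (u0 x)\<^sup>2) *
     (1 + exp (4 * (1 / (2 * a * \<epsilon>)) * (C0 * T + (LINT z:{0..T} \<times> \<Omega>|lborel. g z powr p))))"
proof -
  have cl: "x \<in> \<Omega> \<Longrightarrow> x \<in> closure \<Omega>" for x using closure_subset by blast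
  have u0Q: "continuous_on Q (\<lambda>z. u0 (snd z))"
    by (rule continuous_on_compose2[OF u0]) (auto intro!: continuous_intros)
  have c1: "continuous_on Q (\<lambda>z. (u z)\<^sup>2)" "continuous_on Q (\<lambda>z. u z * w z)" "continuous_on Q (\<lambda>z. u0 (snd z) * w z)"
    "continuous_on Q (\<lambda>z. (u0 (snd z))\<^sup>2)"
    by (intro continuous_intros u w u0Q)+
  have c2: "continuous_on Q (\<lambda>z. g z powr p)"
    using g0 p by (intro continuous_on_powr' g continuous_intros) auto
  define U0 where "U0 = (LINT x:\<Omega>|lborel. (u0 x)\<^sup>2)"
  define y where "y s = sqrt (LINT x:\<Omega>|lborel. (u (s, x))\<^sup>2)" for s
  define P where "P s = C0 + (LINT x:\<Omega>|lborel. g (s, x) powr p)" for s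
  have y2: "(y s)\<^sup>2 = (LINT x:\<Omega>|lborel. (u (s, x))\<^sup>2)" for s
    unfolding y_def by (rule real_sqrt_pow2) (auto simp: set_lebesgue_integral_def intro!: Bochner_Integration.integral_nonneg)
  have yc: "continuous_on {0..T} y" and Pc: "continuous_on {0..T} P"
    unfolding y_def[abs_def] P_def[abs_def]
    by (intro continuous_intros continuous_on_space_integral c1 c2)+
  have P0: "P s \<ge> 0" for s using C0
    by (auto simp: P_def set_lebesgue_integral_def intro!: add_nonneg_nonneg Bochner_Integration.integral_nonneg)
  have U0: "U0 \<ge> 0" by (auto simp: U0_def set_lebesgue_integral_def intro!: Bochner_Integration.integral_nonneg)
  have wn: "w (t, x) \<ge> 0" if "t \<in> {0..T}" "x \<in> closure \<Omega>" for t x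
  proof -
    have "0 \<le> a * u (t, x)" using ab(1) un[OF that] by simp
    also have "\<dots> \<le> w (t, x)" using ab(3)[OF that] by simp
    finally show ?thesis .
  qed
  define c where "c = 1 / (2 * a * \<epsilon>)"
  have c: "c > 0" using ab \<epsilon> by (simp add: c_def)
  have "integral {0..T} (\<lambda>t. (y t)\<^sup>2) \<le> 2 * b\<^sup>2 * T / a\<^sup>2 * U0 * (1 + exp (4 * c * integral {0..T} P))"
  proof (rule quadratic_gronwall[OF T yc Pc P0 _ c])
    show "2 * b\<^sup>2 * T / a\<^sup>2 * U0 \<ge> 0" using U0 T by simp
    fix r assume r: "r \<in> {0..T}"
    define Y where "Y = integral {0..r} (\<lambda>t. (y t)\<^sup>2)"
    define Z where "Z = integral {0..r} (\<lambda>t. y t * sqrt (P t))"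
    define m where "m x = integral {0..r} (\<lambda>s. w (s, x))" for x
    define GM where "GM x = integral {0..r} (\<lambda>s. G (s, x))" for x
    define N where "N = (LINT x:\<Omega>|lborel. (m x)\<^sup>2 + (norm (GM x))\<^sup>2)"
    have mc: "continuous_on (closure \<Omega>) m" "continuous_on (closure \<Omega>) GM"
      unfolding m_def[abs_def] GM_def[abs_def] by (intro continuous_on_time_integral_space w G r)+
    have C1m: "C1_bounded \<Omega> m GM"
      unfolding m_def[abs_def] GM_def[abs_def] by (rule C1_bounded_time_integral[OF w G wG r])
    have m0: "m x \<ge> 0" if "x \<in> \<Omega>" for x
      unfolding m_def using time_integrable[OF w cl[OF that] r] wn[OF _ cl[OF that]] r by (intro integral_nonneg) auto
    have N0: "N \<ge> 0" by (auto simp: N_def set_lebesgue_integral_def intro!: Bochner_Integration.integral_nonneg)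
    define D where "D = (LINT x:\<Omega>|lborel. (norm (GM x))\<^sup>2)"
    have N_eq: "N = (LINT x:\<Omega>|lborel. (m x)\<^sup>2) + D"
      unfolding N_def D_def by (rule set_integral_add(2)) (intro set_integrable_closure continuous_intros mc)+
    have D0: "D \<ge> 0" by (auto simp: D_def set_lebesgue_integral_def intro!: Bochner_Integration.integral_nonneg)
    have Yeq: "Y = integral {0..r} (\<lambda>s. LINT x:\<Omega>|lborel. (u (s, x))\<^sup>2)" by (simp add: Y_def y2)
    have mY: "(LINT x:\<Omega>|lborel. (m x)\<^sup>2) \<le> b\<^sup>2 * T * Y"
      unfolding m_def Yeq by (rule time_integral_square_le[OF w u _ r]) (use ab(3) wn in auto)
    have Y0: "Y \<ge> 0" unfolding Y_def using r yc
      by (intro integral_nonneg integrable_continuous_real continuous_intros) (auto intro: continuous_on_subset)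
    have src: "(LINT x:\<Omega>|lborel. m x * integral {0..r} (\<lambda>s. u (s, x) * g (s, x))) \<le> sqrt N * Z"
      unfolding Z_def y_def P_def
    proof (rule source_term_bound[OF u g g0 p mc(1) N0 C0 _ r])
      fix t assume t: "t \<in> {0..T}"
      have gt: "continuous_on (closure \<Omega>) (\<lambda>x. g (t, x))" by (rule continuous_on_slice_space[OF g t])
      show "(LINT x:\<Omega>|lborel. (m x)\<^sup>2 * (g (t, x))\<^sup>2) \<le> N * (C0 + (LINT x:\<Omega>|lborel. g (t, x) powr p))"
        unfolding N_def
      proof (rule weighted[OF C1m])
        show "continuous_on \<Omega> (\<lambda>x. g (t, x))" using gt closure_subset continuous_on_subset by blast
        have "compact (closure \<Omega>)" using bd by (simp add: compact_closure)
        then show "bounded ((\<lambda>x. g (t, x)) ` \<Omega>)"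
          using gt by (meson bounded_subset closure_subset compact_continuous_image compact_imp_bounded image_mono)
      qed (use m0 g0[OF t] cl in auto)
    qed auto
    have young: "sqrt N * Z \<le> \<epsilon> * N + Z\<^sup>2 / (4 * \<epsilon>)"
    proof -
      define q where "q = sqrt N"
      have q: "q\<^sup>2 = N" using N0 by (simp add: q_def)
      have "0 \<le> (2 * \<epsilon> * q - Z)\<^sup>2 / (4 * \<epsilon>)" using \<epsilon> by simp
      also have "\<dots> = \<epsilon> * q\<^sup>2 + Z\<^sup>2 / (4 * \<epsilon>) - q * Z"
        using \<epsilon> by (simp add: power2_eq_square field_simps)
      finally show ?thesis using q by (simp add: q_def)
    qed
    have lhs: "a * Y \<le> integral {0..r} (\<lambda>t. LINT x:\<Omega>|lborel. u (t, x) * w (t, x))"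
    proof -
      have "a * Y = integral {0..r} (\<lambda>t. a * (LINT x:\<Omega>|lborel. (u (t, x))\<^sup>2))"
        by (simp add: Yeq)
      also have "\<dots> \<le> integral {0..r} (\<lambda>t. LINT x:\<Omega>|lborel. u (t, x) * w (t, x))"
      proof (rule integral_le)
        show "(\<lambda>t. a * (LINT x:\<Omega>|lborel. (u (t, x))\<^sup>2)) integrable_on {0..r}"
          using space_integral_integrable[OF c1(1) r] by (intro integrable_on_mult_right)
        show "(\<lambda>t. LINT x:\<Omega>|lborel. u (t, x) * w (t, x)) integrable_on {0..r}"
          by (rule space_integral_integrable[OF c1(2) r])
        fix t assume t: "t \<in> {0..r}"
        then have t: "t \<in> {0..T}" using r by auto
        note si = set_integrable_closure[OF continuous_on_slice_space[OF _ t]]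
        have "(LINT x:\<Omega>|lborel. a * (u (t, x))\<^sup>2) \<le> (LINT x:\<Omega>|lborel. u (t, x) * w (t, x))"
        proof (rule set_integral_mono)
          show "a * (u (t, x))\<^sup>2 \<le> u (t, x) * w (t, x)" if "x \<in> \<Omega>" for x
            using mult_left_mono[of "a * u (t, x)" "w (t, x)" "u (t, x)"] ab(3)[OF t cl[OF that]] un[OF t cl[OF that]]
            by (simp add: power2_eq_square mult_ac)
        qed (use si[OF c1(1)] si[OF c1(2)] in auto)
        then show "a * (LINT x:\<Omega>|lborel. (u (t, x))\<^sup>2) \<le> (LINT x:\<Omega>|lborel. u (t, x) * w (t, x))" by simp
      qed
      finally show ?thesis .
    qed
    have rhs: "integral {0..r} (\<lambda>t. LINT x:\<Omega>|lborel. u0 x * w (t, x)) \<le> a / 4 * Y + b\<^sup>2 * T / a * U0"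
    proof -
      have "integral {0..r} (\<lambda>t. LINT x:\<Omega>|lborel. u0 x * w (t, x)) \<le>
        integral {0..r} (\<lambda>t. a / 4 * (LINT x:\<Omega>|lborel. (u (t, x))\<^sup>2) + b\<^sup>2 / a * U0)"
      proof (rule integral_le)
        show "(\<lambda>t. LINT x:\<Omega>|lborel. u0 x * w (t, x)) integrable_on {0..r}"
          using space_integral_integrable[OF c1(3) r] by simp
        show "(\<lambda>t. a / 4 * (LINT x:\<Omega>|lborel. (u (t, x))\<^sup>2) + b\<^sup>2 / a * U0) integrable_on {0..r}"
          using space_integral_integrable[OF c1(1) r] by (intro integrable_add integrable_on_mult_right integrable_const_ivl)
        fix t assume t: "t \<in> {0..r}"
        then have t: "t \<in> {0..T}" using r by auto
        note si = set_integrable_closure[OF continuous_on_slice_space[OF _ t]]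
        have "(LINT x:\<Omega>|lborel. u0 x * w (t, x)) \<le> (LINT x:\<Omega>|lborel. a / 4 * (u (t, x))\<^sup>2 + b\<^sup>2 / a * (u0 x)\<^sup>2)"
        proof (rule set_integral_mono)
          show "set_integrable lborel \<Omega> (\<lambda>x. u0 x * w (t, x))" using si[OF c1(3)] by simp
          show "set_integrable lborel \<Omega> (\<lambda>x. a / 4 * (u (t, x))\<^sup>2 + b\<^sup>2 / a * (u0 x)\<^sup>2)"
            using si[OF c1(1)] si[OF c1(4)] by (intro set_integral_add set_integrable_mult_right) simp_all
          fix x assume x: "x \<in> \<Omega>"
          have "u0 x * w (t, x) \<le> u0 x * (b * u (t, x))"
            using ab(3)[OF t cl[OF x]] u0n[OF cl[OF x]] by (intro mult_left_mono) auto
          also have "\<dots> \<le> a / 4 * (u (t, x))\<^sup>2 + b\<^sup>2 / a * (u0 x)\<^sup>2"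
          proof -
            \<comment> \<open>The square is weighted so that \<open>u\<^sup>2\<close> receives the
              coefficient \<open>a / 4\<close> reserved for the initial datum; completing the square
              forces \<open>b\<^sup>2 / a\<close> on the other term.\<close>
            have "0 \<le> (a * u (t, x) - 2 * b * u0 x)\<^sup>2 / (4 * a)" using ab by simp
            also have "\<dots> = a / 4 * (u (t, x))\<^sup>2 + b\<^sup>2 / a * (u0 x)\<^sup>2 - u0 x * (b * u (t, x))"
              using ab(1) by (simp add: power2_eq_square field_simps)
            finally show ?thesis by simp
          qed
          finally show "u0 x * w (t, x) \<le> a / 4 * (u (t, x))\<^sup>2 + b\<^sup>2 / a * (u0 x)\<^sup>2" .
        qed
        also have "\<dots> = a / 4 * (LINT x:\<Omega>|lborel. (u (t, x))\<^sup>2) + b\<^sup>2 / a * U0"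
        proof -
          have "(LINT x:\<Omega>|lborel. a / 4 * (u (t, x))\<^sup>2 + b\<^sup>2 / a * (u0 x)\<^sup>2) =
             (LINT x:\<Omega>|lborel. a / 4 * (u (t, x))\<^sup>2) + (LINT x:\<Omega>|lborel. b\<^sup>2 / a * (u0 x)\<^sup>2)"
            using si[OF c1(1)] si[OF c1(4)] by (intro set_integral_add(2) set_integrable_mult_right) simp_all
          then show ?thesis unfolding set_integral_mult_right U0_def .
        qed
        finally show "(LINT x:\<Omega>|lborel. u0 x * w (t, x)) \<le> a / 4 * (LINT x:\<Omega>|lborel. (u (t, x))\<^sup>2) + b\<^sup>2 / a * U0" .
      qed
      also have "\<dots> = a / 4 * Y + r * (b\<^sup>2 / a * U0)"
      proof -
        have "integral {0..r} (\<lambda>t. a / 4 * (LINT x:\<Omega>|lborel. (u (t, x))\<^sup>2) + b\<^sup>2 / a * U0)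
          = integral {0..r} (\<lambda>t. a / 4 * (LINT x:\<Omega>|lborel. (u (t, x))\<^sup>2)) + integral {0..r} (\<lambda>t. b\<^sup>2 / a * U0)"
          using space_integral_integrable[OF c1(1) r] by (intro integral_add integrable_on_mult_right integrable_const_ivl)
        then show ?thesis using r unfolding Yeq integral_mult_right by simp
      qed
      also have "\<dots> \<le> a / 4 * Y + T * (b\<^sup>2 / a * U0)"
        using r U0 ab by (intro add_left_mono mult_right_mono) auto
      finally show ?thesis by (simp add: mult_ac)
    qed
    have "a * Y + D / 2 \<le> a / 4 * Y + b\<^sup>2 * T / a * U0 + (\<epsilon> * N + Z\<^sup>2 / (4 * \<epsilon>))"
      using energy[OF r] lhs rhs src young by (simp add: m_def GM_def D_def)
    moreover have "\<epsilon> * N \<le> a / 4 * Y + D / 2"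
    proof -
      have "\<epsilon> * (LINT x:\<Omega>|lborel. (m x)\<^sup>2) \<le> \<epsilon> * (b\<^sup>2 * T * Y)" using mY \<epsilon> by (intro mult_left_mono) auto
      also have "\<dots> \<le> a / 4 * Y" using mult_right_mono[OF \<epsilon>(3) Y0] by (simp add: mult_ac)
      finally have "\<epsilon> * (LINT x:\<Omega>|lborel. (m x)\<^sup>2) \<le> a / 4 * Y" .
      moreover have "\<epsilon> * D \<le> 1 / 2 * D" using \<epsilon>(2) D0 by (rule mult_right_mono)
      ultimately show ?thesis by (simp add: N_eq distrib_left)
    qed
    ultimately have "a / 2 * Y \<le> b\<^sup>2 * T / a * U0 + Z\<^sup>2 / (4 * \<epsilon>)" by simp
    then have "2 / a * (a / 2 * Y) \<le> 2 / a * (b\<^sup>2 * T / a * U0 + Z\<^sup>2 / (4 * \<epsilon>))"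
      using ab by (intro mult_left_mono) auto
    also have "2 / a * (b\<^sup>2 * T / a * U0 + Z\<^sup>2 / (4 * \<epsilon>)) = 2 * b\<^sup>2 * T / a\<^sup>2 * U0 + c * Z\<^sup>2"
      using ab(1) \<epsilon>(1) by (simp add: c_def field_simps power2_eq_square)
    finally have "Y \<le> 2 * b\<^sup>2 * T / a\<^sup>2 * U0 + c * Z\<^sup>2" using ab(1) by simp
    then show "integral {0..r} (\<lambda>t. (y t)\<^sup>2) \<le> 2 * b\<^sup>2 * T / a\<^sup>2 * U0 + c * (integral {0..r} (\<lambda>t. y t * sqrt (P t)))\<^sup>2"
      by (simp add: Y_def Z_def)
  qed
  moreover have "integral {0..T} P = C0 * T + (LINT z:{0..T} \<times> \<Omega>|lborel. g z powr p)"
    using T integral_space_time(1)[OF c2, of T] space_integral_integrable[OF c2, of T]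
    by (simp add: P_def[abs_def] integral_add[OF integrable_const_ivl])
  moreover have "integral {0..T} (\<lambda>t. (y t)\<^sup>2) = (LINT z:{0..T} \<times> \<Omega>|lborel. (u z)\<^sup>2)"
    using T integral_space_time(1)[OF c1(1), of T] by (simp add: y2)
  ultimately show ?thesis by (simp add: U0_def c_def)
qed

end

section \<open>Calculus of \<open>Ck_on\<close> and classical derivatives on the closed
  cylinder\<close>

lemma Ck_on_imp_continuous: "Ck_on k S g \<Longrightarrow> continuous_on S g"
proof (cases k)
  case (Suc j)
  assume "Ck_on k S g"
  then obtain g' where "\<And>x. x \<in> S \<Longrightarrow> (g has_derivative g' x) (at x within S)" using Suc by auto
  then show ?thesis by (rule has_derivative_continuous_on)
qed simp

lemma Ck_on_Suc_imp_Ck_on: "Ck_on (Suc k) S g \<Longrightarrow> Ck_on k S g"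
proof (induction k arbitrary: g)
  case 0
  then show ?case using Ck_on_imp_continuous[of "Suc 0" S g] by simp
next
  case (Suc k)
  from Suc.prems obtain g' where "\<forall>x\<in>S. (g has_derivative g' x) (at x within S)" "\<forall>v. Ck_on (Suc k) S (\<lambda>x. g' x v)"
    by (subst (asm) Ck_on.simps(2)) blast
  then show ?case using Suc.IH by (subst Ck_on.simps(2)) blast
qed

lemma Ck_on_add: "Ck_on k S f \<Longrightarrow> Ck_on k S g \<Longrightarrow> Ck_on k S (\<lambda>x. f x + g x)"
proof (induction k arbitrary: f g)
  case 0
  then show ?case by (simp add: continuous_on_add)
next
  case (Suc k)
  from Suc.prems obtain f' g' where f: "\<forall>x\<in>S. (f has_derivative f' x) (at x within S)" "\<forall>v. Ck_on k S (\<lambda>x. f' x v)"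
    and g: "\<forall>x\<in>S. (g has_derivative g' x) (at x within S)" "\<forall>v. Ck_on k S (\<lambda>x. g' x v)"
    by auto
  show ?case
    unfolding Ck_on.simps(2)
    by (intro exI[of _ "\<lambda>x v. f' x v + g' x v"] conjI ballI allI has_derivative_add Suc.IH) (use f g in auto)
qed

text \<open>The product rule at order \<open>Suc k\<close> involves the factors themselves at order
  \<open>k\<close> and not only their derivatives, so both are first lowered by one order.\<close>

lemma Ck_on_mult: "Ck_on k S f \<Longrightarrow> Ck_on k S g \<Longrightarrow> Ck_on k S (\<lambda>x. f x * g x)"
proof (induction k arbitrary: f g)
  case 0
  then show ?case by (simp add: continuous_on_mult)
next
  case (Suc k)
  note fg = Ck_on_Suc_imp_Ck_on[OF Suc.prems(1)] Ck_on_Suc_imp_Ck_on[OF Suc.prems(2)]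
  from Suc.prems obtain f' g' where f: "\<forall>x\<in>S. (f has_derivative f' x) (at x within S)" "\<forall>v. Ck_on k S (\<lambda>x. f' x v)"
    and g: "\<forall>x\<in>S. (g has_derivative g' x) (at x within S)" "\<forall>v. Ck_on k S (\<lambda>x. g' x v)"
    by auto
  show ?case
    unfolding Ck_on.simps(2)
    by (intro exI[of _ "\<lambda>x v. f x * g' x v + f' x v * g x"] conjI ballI allI has_derivative_mult Ck_on_add Suc.IH)
      (use f g fg in auto)
qed

text \<open>Regularity is assumed jointly in time and space, whereas the estimates use separate time
  and space derivatives that are continuous up to the boundary. These are the values of the joint
  derivatives on the directions (1,0) and (0,h). On the closure the gradient is identified with
  \<open>G\<close> by uniqueness of derivatives there, which is how the Neumann condition becomes
  usable.\<close>

lemma (in cylinder) C2_on_cylinder: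
  fixes w :: "real \<times> 'a \<Rightarrow> real"
  assumes dom: "C2_bounded_domain \<Omega>" and w: "Ck_on 2 Q w"
  obtains wt :: "real \<times> 'a \<Rightarrow> real" and G :: "real \<times> 'a \<Rightarrow> 'a" and DG :: "real \<times> 'a \<Rightarrow> 'a \<Rightarrow> 'a"
  where "\<And>t x. t \<in> {0..T} \<Longrightarrow> x \<in> closure \<Omega> \<Longrightarrow> ((\<lambda>s. w (s, x)) has_vector_derivative wt (t, x)) (at t within {0..T})"
    and "continuous_on Q wt"
    and "\<And>t x. t \<in> {0..T} \<Longrightarrow> x \<in> \<Omega> \<Longrightarrow> ((\<lambda>y. w (t, y)) has_derivative (\<lambda>h. G (t, x) \<bullet> h)) (at x)"
    and "continuous_on Q G"
    and "\<And>t x. t \<in> {0..T} \<Longrightarrow> x \<in> \<Omega> \<Longrightarrow> ((\<lambda>y. G (t, y)) has_derivative DG (t, x)) (at x)"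
    and "\<And>v. continuous_on Q (\<lambda>z. DG z v)"
    and "\<And>t x. t \<in> {0..T} \<Longrightarrow> x \<in> \<Omega> \<Longrightarrow> laplacian (\<lambda>y. w (t, y)) x = (\<Sum>i\<in>Basis. DG (t, x) i \<bullet> i)"
    and "\<And>t x. t \<in> {0..T} \<Longrightarrow> x \<in> closure \<Omega> \<Longrightarrow> grad_within (closure \<Omega>) (\<lambda>y. w (t, y)) x = G (t, x)"
proof -
  have cl: "x \<in> \<Omega> \<Longrightarrow> x \<in> closure \<Omega>" for x using closure_subset by blast
  from w have "Ck_on (Suc (Suc 0)) Q w" by (simp add: numeral_2_eq_2)
  then obtain D where D: "\<And>z. z \<in> Q \<Longrightarrow> (w has_derivative D z) (at z within Q)" and D1: "\<And>v. Ck_on (Suc 0) Q (\<lambda>z. D z v)"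
    by (subst (asm) Ck_on.simps(2)) blast
  from D1 have "\<forall>v. \<exists>E. (\<forall>z\<in>Q. ((\<lambda>z. D z v) has_derivative E z) (at z within Q)) \<and> (\<forall>h. continuous_on Q (\<lambda>z. E z h))"
    by simp
  then obtain E where E: "\<And>v z. z \<in> Q \<Longrightarrow> ((\<lambda>z. D z v) has_derivative E v z) (at z within Q)"
    and Ec: "\<And>v h. continuous_on Q (\<lambda>z. E v z h)"
    by metis
  have Dc: "continuous_on Q (\<lambda>z. D z v)" for v
    using D1[of v] by (rule Ck_on_imp_continuous)
  define G where "G z = (\<Sum>i\<in>Basis. D z (0, i) *\<^sub>R i)" for z
  define DG where "DG z h = (\<Sum>i\<in>Basis. E (0, i) z (0, h) *\<^sub>R i)" for z h
  \<comment> \<open>Chain rule with the affine embedding of the time slice; the derivative within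
    the cylinder is first restricted to that slice.\<close>
  have space: "((\<lambda>y. g (t, y)) has_derivative (\<lambda>h. d (0, h))) (at x within closure \<Omega>)"
    if "(g has_derivative d) (at (t, x) within Q)" "t \<in> {0..T}" for g :: "real \<times> 'a \<Rightarrow> real" and d t x
  proof -
    have "((\<lambda>y. (t, y)) has_derivative (\<lambda>h. (0, h))) (at x within closure \<Omega>)"
      by (auto intro!: derivative_eq_intros)
    moreover have "(g has_derivative d) (at (t, x) within (\<lambda>y. (t, y)) ` closure \<Omega>)"
      using that by (auto intro: has_derivative_subset)
    ultimately show ?thesis using has_derivative_in_compose by fastforce
  qed
  have GD: "D z (0, h) = G z \<bullet> h" if "z \<in> Q" for z h
  proof -
    have "linear (D z)" using D[OF that] has_derivative_linear by blast
    then have "linear (\<lambda>h. D z (0, h))"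
      using linear_add[of "D z" "(0, _)" "(0, _)"] linear_scale[of "D z" _ "(0, _)"]
      by (intro linearI) (simp_all add: scaleR_Pair)
    then interpret linear "\<lambda>h. D z (0, h)" .
    have "D z (0, h) = D z (0, \<Sum>i\<in>Basis. (h \<bullet> i) *\<^sub>R i)"
      by (simp add: euclidean_representation)
    also have "\<dots> = (\<Sum>i\<in>Basis. (h \<bullet> i) * D z (0, i))" by (simp only: sum scale real_scaleR_def)
    also have "\<dots> = (\<Sum>i\<in>Basis. (D z (0, i) *\<^sub>R i) \<bullet> h)"
      by (rule sum.cong) (simp_all add: inner_commute)
    finally show ?thesis by (simp only: G_def inner_sum_left)
  qed
  have wG: "((\<lambda>y. w (t, y)) has_derivative (\<lambda>h. G (t, x) \<bullet> h)) (at x within closure \<Omega>)"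
    if "t \<in> {0..T}" "x \<in> closure \<Omega>" for t x
    using space[OF D[of "(t, x)"]] that by (simp add: GD)
  have at_eq: "at x within closure \<Omega> = at x" if "x \<in> \<Omega>" for x
    using op that at_within_interior by (metis closure_subset interior_maximal subsetD)
  have GDG: "((\<lambda>y. G (t, y)) has_derivative DG (t, x)) (at x)" if t: "t \<in> {0..T}" and x: "x \<in> \<Omega>" for t x
  proof -
    have "((\<lambda>y. D (t, y) (0, i)) has_derivative (\<lambda>h. E (0, i) (t, x) (0, h))) (at x)" for i
      using space[OF E[of "(t, x)" "(0, i)"] t] t cl[OF x] at_eq[OF x] by simp
    then show ?thesis unfolding G_def DG_def[abs_def]
      by (intro has_derivative_sum has_derivative_scaleR_left)
  qed
  show thesis
  proof (rule that[of "\<lambda>z. D z (1, 0)" G DG])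
    fix t x assume t: "t \<in> {0..T}" and x: "x \<in> closure \<Omega>"
    have "((\<lambda>s. (s, x)) has_vector_derivative (1, 0)) (at t within {0..T})"
      unfolding has_vector_derivative_def by (auto intro!: derivative_eq_intros)
    moreover have "(w has_derivative D (t, x)) (at (t, x) within (\<lambda>s. (s, x)) ` {0..T})"
      using D[of "(t, x)"] t x by (auto intro: has_derivative_subset)
    ultimately show "((\<lambda>s. w (s, x)) has_vector_derivative D (t, x) (1, 0)) (at t within {0..T})"
      using vector_derivative_diff_chain_within by (fastforce simp: o_def)
    have "(\<lambda>y. w (t, y)) differentiable (at x within closure \<Omega>)"
      using wG[OF t x] differentiableI by blast
    then have "((\<lambda>y. w (t, y)) has_derivative frechet_derivative (\<lambda>y. w (t, y)) (at x within closure \<Omega>)) (at x within closure \<Omega>)"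
      by (simp add: frechet_derivative_works)
    from has_derivative_unique_closure_domain[OF dom x this wG[OF t x]]
    show "grad_within (closure \<Omega>) (\<lambda>y. w (t, y)) x = G (t, x)"
      by (simp add: grad_within_def euclidean_representation)
  next
    fix t x assume t: "t \<in> {0..T}" and x: "x \<in> \<Omega>"
    have wd: "((\<lambda>y. w (t, y)) has_derivative (\<lambda>h. G (t, y) \<bullet> h)) (at y)" if "y \<in> \<Omega>" for y
      using wG[OF t cl[OF that]] at_eq[OF that] by simp
    show "((\<lambda>y. w (t, y)) has_derivative (\<lambda>h. G (t, x) \<bullet> h)) (at x)" by (rule wd[OF x])
    show "((\<lambda>y. G (t, y)) has_derivative DG (t, x)) (at x)" by (rule GDG[OF t x])
    have "frechet_derivative (\<lambda>y. frechet_derivative (\<lambda>y. w (t, y)) (at y) i) (at x) = (\<lambda>h. DG (t, x) h \<bullet> i)" for i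
    proof (rule frechet_derivative_at[symmetric])
      have "((\<lambda>y. G (t, y) \<bullet> i) has_derivative (\<lambda>h. DG (t, x) h \<bullet> i)) (at x)"
        by (rule has_derivative_inner_left[OF GDG[OF t x]])
      then show "((\<lambda>y. frechet_derivative (\<lambda>y. w (t, y)) (at y) i) has_derivative (\<lambda>h. DG (t, x) h \<bullet> i)) (at x)"
        by (rule has_derivative_transform_within_open[OF _ op x]) (metis frechet_derivative_at[OF wd])
    qed
    then show "laplacian (\<lambda>y. w (t, y)) x = (\<Sum>i\<in>Basis. DG (t, x) i \<bullet> i)"
      by (simp add: laplacian_def)
  next
    show "continuous_on Q (\<lambda>z. D z (1, 0))" by (rule Dc)
    show "continuous_on Q G" unfolding G_def[abs_def] by (intro continuous_intros Dc)
    show "continuous_on Q (\<lambda>z. DG z v)" for v unfolding DG_def by (intro continuous_intros Ec)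
  qed
qed

lemma Lp_norm_on_2: "Lp_norm_on 2 S g = sqrt (LINT x:S|lborel. (g x)\<^sup>2)"
proof -
  have "(LINT x:S|lborel. \<bar>g x\<bar> powr 2) = (LINT x:S|lborel. (g x)\<^sup>2)" by simp
  moreover have "(LINT x:S|lborel. (g x)\<^sup>2) \<ge> 0"
    by (auto simp: set_lebesgue_integral_def intro!: Bochner_Integration.integral_nonneg)
  ultimately show ?thesis by (simp add: Lp_norm_on_def powr_half_sqrt)
qed

lemma Lp_norm_on_powr:
  assumes "p > 0"
  shows "Lp_norm_on p S g powr p = (LINT x:S|lborel. \<bar>g x\<bar> powr p)"
proof -
  have "(LINT x:S|lborel. \<bar>g x\<bar> powr p) \<ge> 0"
    by (auto simp: set_lebesgue_integral_def intro!: Bochner_Integration.integral_nonneg)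
  then show ?thesis using assms by (simp add: Lp_norm_on_def powr_powr)
qed

theorem proposition1:
  fixes T a b p :: real
    and \<Omega> :: "'a::euclidean_space set"
    and n :: "'a \<Rightarrow> 'a"
  assumes "DIM('a) \<le> 2"
    and "T > 0"
    and "C2_bounded_domain \<Omega>"
    and "\<forall>x\<in>frontier \<Omega>. outward_unit_normal_at \<Omega> x (n x)"
    and "0 < a" and "a < b"
    and "p > 2"
  shows "\<exists>C :: real \<Rightarrow> real.
    \<forall>(\<mu> :: real \<times> 'a \<Rightarrow> real) (f :: real \<times> 'a \<Rightarrow> real)
     (u_in :: 'a \<Rightarrow> real) (u :: real \<times> 'a \<Rightarrow> real).
      smooth_on ({0..T} \<times> closure \<Omega>) \<mu> \<longrightarrow>
      (\<forall>z\<in>{0..T} \<times> closure \<Omega>. \<mu> z \<in> {a..b}) \<longrightarrow>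
      smooth_on ({0..T} \<times> closure \<Omega>) f \<longrightarrow>
      smooth_on (closure \<Omega>) u_in \<longrightarrow>
      (\<forall>x\<in>closure \<Omega>. u_in x \<ge> 0) \<longrightarrow>
      Ck_on 2 ({0..T} \<times> closure \<Omega>) u \<longrightarrow>
      (\<forall>z\<in>{0..T} \<times> closure \<Omega>. u z \<ge> 0) \<longrightarrow>
      (\<forall>t\<in>{0..T}. \<forall>x\<in>\<Omega>.
         vector_derivative (\<lambda>s. u (s, x)) (at t within {0..T})
           - laplacian (\<lambda>y. \<mu> (t, y) * u (t, y)) x \<le> u (t, x) * f (t, x)) \<longrightarrow>
      (\<forall>t\<in>{0..T}. \<forall>x\<in>frontier \<Omega>.
         grad_within (closure \<Omega>) (\<lambda>y. \<mu> (t, y) * u (t, y)) x \<bullet> n x = 0) \<longrightarrow>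
      (\<forall>x\<in>\<Omega>. u (0, x) = u_in x) \<longrightarrow>
      Lp_norm_on 2 ({0..T} \<times> \<Omega>) u
        \<le> C (Lp_norm_on p ({0..T} \<times> \<Omega>) f) * Lp_norm_on 2 \<Omega> u_in"
proof -
  interpret cylinder T \<Omega>
    using assms by unfold_locales (auto simp: C2_bounded_domain_def)
  have cl: "x \<in> \<Omega> \<Longrightarrow> x \<in> closure \<Omega>" and fr: "x \<in> frontier \<Omega> \<Longrightarrow> x \<in> closure \<Omega>" for x
    using closure_subset by (auto simp: frontier_def)
  obtain C0 where C0: "C0 \<ge> 0"
    and weighted: "\<And>v G g. C1_bounded \<Omega> v G \<Longrightarrow> (\<forall>x\<in>\<Omega>. v x \<ge> 0) \<Longrightarrow> continuous_on \<Omega> g \<Longrightarrow> bounded (g ` \<Omega>) \<Longrightarrow>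
      (\<forall>x\<in>\<Omega>. g x \<ge> 0) \<Longrightarrow>
      (LINT x:\<Omega>|lborel. (v x)\<^sup>2 * (g x)\<^sup>2) \<le>
        (LINT x:\<Omega>|lborel. (v x)\<^sup>2 + (norm (G x))\<^sup>2) * (C0 + (LINT x:\<Omega>|lborel. g x powr p))"
    using weighted_sobolev[OF assms(3,1,7)] by blast
  \<comment> \<open>The largest value permitted by the two absorption conditions, on the gradient
    and on the L^2 part.\<close>
  define \<epsilon> where "\<epsilon> = min (1 / 2) (a / (4 * (b\<^sup>2 * T)))"
  have bT: "b\<^sup>2 * T > 0" using assms by simp
  have \<epsilon>: "\<epsilon> > 0" "\<epsilon> \<le> 1 / 2" "\<epsilon> * (b\<^sup>2 * T) \<le> a / 4"
  proof -
    show "\<epsilon> > 0" "\<epsilon> \<le> 1 / 2" using bT assms(5) by (auto simp: \<epsilon>_def)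
    have "\<epsilon> * (b\<^sup>2 * T) \<le> a / (4 * (b\<^sup>2 * T)) * (b\<^sup>2 * T)"
      using bT by (intro mult_right_mono) (auto simp: \<epsilon>_def)
    also have "\<dots> = a / 4" using assms(2,5,6) by simp
    finally show "\<epsilon> * (b\<^sup>2 * T) \<le> a / 4" .
  qed
  \<comment> \<open>Fixed before \<open>\<mu>\<close>, \<open>f\<close>, \<open>u_in\<close> and
    \<open>u\<close> are introduced. Besides \<open>a\<close>, \<open>b\<close>, \<open>T\<close>
    and \<open>\<epsilon>\<close> only \<open>C0\<close> enters, which was obtained from the domain
    and \<open>p\<close> alone. The square root appears because the estimate is for the squared
    norm.\<close>
  define C where "C N = sqrt (2 * b\<^sup>2 * T / a\<^sup>2 * (1 + exp (4 * (1 / (2 * a * \<epsilon>)) * (C0 * T + N powr p))))" for N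
  show ?thesis
  proof (intro exI[of _ C] allI impI)
    fix \<mu> f :: "real \<times> 'a \<Rightarrow> real" and u_in :: "'a \<Rightarrow> real" and u :: "real \<times> 'a \<Rightarrow> real"
    assume \<mu>: "smooth_on Q \<mu>" "\<forall>z\<in>Q. \<mu> z \<in> {a..b}" and f: "smooth_on Q f"
      and u_in: "smooth_on (closure \<Omega>) u_in" "\<forall>x\<in>closure \<Omega>. u_in x \<ge> 0"
      and u: "Ck_on 2 Q u" "\<forall>z\<in>Q. u z \<ge> 0"
      and pde: "\<forall>t\<in>{0..T}. \<forall>x\<in>\<Omega>. vector_derivative (\<lambda>s. u (s, x)) (at t within {0..T})
           - laplacian (\<lambda>y. \<mu> (t, y) * u (t, y)) x \<le> u (t, x) * f (t, x)"
      and neumann: "\<forall>t\<in>{0..T}. \<forall>x\<in>frontier \<Omega>. grad_within (closure \<Omega>) (\<lambda>y. \<mu> (t, y) * u (t, y)) x \<bullet> n x = 0"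
      and init: "\<forall>x\<in>\<Omega>. u (0, x) = u_in x"
    define w where "w z = \<mu> z * u z" for z
    \<comment> \<open>The absolute value provides the sign that monotonicity of the accumulated
      source requires and leaves the L^p norm unchanged; since \<open>u\<close> is nonnegative, the
      differential inequality remains true with it.\<close>
    define g where "g z = \<bar>f z\<bar>" for z
    have uc: "continuous_on Q u" using u(1) by (rule Ck_on_imp_continuous)
    have fc: "continuous_on Q f" using f Ck_on_imp_continuous unfolding smooth_on_def by blast
    have gc: "continuous_on Q g" unfolding g_def[abs_def] by (intro continuous_intros fc)
    have uic: "continuous_on (closure \<Omega>) u_in" using u_in(1) Ck_on_imp_continuous unfolding smooth_on_def by blast
    have w2: "Ck_on 2 Q w"
      unfolding w_def[abs_def] using \<mu>(1) u(1) by (intro Ck_on_mult) (auto simp: smooth_on_def)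
    from w2 obtain G DG
      where G: "\<And>t x. t \<in> {0..T} \<Longrightarrow> x \<in> \<Omega> \<Longrightarrow> ((\<lambda>y. w (t, y)) has_derivative (\<lambda>h. G (t, x) \<bullet> h)) (at x)"
        "continuous_on Q G"
        and DG: "\<And>t x. t \<in> {0..T} \<Longrightarrow> x \<in> \<Omega> \<Longrightarrow> ((\<lambda>y. G (t, y)) has_derivative DG (t, x)) (at x)"
        "\<And>v. continuous_on Q (\<lambda>z. DG z v)"
        and lap: "\<And>t x. t \<in> {0..T} \<Longrightarrow> x \<in> \<Omega> \<Longrightarrow> laplacian (\<lambda>y. w (t, y)) x = (\<Sum>i\<in>Basis. DG (t, x) i \<bullet> i)"
        and gr: "\<And>t x. t \<in> {0..T} \<Longrightarrow> x \<in> closure \<Omega> \<Longrightarrow> grad_within (closure \<Omega>) (\<lambda>y. w (t, y)) x = G (t, x)"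
      by (rule C2_on_cylinder[OF assms(3)]) (rule that; assumption)
    obtain ut
      where ut: "\<And>t x. t \<in> {0..T} \<Longrightarrow> x \<in> closure \<Omega> \<Longrightarrow> ((\<lambda>s. u (s, x)) has_vector_derivative ut (t, x)) (at t within {0..T})"
        "continuous_on Q ut"
      by (rule C2_on_cylinder[OF assms(3) u(1)]) (rule that; assumption)
    have wc: "continuous_on Q w"
      using w2 by (rule Ck_on_imp_continuous)
    have ab: "a * u (t, x) \<le> w (t, x) \<and> w (t, x) \<le> b * u (t, x)" if "t \<in> {0..T}" "x \<in> closure \<Omega>" for t x
      using \<mu>(2) u(2) that by (auto simp: w_def intro!: mult_right_mono)
    have un: "u (t, x) \<ge> 0" if "t \<in> {0..T}" "x \<in> closure \<Omega>" for t x
      using u(2) that by auto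
    have wn: "w (t, x) \<ge> 0" if "t \<in> {0..T}" "x \<in> closure \<Omega>" for t x
      using mult_nonneg_nonneg[OF less_imp_le[OF assms(5)] un[OF that]] ab[OF that] by linarith
    have flux: "G (t, x) \<bullet> n x = 0" if "t \<in> {0..T}" "x \<in> frontier \<Omega>" for t x
    proof -
      have "grad_within (closure \<Omega>) (\<lambda>y. w (t, y)) x \<bullet> n x = 0"
        unfolding w_def using neumann that by blast
      then show ?thesis using gr[OF that(1) fr[OF that(2)]] by simp
    qed
    define L where "L z = (\<Sum>i\<in>Basis. DG z i \<bullet> i)" for z
    have Lc: "continuous_on Q L" unfolding L_def[abs_def] by (intro continuous_intros DG)
    have ugc: "continuous_on Q (\<lambda>z. u z * g z)" by (intro continuous_intros uc gc)
    \<comment> \<open>Only interior points are needed, since the inequality is used under integrals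
      over \<open>\<Omega>\<close>. Integrating from time 0 replaces the time derivative by the
      initial datum.\<close>
    have ineq: "u (t, x) \<le> u_in x + integral {0..t} (\<lambda>s. L (s, x)) + integral {0..t} (\<lambda>s. u (s, x) * g (s, x))"
      if t: "t \<in> {0..T}" and x: "x \<in> \<Omega>" for t x
    proof -
      have "((\<lambda>s. ut (s, x)) has_integral (u (t, x) - u (0, x))) {0..t}"
        using t by (intro fundamental_theorem_of_calculus has_vector_derivative_within_subset[OF ut(1)[OF _ cl[OF x]]]) auto
      then have "u (t, x) - u (0, x) = integral {0..t} (\<lambda>s. ut (s, x))" by (simp add: integral_unique)
      also have "\<dots> \<le> integral {0..t} (\<lambda>s. L (s, x) + u (s, x) * g (s, x))"
      proof (rule integral_le)
        show "(\<lambda>s. ut (s, x)) integrable_on {0..t}" by (rule time_integrable[OF ut(2) cl[OF x] t])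
        show "(\<lambda>s. L (s, x) + u (s, x) * g (s, x)) integrable_on {0..t}"
          using time_integrable[OF Lc cl[OF x] t] time_integrable[OF ugc cl[OF x] t] by (intro integrable_add)
        fix s assume "s \<in> {0..t}"
        then have s: "s \<in> {0..T}" using t by auto
        have "vector_derivative (\<lambda>s. u (s, x)) (at s within {0..T}) = ut (s, x)"
          using ut(1)[OF s cl[OF x]] s T by (intro vector_derivative_within_closed_interval) auto
        moreover have "vector_derivative (\<lambda>s. u (s, x)) (at s within {0..T})
           - laplacian (\<lambda>y. w (s, y)) x \<le> u (s, x) * f (s, x)"
          unfolding w_def using pde s x by blast
        ultimately have "ut (s, x) - L (s, x) \<le> u (s, x) * f (s, x)"
          using lap[OF s x] by (simp add: L_def)
        also have "\<dots> \<le> u (s, x) * g (s, x)"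
          using un[OF s cl[OF x]] by (intro mult_left_mono) (auto simp: g_def)
        finally show "ut (s, x) \<le> L (s, x) + u (s, x) * g (s, x)" by simp
      qed
      also have "\<dots> = integral {0..t} (\<lambda>s. L (s, x)) + integral {0..t} (\<lambda>s. u (s, x) * g (s, x))"
        using time_integrable[OF Lc cl[OF x] t] time_integrable[OF ugc cl[OF x] t] by (intro integral_add)
      finally show ?thesis using init x by simp
    qed
    have "(LINT z:{0..T} \<times> \<Omega>|lborel. (u z)\<^sup>2) \<le> 2 * b\<^sup>2 * T / a\<^sup>2 * (LINT x:\<Omega>|lborel. (u_in x)\<^sup>2) *
      (1 + exp (4 * (1 / (2 * a * \<epsilon>)) * (C0 * T + (LINT z:{0..T} \<times> \<Omega>|lborel. g z powr p))))"
    proof (rule L2_estimate[OF wc uc gc uic G(2)])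
      show "integral {0..r} (\<lambda>t. LINT x:\<Omega>|lborel. u (t, x) * w (t, x))
          + (LINT x:\<Omega>|lborel. (norm (integral {0..r} (\<lambda>s. G (s, x))))\<^sup>2) / 2
        \<le> integral {0..r} (\<lambda>t. LINT x:\<Omega>|lborel. u_in x * w (t, x))
          + (LINT x:\<Omega>|lborel. integral {0..r} (\<lambda>s. w (s, x)) * integral {0..r} (\<lambda>s. u (s, x) * g (s, x)))"
        if "r \<in> {0..T}" for r
        by (rule energy_inequality[OF assms(3,4) wc wn uc un gc _ uic G DG flux ineq[unfolded L_def] that])
          (auto simp: g_def)
      show "(LINT x:\<Omega>|lborel. (v x)\<^sup>2 * (g x)\<^sup>2) \<le>
          (LINT x:\<Omega>|lborel. (v x)\<^sup>2 + (norm (G x))\<^sup>2) * (C0 + (LINT x:\<Omega>|lborel. g x powr p))"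
        if "C1_bounded \<Omega> v G" "\<forall>x\<in>\<Omega>. v x \<ge> 0" "continuous_on \<Omega> g" "bounded (g ` \<Omega>)" "\<forall>x\<in>\<Omega>. g x \<ge> 0" for v G g
        by (rule weighted[OF that])
    qed (use assms C0 \<epsilon> ab un G u_in in \<open>auto simp: g_def\<close>)
    also have "(LINT z:{0..T} \<times> \<Omega>|lborel. g z powr p) = Lp_norm_on p ({0..T} \<times> \<Omega>) f powr p"
      using assms(7) by (simp add: Lp_norm_on_powr g_def)
    finally have "sqrt (LINT z:{0..T} \<times> \<Omega>|lborel. (u z)\<^sup>2) \<le>
      sqrt (2 * b\<^sup>2 * T / a\<^sup>2 * (LINT x:\<Omega>|lborel. (u_in x)\<^sup>2) *
      (1 + exp (4 * (1 / (2 * a * \<epsilon>)) * (C0 * T + Lp_norm_on p ({0..T} \<times> \<Omega>) f powr p))))"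
      by (rule real_sqrt_le_mono)
    also have "\<dots> = C (Lp_norm_on p ({0..T} \<times> \<Omega>) f) * sqrt (LINT x:\<Omega>|lborel. (u_in x)\<^sup>2)"
      unfolding C_def real_sqrt_mult[symmetric] by (rule arg_cong[of _ _ sqrt]) (simp add: mult_ac)
    finally show "Lp_norm_on 2 ({0..T} \<times> \<Omega>) u \<le> C (Lp_norm_on p ({0..T} \<times> \<Omega>) f) * Lp_norm_on 2 \<Omega> u_in"
      by (simp add: Lp_norm_on_2)
  qed
qed

end
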